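(* Let $\mathbb{K}$ be a field, let $1\le k\le n$ be integers, and let $\beta\le\gamma$ be $k$-element subsets of $[n]$. Then the localized homogeneous coordinate ring $\mathring{A}_\beta^\gamma$ of the open Richardson variety is a unique factorization domain.
   Context: $[n]=\{1,\dots,n\}$ and $\mathcal{S}(k,n)$ is the set of $k$-element subsets of $[n]$. For $\alpha\in\mathcal{S}(k,n)$, $\alpha(i)$ is the $i$-th smallest element of $\alpha$. Partial order: $\alpha\le\alpha'$ iff $\alpha(i)\le\alpha'(i)$ for all $i=1,\dots,k$; $[\beta,\gamma]=\{\alpha\in\mathcal{S}(k,n)\mid \beta\le\alpha\le\gamma\}$. $A=\mathbb{K}[\Delta_\alpha\mid\alpha\in\mathcal{S}(k,n)]/I$ is the Plücker coordinate ring of the Grassmannian $\mathrm{Gr}(k,n)=\mathrm{Proj}\,A$: the $\Delta_\alpha$ are indeterminates (Plücker coordinates) and $I$ is the Plücker ideal, i.e. the ideal generated by the quadratic Plücker relations; equivalently, the kernel of the map $\Delta_\alpha\mapsto$ the maximal minor with column set $\alpha$ of a generic $k\times n$ matrix of indeterminates over $\mathbb{K}$. $A_\beta^\gamma=A/\langle\Delta_\alpha\mid\alpha\notin[\beta,\gamma]\rangle$ and $\mathring{A}_\beta^\gamma=A_\beta^\gamma[\Delta_\beta^{-1},\Delta_\gamma^{-1}]$. *)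

theory Defs
  imports
    "HOL-Algebra.Ring_Divisibility"
    "HOL-Library.Poly_Mapping"
    "Jordan_Normal_Form.Determinant"
begin

definition k_subsets :: "nat \<Rightarrow> nat \<Rightarrow> nat set set" where
  "k_subsets k n = {\<alpha>. \<alpha> \<subseteq> {1..n} \<and> card \<alpha> = k}"

(* elt a i is the i-th smallest element of a, counted from i = 1 *)
definition elt :: "nat set \<Rightarrow> nat \<Rightarrow> nat" where
  "elt \<alpha> i = sorted_list_of_set \<alpha> ! (i - 1)"

definition subset_le :: "nat \<Rightarrow> nat set \<Rightarrow> nat set \<Rightarrow> bool" where
  "subset_le k \<alpha> \<alpha>' \<longleftrightarrow> (\<forall>i\<in>{1..k}. elt \<alpha> i \<le> elt \<alpha>' i)"

definition subset_interval :: "nat \<Rightarrow> nat \<Rightarrow> nat set \<Rightarrow> nat set \<Rightarrow> nat set set" where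
  "subset_interval k n \<beta> \<gamma> = {\<alpha> \<in> k_subsets k n. subset_le k \<beta> \<alpha> \<and> subset_le k \<alpha> \<gamma>}"

(* Outer keys are monomials (exponent functions), inner keys are indeterminates. *)
type_synonym ('x, 'k) mpoly = "('x \<Rightarrow>\<^sub>0 nat) \<Rightarrow>\<^sub>0 'k"

definition mvar :: "'x \<Rightarrow> ('x, 'k::field) mpoly" where
  "mvar x = Poly_Mapping.single (Poly_Mapping.single x 1) 1"

definition mconst :: "'k \<Rightarrow> ('x, 'k::field) mpoly" where
  "mconst c = Poly_Mapping.single 0 c"

(* The polynomial ring K[x | x in V], as a ring in the sense of HOL-Algebra. *)
definition mpoly_ring :: "'x set \<Rightarrow> ('x, 'k::field) mpoly ring" where
  "mpoly_ring V =
    \<lparr>carrier = {p. \<forall>m\<in>Poly_Mapping.keys p. Poly_Mapping.keys m \<subseteq> V},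
     mult = (*), one = 1, zero = 0, add = (+)\<rparr>"

(* The K-algebra homomorphism sending each indeterminate x to f x. *)
definition mpoly_subst ::
    "('x \<Rightarrow> ('y, 'k) mpoly) \<Rightarrow> ('x, 'k::field) mpoly \<Rightarrow> ('y, 'k) mpoly" where
  "mpoly_subst f p =
    (\<Sum>m\<in>Poly_Mapping.keys p. mconst (Poly_Mapping.lookup p m) *
       (\<Prod>x\<in>Poly_Mapping.keys m. f x ^ Poly_Mapping.lookup m x))"

(* Maximal minor with column set a of the generic k x n matrix (x_ij), 1 <= i <= k, 1 <= j <= n;
   matrices are indexed from 0 in the library. *)
definition generic_minor :: "nat \<Rightarrow> nat set \<Rightarrow> (nat \<times> nat, 'k::field) mpoly" where
  "generic_minor k \<alpha> = Determinant.det (mat k k (\<lambda>(i, j). mvar (i + 1, elt \<alpha> (j + 1))))"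

definition coord_ring :: "nat \<Rightarrow> nat \<Rightarrow> (nat set, 'k::field) mpoly ring" where
  "coord_ring k n = mpoly_ring (k_subsets k n)"

(* The kernel of the map sending each coordinate to the corresponding maximal minor. *)
definition pluecker_ideal :: "nat \<Rightarrow> nat \<Rightarrow> (nat set, 'k::field) mpoly set" where
  "pluecker_ideal k n =
    a_kernel (coord_ring k n) (mpoly_ring ({1..k} \<times> {1..n})) (mpoly_subst (generic_minor k))"

definition pluecker_ring :: "nat \<Rightarrow> nat \<Rightarrow> (nat set, 'k::field) mpoly set ring" where
  "pluecker_ring k n = coord_ring k n Quot pluecker_ideal k n"

definition pluecker_coord :: "nat \<Rightarrow> nat \<Rightarrow> nat set \<Rightarrow> (nat set, 'k::field) mpoly set" where
  "pluecker_coord k n \<alpha> = pluecker_ideal k n +>\<^bsub>coord_ring k n\<^esub> mvar \<alpha>"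

(* Equivalence class of the fraction r / s; the factor t is needed because S may contain
   zero divisors. *)
definition loc_frac :: "('a, 'm) ring_scheme \<Rightarrow> 'a set \<Rightarrow> 'a \<Rightarrow> 'a \<Rightarrow> ('a \<times> 'a) set" where
  "loc_frac R S r s =
    {(r', s') \<in> carrier R \<times> S.
       \<exists>t\<in>S. t \<otimes>\<^bsub>R\<^esub> (r \<otimes>\<^bsub>R\<^esub> s') = t \<otimes>\<^bsub>R\<^esub> (r' \<otimes>\<^bsub>R\<^esub> s)}"

(* The unions run over all representatives of the two classes; every representative yields the
   same class when S is multiplicatively closed and contains one. *)
definition localization :: "('a, 'm) ring_scheme \<Rightarrow> 'a set \<Rightarrow> ('a \<times> 'a) set ring" where
  "localization R S =
    \<lparr>carrier = {loc_frac R S r s | r s. r \<in> carrier R \<and> s \<in> S},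
     mult = (\<lambda>P Q. \<Union>(r, s)\<in>P. \<Union>(r', s')\<in>Q. loc_frac R S (r \<otimes>\<^bsub>R\<^esub> r') (s \<otimes>\<^bsub>R\<^esub> s')),
     one = loc_frac R S \<one>\<^bsub>R\<^esub> \<one>\<^bsub>R\<^esub>,
     zero = loc_frac R S \<zero>\<^bsub>R\<^esub> \<one>\<^bsub>R\<^esub>,
     add = (\<lambda>P Q. \<Union>(r, s)\<in>P. \<Union>(r', s')\<in>Q.
       loc_frac R S (r \<otimes>\<^bsub>R\<^esub> s' \<oplus>\<^bsub>R\<^esub> r' \<otimes>\<^bsub>R\<^esub> s) (s \<otimes>\<^bsub>R\<^esub> s'))\<rparr>"

(* R[b^-1, c^-1], localizing at the multiplicative set generated by b and c. *)
definition invert2 :: "('a, 'm) ring_scheme \<Rightarrow> 'a \<Rightarrow> 'a \<Rightarrow> ('a \<times> 'a) set ring" where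
  "invert2 R b c =
    localization R {(b [^]\<^bsub>R\<^esub> i) \<otimes>\<^bsub>R\<^esub> (c [^]\<^bsub>R\<^esub> j) | (i::nat) (j::nat). True}"

definition richardson_ideal ::
    "nat \<Rightarrow> nat \<Rightarrow> nat set \<Rightarrow> nat set \<Rightarrow> (nat set, 'k::field) mpoly set set" where
  "richardson_ideal k n \<beta> \<gamma> =
    Idl\<^bsub>pluecker_ring k n\<^esub> (pluecker_coord k n ` (k_subsets k n - subset_interval k n \<beta> \<gamma>))"

definition richardson_ring ::
    "nat \<Rightarrow> nat \<Rightarrow> nat set \<Rightarrow> nat set \<Rightarrow> (nat set, 'k::field) mpoly set set ring" where
  "richardson_ring k n \<beta> \<gamma> = pluecker_ring k n Quot richardson_ideal k n \<beta> \<gamma>"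

definition richardson_coord ::
    "nat \<Rightarrow> nat \<Rightarrow> nat set \<Rightarrow> nat set \<Rightarrow> nat set \<Rightarrow> (nat set, 'k::field) mpoly set set" where
  "richardson_coord k n \<beta> \<gamma> \<alpha> =
    richardson_ideal k n \<beta> \<gamma> +>\<^bsub>pluecker_ring k n\<^esub> pluecker_coord k n \<alpha>"

(* The argument of type 'k itself only serves to name the ground field. *)
definition open_richardson_ring ::
    "'k::field itself \<Rightarrow> nat \<Rightarrow> nat \<Rightarrow> nat set \<Rightarrow> nat set \<Rightarrow>
     ((nat set, 'k) mpoly set set \<times> (nat set, 'k) mpoly set set) set ring" where
  "open_richardson_ring K k n \<beta> \<gamma> =
    invert2 (richardson_ring k n \<beta> \<gamma>)
      (richardson_coord k n \<beta> \<gamma> \<beta>) (richardson_coord k n \<beta> \<gamma> \<gamma>)"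

end

theory Submission
  imports Defs "HOL-Library.Product_Lexorder" "HOL-Library.Nat_Bijection"
begin

text \<open>
The coordinate ring of the open Richardson variety is a retract of a localized polynomial ring,
and a retract of a factorial ring is factorial.

The geometry behind this is as follows. Let \<open>X\<close> be the variety of echelon matrices \<open>M\<close> with pivot
columns \<open>\<beta>\<close>, all pivots being equal and nonzero, and with a nonzero minor at \<open>\<gamma>\<close>. Its coordinate ring
is a polynomial ring with two elements inverted, so it is factorial. A unipotent group acts on
\<open>X\<close>, by adding multiples of the columns in \<open>\<gamma>\<close> to columns further to the right that are not in \<open>\<gamma>\<close>.
Every orbit contains exactly one normalized matrix: one for which each row of \<open>M\<^sub>\<gamma>\<^sup>-\<^sup>1 M\<close> vanishes to the
right of its unit vector in the columns \<open>\<gamma>\<close>. The maximal minors of a normalized matrix outside the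
interval from \<open>\<beta>\<close> to \<open>\<gamma>\<close> vanish, so it represents a point of the (cone over the) open Richardson
variety. Conversely such a point is represented by the reduced echelon matrix scaled to have all
pivots equal to \<open>\<Delta>\<^sub>\<beta>\<close>; its entries are zero or Pluecker coordinates up
to sign, and it is normalized. So normalization exhibits that cone as a retract of \<open>X\<close>.

In algebraic terms, \<open>\<psi>\<close> sends a Pluecker coordinate to the corresponding (suitably scaled) minor of
the normalized generic matrix, and \<open>\<pi>\<close> sends the entries of the generic echelon matrix to
Pluecker coordinates. The lemma \<open>numerator\<close> states that \<open>\<pi>\<close> inverts \<open>\<psi>\<close> up to denominators, modulo any ideal that
contains the defining equations. It has two consequences: \<open>\<psi>\<close> is injective on the localized
coordinate ring (\<open>kernel_torsion\<close>), which therefore may be computed inside a field, and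
\<open>\<psi> \<circ> \<pi>\<close> induces a retraction onto the image of \<open>\<psi>\<close> (\<open>ufd_image\<close>). No knowledge about the
ideal of the Richardson variety, such as primality or a standard monomial basis, is needed.

Two general facts are proved on the way: \<open>ufd_on_retract\<close> on retracts, and Gauss's theorem
that polynomial rings over a field are factorial (\<open>gauss_ufd\<close>, \<open>ufd_on_UNIV_mpoly\<close>).
\<close>

section \<open>Factorial subrings\<close>

text \<open>Divisibility is developed for subsets \<open>S\<close> of a commutative ring type, so that one and the same
element can be studied relative to several subrings. The suffix \<open>_on\<close> marks a notion relative to
the subring \<open>S\<close>: units, quotients and cofactors are required to lie in \<open>S\<close>.\<close>

definition is_subring :: "'a::comm_ring_1 set \<Rightarrow> bool" where
  "is_subring S \<longleftrightarrow> 1 \<in> S \<and> (\<forall>a\<in>S. \<forall>b\<in>S. a - b \<in> S \<and> a * b \<in> S)"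

lemma is_subringI:
  assumes "1 \<in> S" "\<And>a b. a \<in> S \<Longrightarrow> b \<in> S \<Longrightarrow> a - b \<in> S"
    "\<And>a b. a \<in> S \<Longrightarrow> b \<in> S \<Longrightarrow> a * b \<in> S"
  shows "is_subring S"
  using assms by (simp add: is_subring_def)

lemma
  assumes "is_subring S"
  shows is_subring_one: "1 \<in> S"
    and is_subring_diff: "a \<in> S \<Longrightarrow> b \<in> S \<Longrightarrow> a - b \<in> S"
    and is_subring_mult: "a \<in> S \<Longrightarrow> b \<in> S \<Longrightarrow> a * b \<in> S"
    and is_subring_zero: "0 \<in> S"
    and is_subring_uminus: "a \<in> S \<Longrightarrow> - a \<in> S"
    and is_subring_add: "a \<in> S \<Longrightarrow> b \<in> S \<Longrightarrow> a + b \<in> S"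
proof -
  show 1: "1 \<in> S" and d: "\<And>a b. a \<in> S \<Longrightarrow> b \<in> S \<Longrightarrow> a - b \<in> S"
    and "a \<in> S \<Longrightarrow> b \<in> S \<Longrightarrow> a * b \<in> S"
    using assms by (auto simp: is_subring_def)
  show 0: "0 \<in> S" using d[OF 1 1] by simp
  show m: "- a \<in> S" if "a \<in> S" for a using d[OF 0 that] by simp
  show "a + b \<in> S" if "a \<in> S" "b \<in> S" using d[OF that(1) m[OF that(2)]] by simp
qed

lemma is_subring_power: "is_subring S \<Longrightarrow> a \<in> S \<Longrightarrow> a ^ n \<in> S"
  by (induction n) (auto intro: is_subring_one is_subring_mult)

lemma is_subring_sum: "is_subring S \<Longrightarrow> (\<And>i. i \<in> I \<Longrightarrow> f i \<in> S) \<Longrightarrow> sum f I \<in> S"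
  by (induction I rule: infinite_finite_induct) (auto intro: is_subring_zero is_subring_add)

lemma is_subring_prod: "is_subring S \<Longrightarrow> (\<And>i. i \<in> I \<Longrightarrow> f i \<in> S) \<Longrightarrow> prod f I \<in> S"
  by (induction I rule: infinite_finite_induct) (auto intro: is_subring_one is_subring_mult)

lemma is_subring_prod_list: "is_subring S \<Longrightarrow> set xs \<subseteq> S \<Longrightarrow> prod_list xs \<in> S"
  by (induction xs) (auto intro: is_subring_one is_subring_mult)

definition dvd_on :: "'a::comm_ring_1 set \<Rightarrow> 'a \<Rightarrow> 'a \<Rightarrow> bool" where
  "dvd_on S a b \<longleftrightarrow> (\<exists>c\<in>S. b = a * c)"

definition unit_on :: "'a::comm_ring_1 set \<Rightarrow> 'a \<Rightarrow> bool" where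
  "unit_on S u \<longleftrightarrow> u \<in> S \<and> (\<exists>v\<in>S. u * v = 1)"

definition prime_on :: "'a::comm_ring_1 set \<Rightarrow> 'a \<Rightarrow> bool" where
  "prime_on S p \<longleftrightarrow> p \<in> S \<and> p \<noteq> 0 \<and> \<not> unit_on S p \<and>
     (\<forall>a\<in>S. \<forall>b\<in>S. dvd_on S p (a * b) \<longrightarrow> dvd_on S p a \<or> dvd_on S p b)"

text \<open>A product of finitely many primes of \<open>S\<close>, up to a unit. Asking this of every nonzero element is
equivalent to unique factorization, and it passes easily to other rings.\<close>

definition prime_factored :: "'a::comm_ring_1 set \<Rightarrow> 'a \<Rightarrow> bool" where
  "prime_factored S a \<longleftrightarrow>
     (\<exists>u ps. unit_on S u \<and> (\<forall>p\<in>set ps. prime_on S p) \<and> a = u * prod_list ps)"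

definition ufd_on :: "'a::idom set \<Rightarrow> bool" where
  "ufd_on S \<longleftrightarrow> is_subring S \<and> (\<forall>a\<in>S. a \<noteq> 0 \<longrightarrow> prime_factored S a)"

lemma unit_on_one: "is_subring S \<Longrightarrow> unit_on S 1"
  unfolding unit_on_def by (auto intro: is_subring_one)

lemma unit_on_mult:
  assumes "is_subring S" "unit_on S u" "unit_on S v" shows "unit_on S (u * v)"
proof -
  obtain u' v' where *: "u' \<in> S" "u * u' = 1" "v' \<in> S" "v * v' = 1"
    using assms unfolding unit_on_def by auto
  have "u * v * (u' * v') = (u * u') * (v * v')" by (simp add: algebra_simps)
  then show ?thesis
    using * assms unfolding unit_on_def by (auto intro!: is_subring_mult bexI[of _ "u' * v'"])
qed

lemma prime_factored_unit: "unit_on S u \<Longrightarrow> prime_factored S u"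
  unfolding prime_factored_def by (rule exI[of _ u], rule exI[of _ "[]"]) simp

lemma prime_factored_prime: "is_subring S \<Longrightarrow> prime_on S p \<Longrightarrow> prime_factored S p"
  unfolding prime_factored_def by (rule exI[of _ 1], rule exI[of _ "[p]"]) (simp add: unit_on_one)

lemma prime_factored_mult:
  assumes S: "is_subring S" and "prime_factored S a" "prime_factored S b"
  shows "prime_factored S (a * b)"
proof -
  obtain u ps v qs where *: "unit_on S u" "\<forall>p\<in>set ps. prime_on S p" "a = u * prod_list ps"
    "unit_on S v" "\<forall>p\<in>set qs. prime_on S p" "b = v * prod_list qs"
    using assms unfolding prime_factored_def by blast
  show ?thesis unfolding prime_factored_def
    by (rule exI[of _ "u * v"], rule exI[of _ "ps @ qs"])
       (use * unit_on_mult[OF S] in auto)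
qed

lemma prime_factored_prod_list:
  assumes "is_subring S" "\<And>p. p \<in> set ps \<Longrightarrow> prime_factored S p"
  shows "prime_factored S (prod_list ps)"
  using assms(2) by (induction ps)
    (auto intro: prime_factored_mult assms prime_factored_unit unit_on_one)

lemma prime_on_dvd_prod_list:
  assumes "is_subring S" "prime_on S p" "set qs \<subseteq> S" "dvd_on S p (prod_list qs)"
  shows "\<exists>q\<in>set qs. dvd_on S p q"
  using assms(3,4)
proof (induction qs)
  case Nil
  then show ?case using assms(2) unfolding prime_on_def unit_on_def dvd_on_def by auto
next
  case (Cons q qs)
  then have "dvd_on S p q \<or> dvd_on S p (prod_list qs)"
    using assms(1,2) is_subring_prod_list[of S qs] unfolding prime_on_def by auto
  then show ?case using Cons by auto
qed

lemma prime_on_not_dvd_unit: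
  assumes "is_subring S" "prime_on S p" "unit_on S u" shows "\<not> dvd_on S p u"
proof
  assume "dvd_on S p u"
  then obtain c where c: "c \<in> S" "u = p * c" unfolding dvd_on_def by auto
  obtain v where v: "v \<in> S" "u * v = 1" using assms unfolding unit_on_def by auto
  have "unit_on S p" unfolding unit_on_def
    using assms c v by (auto simp: prime_on_def mult.assoc intro!: bexI[of _ "c * v"] is_subring_mult)
  then show False using assms by (auto simp: prime_on_def)
qed

section \<open>Polynomials over a factorial subring\<close>

text \<open>The polynomial ring \<open>D[X]\<close>, as a set of polynomials over the ambient ring of \<open>D\<close>.\<close>

definition polys_over :: "'a::comm_ring_1 set \<Rightarrow> 'a poly set" where
  "polys_over D = {q. \<forall>i. coeff q i \<in> D}"

lemma coeff_in_base: "q \<in> polys_over D \<Longrightarrow> coeff q i \<in> D"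
  by (simp add: polys_over_def)

lemma is_subring_polys_over:
  assumes D: "is_subring D" shows "is_subring (polys_over D)"
proof (rule is_subringI)
  show "1 \<in> polys_over D"
    using D by (auto simp: polys_over_def coeff_pCons one_pCons is_subring_one is_subring_zero split: nat.split)
  show "a - b \<in> polys_over D" if "a \<in> polys_over D" "b \<in> polys_over D" for a b
    using that D by (auto simp: polys_over_def is_subring_diff)
  show "a * b \<in> polys_over D" if "a \<in> polys_over D" "b \<in> polys_over D" for a b
    using that unfolding polys_over_def coeff_mult mem_Collect_eq
    by (intro allI is_subring_sum[OF D] is_subring_mult[OF D]) auto
qed

lemma const_in_polys_over [simp]:
  assumes "is_subring D" shows "[:c:] \<in> polys_over D \<longleftrightarrow> c \<in> D"
proof
  assume "[:c:] \<in> polys_over D" then show "c \<in> D" using coeff_in_base[of "[:c:]" D 0] by simp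
next
  assume "c \<in> D" then show "[:c:] \<in> polys_over D"
    using assms by (auto simp: polys_over_def coeff_pCons is_subring_zero split: nat.split)
qed

lemma smult_in_polys_over:
  assumes "is_subring D" "c \<in> D" "q \<in> polys_over D" shows "smult c q \<in> polys_over D"
  using assms by (auto simp: polys_over_def is_subring_mult)

lemma monom_in_polys_over:
  assumes "is_subring D" "c \<in> D" shows "Polynomial.monom c n \<in> polys_over D"
  using assms by (auto simp: polys_over_def is_subring_zero)

lemma dvd_on_const_iff:
  fixes c :: "'a::idom"
  assumes D: "is_subring D" and c: "c \<noteq> 0"
  shows "dvd_on (polys_over D) [:c:] q \<longleftrightarrow> (\<forall>i. dvd_on D c (coeff q i))"
proof
  assume "dvd_on (polys_over D) [:c:] q"
  then show "\<forall>i. dvd_on D c (coeff q i)" unfolding dvd_on_def by (auto simp: coeff_in_base)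
next
  assume *: "\<forall>i. dvd_on D c (coeff q i)"
  define w where "w a = (SOME b. b \<in> D \<and> a = c * b)" for a
  have w: "w (coeff q i) \<in> D \<and> coeff q i = c * w (coeff q i)" for i
  proof -
    have "\<exists>b. b \<in> D \<and> coeff q i = c * b" using * unfolding dvd_on_def by blast
    then show ?thesis unfolding w_def by (rule someI_ex)
  qed
  have w0: "w 0 = 0"
  proof -
    have "w 0 \<in> D \<and> 0 = c * w 0" unfolding w_def
      by (rule someI[of _ 0]) (use D in \<open>auto simp: is_subring_zero\<close>)
    then show ?thesis using c by simp
  qed
  have co: "coeff (map_poly w q) i = w (coeff q i)" for i
    by (simp add: coeff_map_poly w0)
  have "map_poly w q \<in> polys_over D" using w co by (auto simp: polys_over_def)
  moreover have "q = [:c:] * map_poly w q"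
  proof (rule poly_eqI)
    fix i show "coeff q i = coeff ([:c:] * map_poly w q) i"
      using w[of i] by (simp add: co)
  qed
  ultimately show "dvd_on (polys_over D) [:c:] q" unfolding dvd_on_def by blast
qed

lemma unit_on_const:
  assumes "is_subring D" "unit_on D u" shows "unit_on (polys_over D) [:u:]"
proof -
  obtain v where "v \<in> D" "u * v = 1" using assms by (auto simp: unit_on_def)
  then show ?thesis using assms unfolding unit_on_def
    by (auto intro!: bexI[of _ "[:v:]"] simp: one_pCons)
qed

lemma dvd_on_add:
  "is_subring S \<Longrightarrow> dvd_on S p a \<Longrightarrow> dvd_on S p b \<Longrightarrow> dvd_on S p (a + b)"
  unfolding dvd_on_def by (metis distrib_left is_subring_add)

lemma dvd_on_diff:
  "is_subring S \<Longrightarrow> dvd_on S p a \<Longrightarrow> dvd_on S p b \<Longrightarrow> dvd_on S p (a - b)"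
  unfolding dvd_on_def by (metis right_diff_distrib is_subring_diff)

lemma dvd_on_mult_right:
  "is_subring S \<Longrightarrow> dvd_on S p a \<Longrightarrow> b \<in> S \<Longrightarrow> dvd_on S p (a * b)"
  unfolding dvd_on_def by (metis mult.assoc is_subring_mult)

lemma dvd_on_mult_left:
  "is_subring S \<Longrightarrow> dvd_on S p b \<Longrightarrow> a \<in> S \<Longrightarrow> dvd_on S p (a * b)"
  using dvd_on_mult_right[of S p b a] by (simp add: mult.commute)

lemma dvd_on_sum:
  "is_subring S \<Longrightarrow> (\<And>i. i \<in> I \<Longrightarrow> dvd_on S p (f i)) \<Longrightarrow> dvd_on S p (sum f I)"
proof (induction I rule: infinite_finite_induct)
  case (insert x F) then show ?case by (auto intro: dvd_on_add)
qed (auto simp: dvd_on_def intro: bexI[of _ 0] is_subring_zero)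

text \<open>A prime of the coefficient ring stays prime: in a product of two polynomials that it does not
divide, look at the product of the first coefficients that it does not divide.\<close>

lemma prime_on_const:
  fixes p :: "'a::idom"
  assumes D: "is_subring D" and p: "prime_on D p"
  shows "prime_on (polys_over D) [:p:]"
proof -
  let ?X = "polys_over D"
  have X: "is_subring ?X" by (rule is_subring_polys_over[OF D])
  have p0: "p \<noteq> 0" "p \<in> D" using p by (auto simp: prime_on_def)
  note iff = dvd_on_const_iff[OF D p0(1)]
  have "\<not> unit_on ?X [:p:]"
  proof
    assume "unit_on ?X [:p:]"
    then obtain v where v: "v \<in> ?X" "[:p:] * v = 1" by (auto simp: unit_on_def)
    then have "coeff ([:p:] * v) 0 = 1" by simp
    then have "p * coeff v 0 = 1" by simp
    then have "unit_on D p" using p0 coeff_in_base[OF v(1), of 0] by (auto simp: unit_on_def)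
    then show False using p by (simp add: prime_on_def)
  qed
  moreover have "dvd_on ?X [:p:] a \<or> dvd_on ?X [:p:] b"
    if a: "a \<in> ?X" and b: "b \<in> ?X" and ab: "dvd_on ?X [:p:] (a * b)" for a b
  proof (rule ccontr)
    assume "\<not> ?thesis"
    then obtain i0 j0 where ij0: "\<not> dvd_on D p (coeff a i0)" "\<not> dvd_on D p (coeff b j0)"
      unfolding iff by auto
    define i where "i = (LEAST i. \<not> dvd_on D p (coeff a i))"
    define j where "j = (LEAST j. \<not> dvd_on D p (coeff b j))"
    have i: "\<not> dvd_on D p (coeff a i)" unfolding i_def by (rule LeastI, rule ij0)
    have j: "\<not> dvd_on D p (coeff b j)" unfolding j_def by (rule LeastI, rule ij0)
    have li: "dvd_on D p (coeff a l)" if "l < i" for l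
      using that not_less_Least unfolding i_def by blast
    have lj: "dvd_on D p (coeff b l)" if "l < j" for l
      using that not_less_Least unfolding j_def by blast
    have "coeff (a * b) (i + j) = (\<Sum>l\<le>i+j. coeff a l * coeff b (i + j - l))"
      by (simp add: coeff_mult)
    also have "\<dots> = coeff a i * coeff b j + (\<Sum>l\<in>{..i+j}-{i}. coeff a l * coeff b (i + j - l))"
      by (subst sum.remove[of _ i]) auto
    finally have eq: "coeff a i * coeff b j
       = coeff (a * b) (i + j) - (\<Sum>l\<in>{..i+j}-{i}. coeff a l * coeff b (i + j - l))" by simp
    have "dvd_on D p (\<Sum>l\<in>{..i+j}-{i}. coeff a l * coeff b (i + j - l))"
    proof (rule dvd_on_sum[OF D])
      fix l assume l: "l \<in> {..i+j}-{i}"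
      show "dvd_on D p (coeff a l * coeff b (i + j - l))"
      proof (cases "l < i")
        case True then show ?thesis using li D b by (auto intro: dvd_on_mult_right simp: coeff_in_base)
      next
        case False
        then have "i + j - l < j" using l by auto
        then show ?thesis using lj D a by (auto intro: dvd_on_mult_left simp: coeff_in_base)
      qed
    qed
    then have "dvd_on D p (coeff a i * coeff b j)"
      unfolding eq using ab[unfolded iff] D by (auto intro: dvd_on_diff)
    then show False
      using p i j coeff_in_base[OF a, of i] coeff_in_base[OF b, of j] unfolding prime_on_def by blast
  qed
  ultimately show ?thesis using p0 D unfolding prime_on_def by auto
qed

text \<open>Gauss's theorem for a factorial subring \<open>D\<close>. Fractions of \<open>D\<close> are avoided: the Euclidean argument
over the fraction field is replaced by pseudo-division, and denominators are removed afterwards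
by cancelling primes of \<open>D\<close> against a primitive factor.\<close>

locale factorial_subring =
  fixes D :: "'a::idom set"
  assumes ufd: "ufd_on D"
begin

abbreviation "DX \<equiv> polys_over D"

lemma subring_D: "is_subring D" using ufd by (simp add: ufd_on_def)

lemma subring_DX: "is_subring DX" by (rule is_subring_polys_over[OF subring_D])

text \<open>Primitivity is expressed through prime divisors instead of the greatest common divisor of the
coefficients.\<close>

definition primitive :: "'a poly \<Rightarrow> bool" where
  "primitive f \<longleftrightarrow> f \<in> DX \<and> f \<noteq> 0 \<and> (\<forall>p. prime_on D p \<longrightarrow> \<not> dvd_on DX [:p:] f)"

lemma prime_factored_const:
  assumes "c \<in> D" "c \<noteq> 0" shows "prime_factored DX [:c:]"
proof -
  obtain u ps where *: "unit_on D u" "\<forall>p\<in>set ps. prime_on D p" "c = u * prod_list ps"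
    using ufd assms unfolding ufd_on_def prime_factored_def by blast
  have "[:prod_list ps:] = prod_list (map (\<lambda>p. [:p:]) ps)"
    by (induction ps) (simp_all add: one_pCons, metis smult_0_right smult_pCons)
  then have "[:c:] = [:u:] * prod_list (map (\<lambda>p. [:p:]) ps)"
    using * by (metis smult_0_right smult_pCons mult_pCons_left add.right_neutral pCons_0_0 mult_zero_left)
  then show ?thesis
    using * unfolding prime_factored_def
    by (auto intro!: exI[of _ "[:u:]"] exI[of _ "map (\<lambda>p. [:p:]) ps"] unit_on_const subring_D prime_on_const)
qed

lemma content_primitive:
  assumes "f \<in> DX" "f \<noteq> 0"
  shows "\<exists>c g. c \<in> D \<and> c \<noteq> 0 \<and> primitive g \<and> f = smult c g"
proof -
  have "lead_coeff f \<in> D" "lead_coeff f \<noteq> 0" using assms by (auto simp: coeff_in_base)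
  then obtain u ps where *: "unit_on D u" "\<forall>p\<in>set ps. prime_on D p" "lead_coeff f = u * prod_list ps"
    using ufd unfolding ufd_on_def prime_factored_def by blast
  \<comment> \<open>Every common prime divisor of the coefficients uses up one prime factor of the leading one.\<close>
  then show ?thesis using assms
  proof (induction "length ps" arbitrary: f u ps)
    case 0
    then have lc: "unit_on D (lead_coeff f)" by simp
    have "primitive f" unfolding primitive_def
    proof (intro conjI allI impI)
      fix p assume p: "prime_on D p"
      then have "\<not> dvd_on D p (lead_coeff f)" using prime_on_not_dvd_unit[OF subring_D] lc by blast
      then show "\<not> dvd_on DX [:p:] f"
        using p dvd_on_const_iff[OF subring_D, of p f] by (auto simp: prime_on_def)
    qed (use 0 in auto)
    then show ?case by (intro exI[of _ 1] exI[of _ f]) (auto simp: is_subring_one[OF subring_D])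
  next
    case (Suc n)
    show ?case
    proof (cases "primitive f")
      case True
      then show ?thesis by (intro exI[of _ 1] exI[of _ f]) (auto simp: is_subring_one[OF subring_D])
    next
      case False
      then obtain p where p: "prime_on D p" "dvd_on DX [:p:] f"
        using Suc.prems by (auto simp: primitive_def)
      then obtain g where g: "g \<in> DX" "f = smult p g" by (auto simp: dvd_on_def)
      have p0: "p \<noteq> 0" "p \<in> D" using p by (auto simp: prime_on_def)
      have psD: "set ps \<subseteq> D" using Suc.prems(2) by (auto simp: prime_on_def)
      have lg: "lead_coeff f = p * lead_coeff g" using g p0 by simp
      have "dvd_on D p (prod_list ps)"
      proof -
        obtain v where v: "v \<in> D" "u * v = 1" using Suc.prems(1) by (auto simp: unit_on_def)
        have "prod_list ps = (u * v) * prod_list ps" using v by simp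
        also have "\<dots> = v * (p * lead_coeff g)" using Suc.prems(3) lg by (simp add: algebra_simps)
        also have "\<dots> = p * (v * lead_coeff g)" by (simp add: algebra_simps)
        finally show ?thesis unfolding dvd_on_def
          using v g subring_D by (auto intro!: is_subring_mult simp: coeff_in_base)
      qed
      then obtain q where q: "q \<in> set ps" "dvd_on D p q"
        using prime_on_dvd_prod_list[OF subring_D p(1) psD] by blast
      then obtain c where c: "c \<in> D" "q = p * c" by (auto simp: dvd_on_def)
      have pq: "prime_on D q" using q Suc.prems by auto
      have "\<not> dvd_on D q p \<Longrightarrow> dvd_on D q c"
        using pq p0 c unfolding prime_on_def dvd_on_def
        by (metis is_subring_one[OF subring_D] mult.right_neutral)
      moreover have "\<not> dvd_on D q c"
      proof
        assume "dvd_on D q c"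
        then obtain e where e: "e \<in> D" "c = q * e" by (auto simp: dvd_on_def)
        then have "c * 1 = c * (p * e)" using c by (simp add: algebra_simps)
        moreover have "c \<noteq> 0" using c pq by (auto simp: prime_on_def)
        ultimately have "p * e = 1" by (metis mult_left_cancel)
        then show False using p e p0 unfolding prime_on_def unit_on_def by auto
      qed
      ultimately obtain e where e: "e \<in> D" "p = q * e" unfolding dvd_on_def by auto
      have "p * (c * e) = p * 1" using c e by (simp add: algebra_simps)
      then have ce: "c * e = 1" using p0 by (metis mult_left_cancel)
      then have uc: "unit_on D c" using c e by (auto simp: unit_on_def)
      define qs where "qs = remove1 q ps"
      have perm: "prod_list ps = q * prod_list qs"
        using q(1) unfolding qs_def by (induction ps) (auto simp: algebra_simps)
      have "p * lead_coeff g = u * ((p * c) * prod_list qs)"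
        using lg Suc.prems(3) perm c(2) by metis
      also have "\<dots> = p * ((u * c) * prod_list qs)" by (simp only: ac_simps)
      finally have "p * lead_coeff g = p * ((u * c) * prod_list qs)" .
      then have lg': "lead_coeff g = (u * c) * prod_list qs" using p0 mult_left_cancel by blast
      have len: "n = length qs" using q Suc.hyps(2) by (simp add: qs_def length_remove1)
      have "set qs \<subseteq> set ps" unfolding qs_def by (rule set_remove1_subset)
      then have "\<exists>c h. c \<in> D \<and> c \<noteq> 0 \<and> primitive h \<and> g = smult c h"
        using Suc.hyps(1)[OF len unit_on_mult[OF subring_D Suc.prems(1) uc] _ lg' g(1)] Suc.prems g by auto
      then obtain d h where dh: "d \<in> D" "d \<noteq> 0" "primitive h" "g = smult d h" by blast
      then show ?thesis
        using g p0 subring_D by (intro exI[of _ "p * d"] exI[of _ h]) (auto simp: is_subring_mult)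
    qed
  qed
qed

text \<open>Constants can be cancelled in a divisibility by a primitive polynomial.\<close>

lemma primitive_cancel:
  assumes f: "primitive f" and c: "c \<in> D" "c \<noteq> 0" and h: "h \<in> DX" and dv: "dvd_on DX f (smult c h)"
  shows "dvd_on DX f h"
proof -
  obtain u ps where *: "unit_on D u" "\<forall>p\<in>set ps. prime_on D p" "c = u * prod_list ps"
    using ufd c unfolding ufd_on_def prime_factored_def by blast
  have fX: "f \<in> DX" using f by (simp add: primitive_def)
  from *(2) h dv[unfolded *(3)] show ?thesis
  proof (induction ps arbitrary: h)
    case Nil
    then obtain q where q: "q \<in> DX" "smult u h = f * q" by (auto simp: dvd_on_def)
    obtain v where v: "v \<in> D" "u * v = 1" using *(1) by (auto simp: unit_on_def)
    have "h = smult v (smult u h)" using v by (simp add: mult.commute)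
    then have "h = f * smult v q" using q by simp
    then show ?case using smult_in_polys_over[OF subring_D v(1) q(1)] unfolding dvd_on_def by blast
  next
    case (Cons p ps)
    have p: "prime_on D p" using Cons.prems by auto
    then have p0: "p \<noteq> 0" "p \<in> D" by (auto simp: prime_on_def)
    note P = prime_on_const[OF subring_D p]
    obtain q where q: "q \<in> DX" "smult (u * prod_list (p # ps)) h = f * q"
      using Cons.prems by (auto simp: dvd_on_def)
    have eq: "f * q = [:p:] * smult (u * prod_list ps) h"
      using q(2) by (simp add: algebra_simps)
    have sX: "smult (u * prod_list ps) h \<in> DX"
      using Cons.prems * by (auto intro!: smult_in_polys_over subring_D is_subring_mult is_subring_prod_list
          simp: unit_on_def prime_on_def)
    then have "dvd_on DX [:p:] (f * q)" unfolding eq dvd_on_def by blast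
    then have "dvd_on DX [:p:] q"
      using P fX q(1) f p unfolding prime_on_def primitive_def by blast
    then obtain r where r: "r \<in> DX" "q = [:p:] * r" by (auto simp: dvd_on_def)
    have "[:p:] * (f * r) = [:p:] * smult (u * prod_list ps) h" using eq r by (simp add: algebra_simps)
    then have "smult (u * prod_list ps) h = f * r" using p0 by (metis mult_left_cancel pCons_eq_0_iff)
    then have "dvd_on DX f (smult (u * prod_list ps) h)" using r by (auto simp: dvd_on_def)
    then show ?case using Cons by auto
  qed
qed

lemma primitive_const_unit:
  assumes "primitive [:c:]" shows "unit_on D c"
proof -
  have c: "c \<in> D" "c \<noteq> 0" using assms subring_D by (auto simp: primitive_def)
  then obtain u ps where *: "unit_on D u" "\<forall>p\<in>set ps. prime_on D p" "c = u * prod_list ps"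
    using ufd unfolding ufd_on_def prime_factored_def by blast
  show ?thesis
  proof (cases ps)
    case Nil then show ?thesis using * by simp
  next
    case (Cons p qs)
    then have p: "prime_on D p" using * by auto
    have "[:c:] = [:p:] * [:u * prod_list qs:]" using * Cons by (simp add: algebra_simps)
    moreover have "u * prod_list qs \<in> D" using * Cons subring_D
      by (auto simp: unit_on_def prime_on_def intro!: is_subring_mult is_subring_prod_list)
    ultimately have "dvd_on DX [:p:] [:c:]" unfolding dvd_on_def using subring_D by (metis const_in_polys_over)
    then show ?thesis using assms p by (auto simp: primitive_def)
  qed
qed

lemma pseudo_division:
  assumes d: "d \<in> DX" "d \<noteq> 0" and f: "f \<in> DX"
  shows "\<exists>c q r. c \<in> D \<and> c \<noteq> 0 \<and> q \<in> DX \<and> r \<in> DX \<and> smult c f = q * d + r \<and>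
           (r = 0 \<or> degree r < degree d)"
  using f
proof (induction "degree f" arbitrary: f rule: less_induct)
  case less
  show ?case
  proof (cases "f = 0 \<or> degree f < degree d")
    case True
    then show ?thesis using less.prems
      by (intro exI[of _ 1] exI[of _ 0] exI[of _ f]) (auto simp: is_subring_one[OF subring_D] is_subring_zero[OF subring_DX])
  next
    case False
    then have f0: "f \<noteq> 0" and deg: "degree d \<le> degree f" by auto
    define l where "l = lead_coeff d"
    define m where "m = Polynomial.monom (lead_coeff f) (degree f - degree d)"
    have l: "l \<in> D" "l \<noteq> 0" using d by (auto simp: l_def coeff_in_base)
    have m: "m \<in> DX" unfolding m_def using less.prems by (auto intro!: monom_in_polys_over subring_D simp: coeff_in_base)
    define f' where "f' = smult l f - m * d"
    have f'X: "f' \<in> DX" unfolding f'_def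
      using subring_DX l m d less.prems by (auto intro!: is_subring_diff is_subring_mult smult_in_polys_over subring_D)
    have m0: "m \<noteq> 0" using f0 by (simp add: m_def)
    have dmd: "degree (m * d) = degree f" using m0 d deg f0
      by (simp add: degree_mult_eq m_def degree_monom_eq)
    have "coeff f' (degree f) = l * lead_coeff f - lead_coeff (m * d)"
      unfolding f'_def using dmd by simp
    also have "lead_coeff (m * d) = lead_coeff f * l"
      using f0 deg by (simp add: lead_coeff_mult m_def l_def degree_monom_eq)
    finally have top: "coeff f' (degree f) = 0" by simp
    have "degree f' \<le> degree f" unfolding f'_def using dmd
      by (intro degree_diff_le) auto
    show ?thesis
    proof (cases "f' = 0")
      case True
      then have "smult l f = m * d + 0" by (simp add: f'_def)
      then show ?thesis using l m is_subring_zero[OF subring_DX] by blast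
    next
      case f'0: False
      have "degree f' < degree f"
      proof (rule ccontr)
        assume "\<not> ?thesis"
        then have "degree f' = degree f" using \<open>degree f' \<le> degree f\<close> by simp
        then show False using top f'0 by (metis leading_coeff_0_iff)
      qed
      then obtain c q r where *: "c \<in> D" "c \<noteq> 0" "q \<in> DX" "r \<in> DX" "smult c f' = q * d + r"
        "r = 0 \<or> degree r < degree d" using less.hyps f'X by blast
      have "smult (c * l) f = smult c (f' + m * d)" by (simp add: f'_def)
      also have "\<dots> = (q + smult c m) * d + r" using *(5) by (simp add: smult_add_right algebra_simps)
      finally have "smult (c * l) f = (q + smult c m) * d + r" .
      then show ?thesis using * l m subring_D subring_DX
        by (intro exI[of _ "c * l"] exI[of _ "q + smult c m"] exI[of _ r])
           (auto intro!: is_subring_mult is_subring_add smult_in_polys_over)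
    qed
  qed
qed

text \<open>If \<open>f\<close> divides \<open>g h\<close> but not \<open>g\<close>, take a nonzero \<open>d\<close> of least degree in the ideal generated by \<open>f\<close> and
\<open>g\<close>. Its primitive part divides both, so by indecomposability \<open>d\<close> is a constant; multiplying by \<open>h\<close>
shows that \<open>f\<close> divides a constant multiple of \<open>h\<close>.\<close>

lemma indecomposable_prime:
  assumes f: "primitive f" and degf: "0 < degree f"
    and ind: "\<And>a b. a \<in> DX \<Longrightarrow> b \<in> DX \<Longrightarrow> f = a * b \<Longrightarrow> degree a = 0 \<or> degree b = 0"
  shows "prime_on DX f"
proof -
  have fX: "f \<in> DX" and f0: "f \<noteq> 0" using f by (auto simp: primitive_def)
  have nu: "\<not> unit_on DX f"
  proof
    assume "unit_on DX f"
    then obtain v where v: "f * v = 1" by (auto simp: unit_on_def)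
    then have "degree (f * v) = 0" "v \<noteq> 0" by auto
    then show False using f0 degf by (simp add: degree_mult_eq)
  qed
  have "dvd_on DX f g \<or> dvd_on DX f h"
    if g: "g \<in> DX" and h: "h \<in> DX" and gh: "dvd_on DX f (g * h)" for g h
  proof (rule ccontr)
    assume "\<not> ?thesis"
    then have ng: "\<not> dvd_on DX f g" and nh: "\<not> dvd_on DX f h" by auto
    define Z where "Z = {a * f + b * g | a b. a \<in> DX \<and> b \<in> DX}"
    have ZX: "z \<in> DX" if "z \<in> Z" for z
      using that fX g subring_DX unfolding Z_def by (auto intro!: is_subring_add is_subring_mult)
    have Zd: "z - w * z' \<in> Z" if "z \<in> Z" "z' \<in> Z" "w \<in> DX" for z z' w
    proof -
      obtain a b a' b' where *: "a \<in> DX" "b \<in> DX" "z = a * f + b * g"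
        "a' \<in> DX" "b' \<in> DX" "z' = a' * f + b' * g" using \<open>z \<in> Z\<close> \<open>z' \<in> Z\<close> unfolding Z_def by blast
      have "z - w * z' = (a - w * a') * f + (b - w * b') * g" using * by (simp add: algebra_simps)
      moreover have "a - w * a' \<in> DX" "b - w * b' \<in> DX"
        using * that subring_DX by (auto intro!: is_subring_diff is_subring_mult)
      ultimately show ?thesis unfolding Z_def by blast
    qed
    have Zm: "w * z \<in> Z" if "z \<in> Z" "w \<in> DX" for w z
    proof -
      obtain a b where *: "a \<in> DX" "b \<in> DX" "z = a * f + b * g" using \<open>z \<in> Z\<close> unfolding Z_def by blast
      have "w * z = (w * a) * f + (w * b) * g" using * by (simp add: algebra_simps)
      moreover have "w * a \<in> DX" "w * b \<in> DX" using * that subring_DX by (auto intro!: is_subring_mult)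
      ultimately show ?thesis unfolding Z_def by blast
    qed
    have "f = 1 * f + 0 * g" "g = 0 * f + 1 * g" by auto
    then have fZ: "f \<in> Z" and gZ: "g \<in> Z"
      unfolding Z_def using is_subring_one[OF subring_DX] is_subring_zero[OF subring_DX] by blast+
    define N where "N = (LEAST n. \<exists>z\<in>Z. z \<noteq> 0 \<and> degree z = n)"
    have "\<exists>z\<in>Z. z \<noteq> 0 \<and> degree z = N" unfolding N_def
      by (rule LeastI_ex) (use fZ f0 in blast)
    then obtain d where d: "d \<in> Z" "d \<noteq> 0" "degree d = N" by blast
    have dmin: "degree d \<le> degree z" if "z \<in> Z" "z \<noteq> 0" for z
      unfolding d(3) N_def by (rule Least_le) (use that in blast)
    have mult: "\<exists>c q. c \<in> D \<and> c \<noteq> 0 \<and> q \<in> DX \<and> smult c z = q * d" if z: "z \<in> Z" for z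
    proof -
      obtain c q r where *: "c \<in> D" "c \<noteq> 0" "q \<in> DX" "r \<in> DX" "smult c z = q * d + r"
        "r = 0 \<or> degree r < degree d"
        using pseudo_division[OF ZX[OF d(1)] d(2) ZX[OF z]] by blast
      have "r = [:c:] * z - q * d" using *(5) by simp
      moreover have "[:c:] \<in> DX" using *(1) subring_D by simp
      ultimately have "r \<in> Z" using Zd[OF Zm[OF z] d(1) *(3)] by blast
      then have "r = 0" using *(6) dmin by fastforce
      then show ?thesis using * by auto
    qed
    obtain e d' where ed: "e \<in> D" "e \<noteq> 0" "primitive d'" "d = smult e d'"
      using content_primitive[OF ZX[OF d(1)] d(2)] by blast
    have dX: "d' \<in> DX" using ed by (simp add: primitive_def)
    have dvd': "dvd_on DX d' z" if z: "z \<in> Z" for z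
    proof -
      obtain c q where *: "c \<in> D" "c \<noteq> 0" "q \<in> DX" "smult c z = q * d" using mult[OF z] by blast
      have "smult c z = d' * smult e q" using * ed by (simp add: algebra_simps)
      then have "dvd_on DX d' (smult c z)"
        using smult_in_polys_over[OF subring_D ed(1) *(3)] unfolding dvd_on_def by blast
      then show ?thesis using primitive_cancel[OF ed(3) *(1,2) ZX[OF z]] by blast
    qed
    obtain w where w: "w \<in> DX" "f = d' * w" using dvd'[OF fZ] by (auto simp: dvd_on_def)
    have "degree d' = 0 \<or> degree w = 0" using ind[OF dX w] .
    then show False
    proof
      assume "degree w = 0"
      then obtain w0 where w0: "w = [:w0:]" by (elim degree_eq_zeroE)
      have "primitive w" unfolding primitive_def
      proof (intro conjI allI impI notI)
        fix p assume p: "prime_on D p" and "dvd_on DX [:p:] w"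
        then have "dvd_on DX [:p:] f" unfolding w(2) using dvd_on_mult_left[OF subring_DX _ dX] by blast
        then show False using f p by (auto simp: primitive_def)
      qed (use w f0 in auto)
      then have "unit_on D w0" using primitive_const_unit w0 by simp
      then obtain v where v: "v \<in> D" "w0 * v = 1" by (auto simp: unit_on_def)
      have "f * [:v:] = d'" using w w0 v by (simp add: mult.commute)
      moreover obtain t where "t \<in> DX" "g = d' * t" using dvd'[OF gZ] by (auto simp: dvd_on_def)
      ultimately have "g = f * ([:v:] * t)" "[:v:] * t \<in> DX"
        using v subring_D subring_DX by (auto simp: mult.assoc is_subring_mult smult_in_polys_over)
      then show False using ng by (auto simp: dvd_on_def)
    next
      assume "degree d' = 0"
      then have "degree d = 0" using ed by simp
      then obtain d0 where d0: "d = [:d0:]" by (elim degree_eq_zeroE)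
      have d0D: "d0 \<in> D" "d0 \<noteq> 0" using ZX[OF d(1)] d(2) d0 subring_D by auto
      obtain a b where ab: "a \<in> DX" "b \<in> DX" "d = a * f + b * g" using d(1) unfolding Z_def by blast
      obtain t where t: "t \<in> DX" "g * h = f * t" using gh by (auto simp: dvd_on_def)
      have "smult d0 h = d * h" using d0 by simp
      also have "\<dots> = a * f * h + b * (g * h)" using ab by (simp add: algebra_simps)
      also have "\<dots> = f * (a * h + b * t)" unfolding t(2) by (simp add: algebra_simps)
      finally have "dvd_on DX f (smult d0 h)"
        unfolding dvd_on_def using ab t h subring_DX by (auto intro!: is_subring_add is_subring_mult)
      then show False using primitive_cancel[OF f d0D h] nh by blast
    qed
  qed
  then show ?thesis using fX f0 nu unfolding prime_on_def by blast
qed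

theorem gauss_ufd: "ufd_on DX"
proof -
  have "prime_factored DX f" if "f \<in> DX" "f \<noteq> 0" for f
    using that
  proof (induction "degree f" arbitrary: f rule: less_induct)
    case less
    obtain c g where cg: "c \<in> D" "c \<noteq> 0" "primitive g" "f = smult c g"
      using content_primitive less.prems by blast
    have gX: "g \<in> DX" "g \<noteq> 0" using cg by (auto simp: primitive_def)
    have dg: "degree g = degree f" using cg by simp
    have "prime_factored DX g"
    proof (cases "degree g = 0")
      case True
      then obtain u where "g = [:u:]" by (elim degree_eq_zeroE)
      then show ?thesis using cg primitive_const_unit unit_on_const[OF subring_D] prime_factored_unit by metis
    next
      case False
      show ?thesis
      proof (cases "\<exists>a b. a \<in> DX \<and> b \<in> DX \<and> g = a * b \<and> degree a \<noteq> 0 \<and> degree b \<noteq> 0")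
        case True
        then obtain a b where ab: "a \<in> DX" "b \<in> DX" "g = a * b" "degree a \<noteq> 0" "degree b \<noteq> 0" by blast
        then have "a \<noteq> 0" "b \<noteq> 0" using gX by auto
        moreover have "degree a < degree f" "degree b < degree f"
          using ab dg calculation by (auto simp: degree_mult_eq)
        ultimately show ?thesis using less.hyps ab prime_factored_mult[OF subring_DX] by blast
      next
        case nd: False
        have "prime_on DX g"
        proof (rule indecomposable_prime[OF cg(3)])
          show "0 < degree g" using False by simp
          show "degree a = 0 \<or> degree b = 0" if "a \<in> DX" "b \<in> DX" "g = a * b" for a b
            using nd that by blast
        qed
        then show ?thesis using prime_factored_prime[OF subring_DX] by blast
      qed
    qed
    then have "prime_factored DX ([:c:] * g)"
      using prime_factored_const[OF cg(1,2)] prime_factored_mult[OF subring_DX] by blast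
    then show ?case using cg by simp
  qed
  then show ?thesis using subring_DX by (simp add: ufd_on_def)
qed

end

section \<open>Transport, localization and retraction\<close>

lemma ufd_on_image:
  fixes h :: "'a::idom \<Rightarrow> 'b::idom"
  assumes S: "ufd_on S" and inj: "inj_on h S" and one: "h 1 = 1"
    and diff: "\<And>a b. a \<in> S \<Longrightarrow> b \<in> S \<Longrightarrow> h (a - b) = h a - h b"
    and mult: "\<And>a b. a \<in> S \<Longrightarrow> b \<in> S \<Longrightarrow> h (a * b) = h a * h b"
  shows "ufd_on (h ` S)" and "\<And>p. prime_on S p \<Longrightarrow> prime_on (h ` S) (h p)"
proof -
  have R: "is_subring S" using S by (simp add: ufd_on_def)
  note R_simps = is_subring_one[OF R] is_subring_diff[OF R] is_subring_mult[OF R] is_subring_zero[OF R]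
  have zero: "h 0 = 0" using diff[OF R_simps(1) R_simps(1)] by simp
  have sub: "is_subring (h ` S)"
  proof (rule is_subringI)
    show "1 \<in> h ` S" using R_simps(1) one by (metis imageI)
    show "a - b \<in> h ` S" "a * b \<in> h ` S" if "a \<in> h ` S" "b \<in> h ` S" for a b
      using that diff mult R_simps by (auto, (metis imageI)+)
  qed
  have dvd: "dvd_on (h ` S) (h a) (h b) \<longleftrightarrow> dvd_on S a b" if "a \<in> S" "b \<in> S" for a b
  proof -
    have "h b = h a * h c \<longleftrightarrow> b = a * c" if "c \<in> S" for c
      using that \<open>a \<in> S\<close> \<open>b \<in> S\<close> R_simps mult inj unfolding inj_on_def by metis
    then show ?thesis unfolding dvd_on_def by auto
  qed
  have unit: "unit_on (h ` S) (h a) \<longleftrightarrow> unit_on S a" if "a \<in> S" for a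
  proof -
    have "dvd_on (h ` S) (h a) (h 1) \<longleftrightarrow> dvd_on S a 1" using dvd that R_simps by blast
    then show ?thesis using that one unfolding unit_on_def dvd_on_def by (metis imageI)
  qed
  show prime: "prime_on (h ` S) (h p)" if p: "prime_on S p" for p
    unfolding prime_on_def
  proof (intro conjI ballI impI)
    have pS: "p \<in> S" "p \<noteq> 0" using p by (auto simp: prime_on_def)
    show "h p \<in> h ` S" using pS by blast
    show "h p \<noteq> 0" using pS zero inj R_simps unfolding inj_on_def by metis
    show "\<not> unit_on (h ` S) (h p)" using unit p by (auto simp: prime_on_def)
    fix a b assume "a \<in> h ` S" "b \<in> h ` S" and d: "dvd_on (h ` S) (h p) (a * b)"
    then obtain a' b' where ab: "a' \<in> S" "b' \<in> S" "a = h a'" "b = h b'" by blast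
    then have "dvd_on S p (a' * b')" using d dvd[OF pS(1), of "a' * b'"] mult R_simps by simp
    then have "dvd_on S p a' \<or> dvd_on S p b'" using p ab by (auto simp: prime_on_def)
    then show "dvd_on (h ` S) (h p) a \<or> dvd_on (h ` S) (h p) b" using ab dvd pS by auto
  qed
  have pl: "prod_list ps \<in> S \<and> h (prod_list ps) = prod_list (map h ps)" if "set ps \<subseteq> S" for ps
    using that by (induction ps) (auto simp: one mult R_simps)
  show "ufd_on (h ` S)" unfolding ufd_on_def
  proof (intro conjI ballI impI sub)
    fix x assume "x \<in> h ` S" "x \<noteq> 0"
    then obtain a where a: "a \<in> S" "x = h a" "a \<noteq> 0" using zero by auto
    then obtain u ps where *: "unit_on S u" "\<forall>p\<in>set ps. prime_on S p" "a = u * prod_list ps"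
      using S unfolding ufd_on_def prime_factored_def by blast
    have "set ps \<subseteq> S" "u \<in> S" using * by (auto simp: prime_on_def unit_on_def)
    then have "x = h u * prod_list (map h ps)" using a * mult pl by simp
    then show "prime_factored (h ` S) x" unfolding prime_factored_def
      using * unit prime \<open>u \<in> S\<close> by (intro exI[of _ "h u"] exI[of _ "map h ps"]) auto
  qed
qed

lemma ufd_on_localization:
  fixes S :: "'a::field set"
  assumes S: "ufd_on S" and d: "d \<in> S" "d \<noteq> 0"
  shows "ufd_on {f / d ^ n |f n. f \<in> S}"
proof -
  define T where "T = {f / d ^ n |f n. f \<in> S}"
  have T_iff: "a \<in> T \<longleftrightarrow> (\<exists>f n. f \<in> S \<and> a = f / d ^ n)" for a unfolding T_def by blast
  have R: "is_subring S" using S by (simp add: ufd_on_def)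
  note R_simps = is_subring_one[OF R] is_subring_diff[OF R] is_subring_mult[OF R]
    is_subring_power[OF R]
  have ST: "a \<in> T" if "a \<in> S" for a
  proof -
    have "a = a / d ^ 0" by simp
    then show ?thesis unfolding T_iff using that by blast
  qed
  have dT: "1 / d ^ n \<in> T" for n unfolding T_iff using R_simps(1) by blast
  have TR: "is_subring T"
  proof (rule is_subringI)
    show "1 \<in> T" by (rule ST[OF R_simps(1)])
    fix a b assume "a \<in> T" "b \<in> T"
    then obtain f n g m where *: "f \<in> S" "a = f / d ^ n" "g \<in> S" "b = g / d ^ m" unfolding T_iff by blast
    have "a - b = (f * d ^ m - g * d ^ n) / d ^ (n + m)"
      unfolding *(2,4) power_add by (rule diff_frac_eq) (use d in simp_all)
    moreover have "f * d ^ m - g * d ^ n \<in> S" by (intro R_simps * d)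
    ultimately show "a - b \<in> T" unfolding T_iff by blast
    have "a * b = (f * g) / d ^ (n + m)" using * by (simp add: power_add)
    moreover have "f * g \<in> S" by (intro R_simps *)
    ultimately show "a * b \<in> T" unfolding T_iff by blast
  qed
  have unit: "unit_on T u" if "unit_on S u" for u
    using that ST unfolding unit_on_def by blast
  have ud: "unit_on T (1 / d ^ n)" for n
  proof -
    have "d ^ n \<in> T" by (rule ST[OF R_simps(4)[OF d(1)]])
    moreover have "1 / d ^ n * d ^ n = 1" using d by simp
    ultimately show ?thesis unfolding unit_on_def using dT[of n] by blast
  qed
  have prime: "prime_factored T p" if p: "prime_on S p" for p
  proof (cases "unit_on T p")
    case True then show ?thesis by (rule prime_factored_unit)
  next
    case False
    have pS: "p \<in> S" "p \<noteq> 0" using p by (auto simp: prime_on_def)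
    have "prime_on T p" unfolding prime_on_def
    proof (intro conjI ballI impI ST pS False)
      fix a b assume "a \<in> T" "b \<in> T" and dv: "dvd_on T p (a * b)"
      then obtain f n g m where *: "f \<in> S" "a = f / d ^ n" "g \<in> S" "b = g / d ^ m"
        unfolding T_iff by blast
      obtain e where e: "e \<in> T" "a * b = p * e" using dv unfolding dvd_on_def by blast
      obtain h l where "h \<in> S" "e = h / d ^ l" using e(1) unfolding T_iff by blast
      then have h: "h \<in> S" "a * b = p * (h / d ^ l)" using e(2) by simp_all
      have "(f * g) / d ^ (n + m) = (p * h) / d ^ l"
        using h(2) unfolding *(2,4) by (simp add: power_add)
      then have "(f * g) * d ^ l = (p * h) * d ^ (n + m)"
        using frac_eq_eq[of "d ^ (n + m)" "d ^ l" "f * g" "p * h"] d by simp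
      then have "(f * g) * d ^ l = p * (h * d ^ (n + m))" by (simp only: mult.assoc)
      moreover have "h * d ^ (n + m) \<in> S" by (intro R_simps h d)
      ultimately have "dvd_on S p ((f * g) * d ^ l)" unfolding dvd_on_def by blast
      moreover have "f * g \<in> S" "d ^ l \<in> S" by (intro R_simps * d)+
      ultimately have "dvd_on S p (f * g) \<or> dvd_on S p (d ^ l)"
        using p unfolding prime_on_def by blast
      moreover have "\<not> dvd_on S p (d ^ l)"
      proof
        assume "dvd_on S p (d ^ l)"
        then obtain c where c: "c \<in> S" "d ^ l = p * c" by (auto simp: dvd_on_def)
        have "p * (c / d ^ l) = (p * c) / d ^ l" by simp
        also have "\<dots> = 1" unfolding c(2)[symmetric] using d by simp
        finally have "p * (c / d ^ l) = 1" .
        moreover have "c / d ^ l \<in> T" unfolding T_iff using c by blast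
        ultimately show False using False ST[OF pS(1)] unfolding unit_on_def by blast
      qed
      ultimately have "dvd_on S p f \<or> dvd_on S p g" using p * unfolding prime_on_def by blast
      then show "dvd_on T p a \<or> dvd_on T p b"
      proof
        assume "dvd_on S p f"
        then obtain c where c: "c \<in> S" "f = p * c" by (auto simp: dvd_on_def)
        have "a = p * (c / d ^ n)" using * c by simp
        then show ?thesis using c unfolding dvd_on_def Bex_def T_iff by blast
      next
        assume "dvd_on S p g"
        then obtain c where c: "c \<in> S" "g = p * c" by (auto simp: dvd_on_def)
        have "b = p * (c / d ^ m)" using * c by simp
        then show ?thesis using c unfolding dvd_on_def Bex_def T_iff by blast
      qed
    qed
    then show ?thesis by (rule prime_factored_prime[OF TR])
  qed
  show ?thesis unfolding T_def[symmetric] ufd_on_def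
  proof (intro conjI ballI impI TR)
    fix x assume "x \<in> T" "x \<noteq> 0"
    then obtain f n where f: "f \<in> S" "x = f / d ^ n" "f \<noteq> 0" unfolding T_iff by auto
    then obtain u ps where *: "unit_on S u" "\<forall>p\<in>set ps. prime_on S p" "f = u * prod_list ps"
      using S unfolding ufd_on_def prime_factored_def by blast
    have "prime_factored T (1 / d ^ n * (u * prod_list ps))"
      using * ud unit prime by (intro prime_factored_mult[OF TR] prime_factored_prod_list[OF TR])
        (auto intro: prime_factored_unit)
    then show "prime_factored T x" using f * by simp
  qed
qed

text \<open>Unique factorization in the form needed below: the prime factors of a product are distributed
among the factors.\<close>

lemma prime_list_split:
  fixes b c :: "'a::idom"
  assumes S: "is_subring S" and "b \<in> S" "c \<in> S" "unit_on S u" "\<forall>p\<in>set ps. prime_on S p"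
    "b * c = u * prod_list ps"
  shows "\<exists>v qs w rs. unit_on S v \<and> unit_on S w \<and> (\<forall>p\<in>set qs. prime_on S p) \<and>
    (\<forall>p\<in>set rs. prime_on S p) \<and> b = v * prod_list qs \<and> c = w * prod_list rs \<and>
    length ps = length qs + length rs"
  using assms(2-)
proof (induction ps arbitrary: b c)
  case Nil
  then obtain u' where u': "u' \<in> S" "b * c * u' = 1" by (auto simp: unit_on_def)
  have "b * (c * u') = 1" "c * (b * u') = 1" "c * u' \<in> S" "b * u' \<in> S"
    using Nil u' is_subring_mult[OF S] by (auto simp: mult_ac)
  then have "unit_on S b" "unit_on S c" unfolding unit_on_def using Nil by blast+
  then show ?case
    by (intro exI[of _ b] exI[of _ "[]"] exI[of _ c] exI[of _ "[]"]) simp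
next
  case (Cons p ps)
  have p: "prime_on S p" using Cons.prems by auto
  then have p0: "p \<noteq> 0" by (auto simp: prime_on_def)
  have "u * prod_list ps \<in> S" using Cons.prems
    by (auto simp: unit_on_def prime_on_def intro!: is_subring_mult[OF S] is_subring_prod_list[OF S])
  moreover have eq: "b * c = p * (u * prod_list ps)" using Cons.prems by (simp add: mult_ac)
  ultimately have "dvd_on S p (b * c)" unfolding dvd_on_def by blast
  then have "dvd_on S p b \<or> dvd_on S p c" using p Cons.prems by (auto simp: prime_on_def)
  then show ?case
  proof
    assume "dvd_on S p b"
    then obtain b' where b': "b' \<in> S" "b = p * b'" by (auto simp: dvd_on_def)
    have "p * (b' * c) = p * (u * prod_list ps)" using eq b' by (simp add: mult_ac)
    then have "b' * c = u * prod_list ps" using p0 mult_left_cancel by blast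
    then obtain v qs w rs where "unit_on S v" "unit_on S w" "\<forall>p\<in>set qs. prime_on S p"
      "\<forall>p\<in>set rs. prime_on S p" "b' = v * prod_list qs" "c = w * prod_list rs"
      "length ps = length qs + length rs" using Cons.IH[OF b'(1), of c] Cons.prems by auto
    then show ?thesis using b' p
      by (intro exI[of _ v] exI[of _ "p # qs"] exI[of _ w] exI[of _ rs]) (simp add: mult_ac)
  next
    assume "dvd_on S p c"
    then obtain c' where c': "c' \<in> S" "c = p * c'" by (auto simp: dvd_on_def)
    have "p * (b * c') = p * (u * prod_list ps)" using eq c' by (simp add: mult_ac)
    then have "b * c' = u * prod_list ps" using p0 mult_left_cancel by blast
    then obtain v qs w rs where "unit_on S v" "unit_on S w" "\<forall>p\<in>set qs. prime_on S p"
      "\<forall>p\<in>set rs. prime_on S p" "b = v * prod_list qs" "c' = w * prod_list rs"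
      "length ps = length qs + length rs" using Cons.IH[OF _ c'(1), of b] Cons.prems by auto
    then show ?thesis using c' p
      by (intro exI[of _ v] exI[of _ qs] exI[of _ w] exI[of _ "p # rs"]) (simp add: mult_ac)
  qed
qed

text \<open>Irreducible elements of \<open>S\<close>: nonunits that are not a product of two nonunits of \<open>S\<close>.\<close>

definition irred_on :: "'a::comm_ring_1 set \<Rightarrow> 'a \<Rightarrow> bool" where
  "irred_on S a \<longleftrightarrow> a \<in> S \<and> \<not> unit_on S a \<and>
     (\<forall>b\<in>S. \<forall>c\<in>S. a = b * c \<longrightarrow> unit_on S b \<or> unit_on S c)"

lemma irred_on_prod_list:
  assumes T: "is_subring T" and a: "irred_on T a" and u: "unit_on T u" and ts: "set ts \<subseteq> T"
    and eq: "a = u * prod_list ts"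
  shows "\<exists>t\<in>set ts. \<exists>w. unit_on T w \<and> a = w * t"
  using u ts eq
proof (induction ts arbitrary: u)
  case Nil then show ?case using a by (auto simp: irred_on_def)
next
  case (Cons t ts)
  have pT: "u * prod_list ts \<in> T" using Cons.prems
    by (auto simp: unit_on_def intro!: is_subring_mult[OF T] is_subring_prod_list[OF T])
  have "a = t * (u * prod_list ts)" using Cons.prems by (simp add: mult_ac)
  then have "unit_on T t \<or> unit_on T (u * prod_list ts)"
    using a pT Cons.prems unfolding irred_on_def by auto
  then show ?case
  proof
    assume "unit_on T t"
    then have "unit_on T (u * t)" using Cons.prems unit_on_mult[OF T] by blast
    moreover have "a = (u * t) * prod_list ts" using Cons.prems by (simp add: mult_ac)
    moreover have "set ts \<subseteq> T" using Cons.prems by auto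
    ultimately have "\<exists>t\<in>set ts. \<exists>w. unit_on T w \<and> a = w * t" by (intro Cons.IH)
    then show ?thesis by auto
  next
    assume "unit_on T (u * prod_list ts)"
    then show ?thesis using Cons.prems by (auto simp: mult_ac intro!: exI[of _ "u * prod_list ts"])
  qed
qed

text \<open>A retract \<open>T\<close> of a factorial ring \<open>S\<close> is factorial; the retraction \<open>r\<close> only has to be multiplicative.
Let \<open>a\<close> be irreducible in \<open>T\<close>. Applying \<open>r\<close> to its factorization in \<open>S\<close> shows that \<open>a\<close> is
associated in \<open>T\<close> to \<open>r p\<close> for one of its prime factors \<open>p\<close>. If \<open>a\<close> divides \<open>x y\<close>, then \<open>p\<close> divides
\<open>x\<close>, say, hence \<open>r p\<close> divides \<open>r x = x\<close>. Factorizations exist because a proper factorization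
in \<open>T\<close> lowers the number of prime factors in \<open>S\<close>.\<close>

theorem ufd_on_retract:
  fixes S T :: "'a::idom set"
  assumes S: "ufd_on S" and T: "is_subring T" and TS: "T \<subseteq> S"
    and rT: "\<And>a. a \<in> S \<Longrightarrow> r a \<in> T" and rm: "\<And>a b. a \<in> S \<Longrightarrow> b \<in> S \<Longrightarrow> r (a * b) = r a * r b"
    and rid: "\<And>a. a \<in> T \<Longrightarrow> r a = a"
  shows "ufd_on T"
proof -
  have R: "is_subring S" using S by (simp add: ufd_on_def)
  have r1: "r 1 = 1" using rid[OF is_subring_one[OF T]] .
  have unit: "unit_on T (r u)" if "unit_on S u" for u
    using that rT rm r1 unfolding unit_on_def by metis
  have rp: "r (prod_list ps) = prod_list (map r ps)" if "set ps \<subseteq> S" for ps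
    using that by (induction ps) (auto simp: r1 rm is_subring_prod_list[OF R])
  have irr: "prime_on T a" if a: "irred_on T a" "a \<noteq> 0" for a
  proof -
    have aT: "a \<in> T" using a by (simp add: irred_on_def)
    then obtain u ps where *: "unit_on S u" "\<forall>p\<in>set ps. prime_on S p" "a = u * prod_list ps"
      using S a TS unfolding ufd_on_def prime_factored_def by blast
    have psS: "set ps \<subseteq> S" "u \<in> S" using * by (auto simp: prime_on_def unit_on_def)
    have "a = r u * prod_list (map r ps)"
      using rid[OF aT] * psS rm[OF psS(2) is_subring_prod_list[OF R psS(1)]] rp by simp
    then obtain p w where p: "p \<in> set ps" "unit_on T w" "a = w * r p"
      using irred_on_prod_list[OF T a(1) unit[OF *(1)], of "map r ps"] psS rT by auto
    have pp: "prime_on S p" using p * by blast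
    have pS: "p \<in> S" using pp by (simp add: prime_on_def)
    obtain qs rs where "ps = qs @ p # rs" using split_list[OF p(1)] by blast
    then have eq: "a = p * (u * prod_list (qs @ rs))" and "set (qs @ rs) \<subseteq> S"
      using * psS by (auto simp: mult_ac)
    then have pa: "dvd_on S p a" unfolding dvd_on_def
      using is_subring_mult[OF R psS(2) is_subring_prod_list[OF R]] by blast
    obtain w' where w': "w' \<in> T" "w * w' = 1" using p by (auto simp: unit_on_def)
    have desc: "dvd_on T a x" if x: "x \<in> T" "dvd_on S p x" for x
    proof -
      obtain c where c: "c \<in> S" "x = p * c" using x by (auto simp: dvd_on_def)
      have "x = r p * r c" using rid[OF x(1)] c rm[OF pS c(1)] by simp
      also have "\<dots> = (w * w') * (r p * r c)" using w' by simp
      also have "\<dots> = a * (w' * r c)" using p by (simp add: mult_ac)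
      finally show ?thesis unfolding dvd_on_def using is_subring_mult[OF T w'(1) rT[OF c(1)]] by blast
    qed
    show ?thesis unfolding prime_on_def
    proof (intro conjI ballI impI aT a(2))
      show "\<not> unit_on T a" using a by (simp add: irred_on_def)
      fix x y assume xy: "x \<in> T" "y \<in> T" "dvd_on T a (x * y)"
      then obtain c where c: "c \<in> S" "x * y = a * c" using TS by (auto simp: dvd_on_def)
      then have "dvd_on S p (x * y)" using dvd_on_mult_right[OF R pa c(1)] by simp
      then have "dvd_on S p x \<or> dvd_on S p y" using pp xy TS unfolding prime_on_def by blast
      then show "dvd_on T a x \<or> dvd_on T a y" using desc xy by blast
    qed
  qed
  have "prime_factored T a" if a: "a \<in> T" "unit_on S u" "\<forall>p\<in>set ps. prime_on S p" "a = u * prod_list ps" "a \<noteq> 0" for a u ps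
    using that
  proof (induction "length ps" arbitrary: a u ps rule: less_induct)
    case less
    show ?case
    proof (cases "unit_on T a \<or> irred_on T a")
      case True
      then show ?thesis using irr less.prems prime_factored_prime[OF T] prime_factored_unit by blast
    next
      case False
      then obtain b c where bc: "b \<in> T" "c \<in> T" "a = b * c" "\<not> unit_on T b" "\<not> unit_on T c"
        using less.prems unfolding irred_on_def by blast
      have nu: "\<not> unit_on S b" "\<not> unit_on S c" using unit rid bc by metis+
      obtain v qs w rs where *: "unit_on S v" "unit_on S w" "\<forall>p\<in>set qs. prime_on S p"
        "\<forall>p\<in>set rs. prime_on S p" "b = v * prod_list qs" "c = w * prod_list rs"
        "length ps = length qs + length rs"
        using prime_list_split[OF R _ _ less.prems(2,3), of b c] bc less.prems TS by blast
      have "qs \<noteq> []" "rs \<noteq> []" using nu * by auto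
      then have "length qs < length ps" "length rs < length ps" using * by auto
      then have "prime_factored T b" "prime_factored T c"
        using less.hyps * bc less.prems by auto
      then show ?thesis using prime_factored_mult[OF T] bc by blast
    qed
  qed
  then show ?thesis
    unfolding ufd_on_def using T S TS unfolding ufd_on_def prime_factored_def by blast
qed

section \<open>Factorial domains\<close>

lemma irred_on_imp_prime_on:
  assumes S: "ufd_on S" and a: "irred_on S a" "a \<noteq> 0"
  shows "prime_on S a"
proof -
  have R: "is_subring S" and aS: "a \<in> S" using assms by (auto simp: ufd_on_def irred_on_def)
  obtain u ps where *: "unit_on S u" "\<forall>p\<in>set ps. prime_on S p" "a = u * prod_list ps"
    using S a aS unfolding ufd_on_def prime_factored_def by blast
  then obtain p w where p: "p \<in> set ps" "unit_on S w" "a = w * p"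
    using irred_on_prod_list[OF R a(1) *(1) _ *(3)] unfolding prime_on_def by blast
  then have pp: "prime_on S p" using * by blast
  obtain w' where w: "w \<in> S" "w' \<in> S" "w * w' = 1" using p by (auto simp: unit_on_def)
  have pa: "dvd_on S p x" if "dvd_on S a x" for x
    using that p w is_subring_mult[OF R] unfolding dvd_on_def by (metis mult.commute mult.assoc)
  have ap: "dvd_on S a x" if px: "dvd_on S p x" for x
  proof -
    obtain c where c: "c \<in> S" "x = p * c" using px by (auto simp: dvd_on_def)
    have "x = (w * w') * (p * c)" using c w by simp
    also have "\<dots> = a * (w' * c)" using p by (simp add: mult_ac)
    finally show ?thesis unfolding dvd_on_def using is_subring_mult[OF R w(2) c(1)] by blast
  qed
  show ?thesis using pp pa ap a aS unfolding prime_on_def irred_on_def by blast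
qed

text \<open>The passage from factorial subrings of a type to factorial domains given by a carrier. The
structure \<open>L\<close> is not assumed to be a ring; the ring axioms are carried over by \<open>h\<close>.\<close>

theorem factorial_domain_of_ufd_on:
  fixes T :: "'a::idom set" and L :: "'b ring"
  assumes T: "ufd_on T" and bij: "bij_betw h T (carrier L)"
    and one: "h 1 = \<one>\<^bsub>L\<^esub>" and zero: "h 0 = \<zero>\<^bsub>L\<^esub>"
    and add: "\<And>a b. a \<in> T \<Longrightarrow> b \<in> T \<Longrightarrow> h (a + b) = h a \<oplus>\<^bsub>L\<^esub> h b"
    and mult: "\<And>a b. a \<in> T \<Longrightarrow> b \<in> T \<Longrightarrow> h (a * b) = h a \<otimes>\<^bsub>L\<^esub> h b"
  shows "factorial_domain L"
proof -
  have R: "is_subring T" using T by (simp add: ufd_on_def)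
  note R_simps = is_subring_one[OF R] is_subring_add[OF R] is_subring_mult[OF R] is_subring_zero[OF R]
    is_subring_uminus[OF R]
  define TR :: "'a ring" where "TR = \<lparr>carrier = T, mult = (*), one = 1, zero = 0, add = (+)\<rparr>"
  have "domain TR"
  proof -
    have "cring TR"
    proof (rule cringI)
      show "abelian_group TR"
        by (rule abelian_groupI) (auto simp: TR_def R_simps algebra_simps intro!: bexI[of _ "- x" for x])
      show "comm_monoid TR" by (rule comm_monoidI) (auto simp: TR_def R_simps algebra_simps)
    qed (auto simp: TR_def algebra_simps)
    then show ?thesis by (rule domain.intro) (unfold_locales, auto simp: TR_def)
  qed
  then interpret TR: domain TR .
  have "h \<in> ring_iso TR L" unfolding ring_iso_def Ring.ring_hom_def
    using bij bij_betw_apply[OF bij] one add mult by (auto simp: TR_def)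
  from TR.ring_iso_imp_img_domain[OF this] have "domain (L\<lparr>zero := h 0\<rparr>)" by (simp add: TR_def)
  moreover have "L\<lparr>zero := h 0\<rparr> = L" using zero by simp
  ultimately interpret L: domain L by simp
  have inj: "inj_on h T" and img: "h ` T = carrier L" using bij by (auto simp: bij_betw_def)
  have h0: "h a = \<zero>\<^bsub>L\<^esub> \<longleftrightarrow> a = 0" if "a \<in> T" for a
    using that inj zero R_simps unfolding inj_on_def by metis
  have carr: "carrier (mult_of L) = h ` (T - {0})"
    using img h0 by auto
  have dvd: "h a divides\<^bsub>mult_of L\<^esub> h b \<longleftrightarrow> dvd_on T a b" if "a \<in> T" "b \<in> T" "b \<noteq> 0" for a b
  proof -
    have "h b = h a \<otimes>\<^bsub>L\<^esub> h c \<longleftrightarrow> b = a * c" if "c \<in> T" for c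
      using that \<open>a \<in> T\<close> \<open>b \<in> T\<close> R_simps mult inj unfolding inj_on_def by metis
    then show ?thesis unfolding factor_def carr dvd_on_def using that by auto
  qed
  have unit: "h a \<in> Units (mult_of L) \<longleftrightarrow> unit_on T a" if "a \<in> T" "a \<noteq> 0" for a
  proof -
    have "h a \<in> Units (mult_of L) \<longleftrightarrow> h a divides\<^bsub>mult_of L\<^esub> h 1"
      using that carr L.mult_of.Unit_eq_dividesone[of "h a"] one by simp
    also have "\<dots> \<longleftrightarrow> unit_on T a" using dvd[OF that(1) R_simps(1)] that
      unfolding unit_on_def dvd_on_def by (metis zero_neq_one)
    finally show ?thesis .
  qed
  have prime: "Divisibility.prime (mult_of L) (h p)" if p: "prime_on T p" for p
  proof (rule Divisibility.primeI)
    have pT: "p \<in> T" "p \<noteq> 0" using p by (auto simp: prime_on_def)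
    show "h p \<notin> Units (mult_of L)" using unit[OF pT] p by (simp add: prime_on_def)
    fix a b assume ab: "a \<in> carrier (mult_of L)" "b \<in> carrier (mult_of L)"
      "h p divides\<^bsub>mult_of L\<^esub> a \<otimes>\<^bsub>mult_of L\<^esub> b"
    then obtain a' b' where a: "a' \<in> T" "a' \<noteq> 0" "a = h a'" and b: "b' \<in> T" "b' \<noteq> 0" "b = h b'"
      unfolding carr by blast
    have "dvd_on T p (a' * b')" using ab a b dvd[OF pT(1), of "a' * b'"] mult R_simps by simp
    then have "dvd_on T p a' \<or> dvd_on T p b'" using p a b by (simp add: prime_on_def)
    then show "h p divides\<^bsub>mult_of L\<^esub> a \<or> h p divides\<^bsub>mult_of L\<^esub> b" using a b dvd pT by blast
  qed
  have irred: "prime_on T a" if a: "a \<in> T" "a \<noteq> 0" "Divisibility.irreducible (mult_of L) (h a)" for a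
  proof (rule irred_on_imp_prime_on[OF T])
    show "a \<noteq> 0" by fact
    show "irred_on T a" unfolding irred_on_def
    proof (intro conjI ballI impI a(1))
      show "\<not> unit_on T a" using a unit by (simp add: Divisibility.irreducible_def)
      fix b c assume bc: "b \<in> T" "c \<in> T" "a = b * c"
      then have nz: "b \<noteq> 0" "c \<noteq> 0" using a by auto
      show "unit_on T b \<or> unit_on T c"
        using L.mult_of.irreducible_prodE[of "h b" "h c"] a(3) bc nz unit carr mult by auto
    qed
  qed
  have "factorial_monoid (mult_of L)"
  proof (rule L.mult_of.factorial_monoidI)
    interpret P: primeness_condition_monoid "mult_of L"
    proof (unfold_locales)
      fix x assume "x \<in> carrier (mult_of L)" and x: "Divisibility.irreducible (mult_of L) x"
      then obtain a where "a \<in> T" "a \<noteq> 0" "x = h a" unfolding carr by blast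
      then show "Divisibility.prime (mult_of L) x" using x prime[OF irred] by blast
    qed
    show "essentially_equal (mult_of L) fs fs'"
      if "a \<in> carrier (mult_of L)" "set fs \<subseteq> carrier (mult_of L)" "set fs' \<subseteq> carrier (mult_of L)"
        "wfactors (mult_of L) fs a" "wfactors (mult_of L) fs' a" for a fs fs'
      using P.wfactors_unique that by blast
    fix a assume "a \<in> carrier (mult_of L)"
    then obtain x where x: "x \<in> T" "x \<noteq> 0" "a = h x" unfolding carr by blast
    then obtain u ps where *: "unit_on T u" "\<forall>p\<in>set ps. prime_on T p" "x = u * prod_list ps"
      using T unfolding ufd_on_def prime_factored_def by blast
    have psT: "set ps \<subseteq> T" "u \<in> T" "u \<noteq> 0" "prod_list ps \<noteq> 0" "prod_list ps \<in> T"
      using * x is_subring_prod_list[OF R, of ps] by (auto simp: prime_on_def unit_on_def)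
    have fo: "foldr (\<otimes>\<^bsub>L\<^esub>) (map h ps) \<one>\<^bsub>L\<^esub> = h (prod_list ps)"
      using psT(1) by (induction ps) (auto simp: one mult is_subring_prod_list[OF R])
    have "wfactors (mult_of L) (map h ps) a"
    proof (rule wfactorsI)
      show "\<forall>f\<in>set (map h ps). Divisibility.irreducible (mult_of L) f"
        using prime * L.mult_of.prime_irreducible by auto
      have cp: "h (prod_list ps) \<in> carrier (mult_of L)" and cu: "h u \<in> Units (mult_of L)"
        using psT carr unit * by auto
      have "h x = h (prod_list ps) \<otimes>\<^bsub>L\<^esub> h u"
        using mult[OF psT(5,2)] *(3) by (simp add: mult.commute)
      then have "h x \<sim>\<^bsub>mult_of L\<^esub> h (prod_list ps)"
        by (intro L.mult_of.associatedI2'[OF _ cu cp]) simp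
      then have "h (prod_list ps) \<sim>\<^bsub>mult_of L\<^esub> h x" by (rule L.mult_of.associated_sym)
      then show "foldr (\<otimes>\<^bsub>mult_of L\<^esub>) (map h ps) \<one>\<^bsub>mult_of L\<^esub> \<sim>\<^bsub>mult_of L\<^esub> a"
        using fo x by simp
    qed
    moreover have "set (map h ps) \<subseteq> carrier (mult_of L)" unfolding carr
      using * by (auto simp: prime_on_def)
    ultimately show "\<exists>fs. set fs \<subseteq> carrier (mult_of L) \<and> wfactors (mult_of L) fs a" by blast
  qed
  then show ?thesis using L.domain_axioms by (simp add: factorial_domain_def)
qed

section \<open>Evaluation of polynomials in several variables\<close>

text \<open>The value of the monomial \<open>m\<close> at the point \<open>v\<close>.\<close>

definition mon_eval :: "('x \<Rightarrow> 'a::comm_ring_1) \<Rightarrow> ('x \<Rightarrow>\<^sub>0 nat) \<Rightarrow> 'a" where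
  "mon_eval v m = (\<Prod>x\<in>Poly_Mapping.keys m. v x ^ Poly_Mapping.lookup m x)"

text \<open>The value of \<open>p\<close> at the point \<open>v\<close>, with coefficients mapped by \<open>\<kappa>\<close>.\<close>

definition meval :: "('k \<Rightarrow> 'a::comm_ring_1) \<Rightarrow> ('x \<Rightarrow> 'a) \<Rightarrow> ('x, 'k::field) mpoly \<Rightarrow> 'a" where
  "meval \<kappa> v p = (\<Sum>m\<in>Poly_Mapping.keys p. \<kappa> (Poly_Mapping.lookup p m) * mon_eval v m)"

lemma mpoly_subst_eq_meval: "mpoly_subst f = meval mconst f"
  by (simp add: fun_eq_iff mpoly_subst_def meval_def mon_eval_def)

lemma mon_eval_superset:
  assumes "finite X" "Poly_Mapping.keys m \<subseteq> X"
  shows "mon_eval v m = (\<Prod>x\<in>X. v x ^ Poly_Mapping.lookup m x)"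
  unfolding mon_eval_def by (rule prod.mono_neutral_left) (use assms in \<open>auto simp: in_keys_iff\<close>)

lemma mon_eval_add: "mon_eval v (m + m') = mon_eval v m * mon_eval v m'"
proof -
  let ?X = "Poly_Mapping.keys m \<union> Poly_Mapping.keys m'"
  have "mon_eval v (m + m') = (\<Prod>x\<in>?X. v x ^ Poly_Mapping.lookup (m + m') x)"
    using Poly_Mapping.keys_add[of m m'] by (intro mon_eval_superset) auto
  also have "\<dots> = mon_eval v m * mon_eval v m'"
    by (simp add: mon_eval_superset[of ?X] lookup_add power_add prod.distrib)
  finally show ?thesis .
qed

lemma mon_eval_zero [simp]: "mon_eval v 0 = 1"
  by (simp add: mon_eval_def)

lemma mpoly_sum_monomials:
  fixes p :: "('x, 'k::field) mpoly"
  shows "p = (\<Sum>m\<in>Poly_Mapping.keys p. Poly_Mapping.single m (Poly_Mapping.lookup p m))"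
proof (rule poly_mapping_eqI)
  fix n
  have "Poly_Mapping.lookup (\<Sum>m\<in>Poly_Mapping.keys p. Poly_Mapping.single m (Poly_Mapping.lookup p m)) n
     = (\<Sum>m\<in>Poly_Mapping.keys p. if m = n then Poly_Mapping.lookup p m else 0)"
    by (auto simp: lookup_sum lookup_single when_def intro!: sum.cong)
  also have "\<dots> = Poly_Mapping.lookup p n" by (simp add: in_keys_iff)
  finally show "Poly_Mapping.lookup p n = Poly_Mapping.lookup (\<Sum>m\<in>Poly_Mapping.keys p. Poly_Mapping.single m (Poly_Mapping.lookup p m)) n" ..
qed

lemma comm_ring_hom_meval:
  fixes \<kappa> :: "'k::field \<Rightarrow> 'a::comm_ring_1"
  assumes "comm_ring_hom \<kappa>"
  shows "comm_ring_hom (meval \<kappa> v)"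
proof -
  interpret \<kappa>: comm_ring_hom \<kappa> by fact
  have add: "meval \<kappa> v (p + q) = meval \<kappa> v p + meval \<kappa> v q" for p q
    unfolding meval_def by (rule setsum_keys_plus_distrib) (auto simp: \<kappa>.hom_add algebra_simps)
  have zero: "meval \<kappa> v 0 = 0" by (simp add: meval_def)
  have single: "meval \<kappa> v (Poly_Mapping.single m c) = \<kappa> c * mon_eval v m" for m c
    by (cases "c = 0") (simp_all add: meval_def)
  have sum: "meval \<kappa> v (sum f I) = (\<Sum>i\<in>I. meval \<kappa> v (f i))" for f :: "('b \<Rightarrow>\<^sub>0 nat) \<Rightarrow> _" and I
    by (induction I rule: infinite_finite_induct) (auto simp: add zero)
  have mult: "meval \<kappa> v (p * q) = meval \<kappa> v p * meval \<kappa> v q" for p q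
  proof -
    have "p * q = (\<Sum>m\<in>Poly_Mapping.keys p. Poly_Mapping.single m (Poly_Mapping.lookup p m)) *
       (\<Sum>m\<in>Poly_Mapping.keys q. Poly_Mapping.single m (Poly_Mapping.lookup q m))"
      using mpoly_sum_monomials[of p] mpoly_sum_monomials[of q] by simp
    also have "\<dots> = (\<Sum>m\<in>Poly_Mapping.keys p. \<Sum>n\<in>Poly_Mapping.keys q.
        Poly_Mapping.single (m + n) (Poly_Mapping.lookup p m * Poly_Mapping.lookup q n))"
      by (simp add: sum_product mult_single)
    finally have "meval \<kappa> v (p * q) = (\<Sum>m\<in>Poly_Mapping.keys p. \<Sum>n\<in>Poly_Mapping.keys q.
        \<kappa> (Poly_Mapping.lookup p m * Poly_Mapping.lookup q n) * mon_eval v (m + n))"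
      by (simp add: sum single)
    also have "\<dots> = meval \<kappa> v p * meval \<kappa> v q"
      unfolding meval_def sum_product
      by (intro sum.cong refl) (simp add: \<kappa>.hom_mult mon_eval_add mult_ac)
    finally show ?thesis .
  qed
  have "meval \<kappa> v 1 = 1"
    using single[of 0 1] by simp
  then show ?thesis by unfold_locales (auto simp: add mult zero)
qed

lemma meval_mconst:
  assumes "comm_ring_hom \<kappa>" shows "meval \<kappa> v (mconst c) = \<kappa> c"
proof -
  interpret \<kappa>: comm_ring_hom \<kappa> by fact
  show ?thesis by (cases "c = 0") (simp_all add: meval_def mconst_def)
qed

lemma meval_mvar:
  assumes "comm_ring_hom \<kappa>" shows "meval \<kappa> v (mvar x) = v x"
proof -
  interpret \<kappa>: comm_ring_hom \<kappa> by fact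
  show ?thesis by (simp add: meval_def mvar_def mon_eval_def)
qed

lemma comm_ring_hom_mconst: "comm_ring_hom (mconst :: 'k::field \<Rightarrow> ('x, 'k) mpoly)"
  by unfold_locales (auto simp: mconst_def single_add mult_single)

lemma comm_ring_hom_compose:
  assumes "comm_ring_hom f" "comm_ring_hom g" shows "comm_ring_hom (\<lambda>x. f (g x))"
proof -
  interpret f: comm_ring_hom f by fact
  interpret g: comm_ring_hom g by fact
  show ?thesis by unfold_locales (auto simp: g.hom_add f.hom_add g.hom_mult f.hom_mult)
qed

text \<open>The polynomials whose variables all lie in \<open>V\<close>.\<close>

abbreviation mpolys :: "'x set \<Rightarrow> ('x, 'k::field) mpoly set" where
  "mpolys V \<equiv> carrier (mpoly_ring V)"

lemma mpolys_def: "p \<in> mpolys V \<longleftrightarrow> (\<forall>m\<in>Poly_Mapping.keys p. Poly_Mapping.keys m \<subseteq> V)"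
  by (simp add: mpoly_ring_def)

lemma is_subring_mpolys: "is_subring (mpolys V)"
proof (rule is_subringI)
  show "1 \<in> mpolys V" by (simp add: mpolys_def)
  fix a b :: "('a, 'b) mpoly" assume a: "a \<in> mpolys V" and b: "b \<in> mpolys V"
  have "Poly_Mapping.keys (a - b) \<subseteq> Poly_Mapping.keys a \<union> Poly_Mapping.keys b"
    by (auto simp: in_keys_iff lookup_minus)
  then show "a - b \<in> mpolys V" using a b by (auto simp: mpolys_def)
  show "a * b \<in> mpolys V" unfolding mpolys_def
  proof
    fix m assume "m \<in> Poly_Mapping.keys (a * b)"
    then obtain m1 m2 where "m = m1 + m2" "m1 \<in> Poly_Mapping.keys a" "m2 \<in> Poly_Mapping.keys b"
      using keys_mult[of a b] by blast
    then show "Poly_Mapping.keys m \<subseteq> V"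
      using a b Poly_Mapping.keys_add[of m1 m2] unfolding mpolys_def by blast
  qed
qed

lemma mconst_in_mpolys: "mconst c \<in> mpolys V"
  by (cases "c = 0") (simp_all add: mpolys_def mconst_def)

lemma mvar_in_mpolys: "x \<in> V \<Longrightarrow> mvar x \<in> mpolys V"
  by (simp add: mpolys_def mvar_def)

lemma mpolys_mono: "V \<subseteq> W \<Longrightarrow> mpolys V \<subseteq> mpolys W"
  unfolding mpolys_def subset_iff by blast

lemma mpolys_induct [consumes 1, case_names const var add mult]:
  fixes p :: "('x, 'k::field) mpoly"
  assumes p: "p \<in> mpolys V"
    and const: "\<And>c. P (mconst c)" and var: "\<And>x. x \<in> V \<Longrightarrow> P (mvar x)"
    and add: "\<And>p q. p \<in> mpolys V \<Longrightarrow> q \<in> mpolys V \<Longrightarrow> P p \<Longrightarrow> P q \<Longrightarrow> P (p + q)"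
    and mult: "\<And>p q. p \<in> mpolys V \<Longrightarrow> q \<in> mpolys V \<Longrightarrow> P p \<Longrightarrow> P q \<Longrightarrow> P (p * q)"
  shows "P p"
proof -
  interpret mc: comm_ring_hom "mconst :: 'k \<Rightarrow> ('x, 'k) mpoly" by (rule comm_ring_hom_mconst)
  have R: "is_subring (mpolys V :: ('x, 'k) mpoly set)" by (rule is_subring_mpolys)
  define G where "G = {q :: ('x, 'k) mpoly. q \<in> mpolys V \<and> P q}"
  have c: "mconst c \<in> G" for c using const by (simp add: G_def mconst_in_mpolys)
  have a: "p + q \<in> G" if "p \<in> G" "q \<in> G" for p q
    using that add is_subring_add[OF R] by (simp add: G_def)
  have m: "p * q \<in> G" if "p \<in> G" "q \<in> G" for p q
    using that mult is_subring_mult[OF R] by (simp add: G_def)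
  have 0: "0 \<in> G" and 1: "1 \<in> G" using c[of 0] c[of 1] by simp_all
  have pw: "q ^ i \<in> G" if "q \<in> G" for q i
    by (induction i) (auto simp: 1 m that)
  have pr: "prod f I \<in> G" if "\<And>i. i \<in> I \<Longrightarrow> f i \<in> G" for f and I :: "'x set"
    using that by (induction I rule: infinite_finite_induct) (auto simp: 1 m)
  have su: "sum f I \<in> G" if "\<And>i. i \<in> I \<Longrightarrow> f i \<in> G" for f and I :: "('x \<Rightarrow>\<^sub>0 nat) set"
    using that by (induction I rule: infinite_finite_induct) (auto simp: 0 a)
  have sg: "Poly_Mapping.single n d = mconst d * (\<Prod>x\<in>Poly_Mapping.keys n. mvar x ^ Poly_Mapping.lookup n x)"
    for n :: "'x \<Rightarrow>\<^sub>0 nat" and d :: 'k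
  proof -
    have vp: "mvar x ^ i = Poly_Mapping.single (Poly_Mapping.single x i) (1::'k)" for x :: 'x and i
      by (induction i) (auto simp: mvar_def mult_single simp flip: single_add)
    have "(\<Prod>x\<in>X. Poly_Mapping.single (Poly_Mapping.single x (Poly_Mapping.lookup n x)) (1::'k))
        = Poly_Mapping.single (\<Sum>x\<in>X. Poly_Mapping.single x (Poly_Mapping.lookup n x)) 1" for X
      by (induction X rule: infinite_finite_induct) (auto simp: mult_single)
    moreover have "(\<Sum>x\<in>Poly_Mapping.keys n. Poly_Mapping.single x (Poly_Mapping.lookup n x)) = n"
    proof (rule poly_mapping_eqI)
      fix y
      have "Poly_Mapping.lookup (\<Sum>x\<in>Poly_Mapping.keys n. Poly_Mapping.single x (Poly_Mapping.lookup n x)) y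
        = (\<Sum>x\<in>Poly_Mapping.keys n. if x = y then Poly_Mapping.lookup n x else 0)"
        by (auto simp: lookup_sum lookup_single when_def intro!: sum.cong)
      then show "Poly_Mapping.lookup (\<Sum>x\<in>Poly_Mapping.keys n. Poly_Mapping.single x (Poly_Mapping.lookup n x)) y
        = Poly_Mapping.lookup n y" by (simp add: in_keys_iff)
    qed
    ultimately show ?thesis by (simp add: vp mconst_def mult_single)
  qed
  have "p \<in> G"
  proof (subst mpoly_sum_monomials[of p], rule su)
    fix n assume n: "n \<in> Poly_Mapping.keys p"
    have "mvar x \<in> G" if "x \<in> Poly_Mapping.keys n" for x
      using that n p var mvar_in_mpolys[of x V] unfolding G_def mpolys_def by blast
    then show "Poly_Mapping.single n (Poly_Mapping.lookup p n) \<in> G"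
      unfolding sg by (intro m c pr pw)
  qed
  then show ?thesis by (simp add: G_def)
qed

lemma hom_eq_on_mpolys:
  assumes f: "comm_ring_hom f" and g: "comm_ring_hom g"
    and const: "\<And>c. f (mconst c) = g (mconst c)"
    and var: "\<And>x. x \<in> V \<Longrightarrow> f (mvar x) = g (mvar x)" and p: "p \<in> mpolys V"
  shows "f p = g p"
proof -
  interpret f: comm_ring_hom f by fact
  interpret g: comm_ring_hom g by fact
  show ?thesis using p
    by (induction p rule: mpolys_induct) (auto simp: const var f.hom_add g.hom_add f.hom_mult g.hom_mult)
qed

section \<open>Polynomial rings over a field are factorial\<close>

text \<open>The tower \<open>K[x\<^sub>0] \<subseteq> K[x\<^sub>0, x\<^sub>1] \<subseteq> \<dots>\<close>: each step adjoins a variable, by evaluation of polynomials at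
that variable.\<close>

lemma mpolys_Suc:
  "mpolys {..<Suc N} = (\<lambda>q. poly q (mvar N)) ` polys_over (mpolys {..<N} :: (nat, 'k::field) mpoly set)"
    (is "_ = ?h ` ?Q")
proof
  have R: "is_subring (mpolys {..<N} :: (nat, 'k) mpoly set)"
    and R': "is_subring (mpolys {..<Suc N} :: (nat, 'k) mpoly set)" by (rule is_subring_mpolys)+
  have Q: "is_subring ?Q" by (rule is_subring_polys_over[OF R])
  show "?h ` ?Q \<subseteq> mpolys {..<Suc N}"
  proof
    fix x assume "x \<in> ?h ` ?Q"
    then obtain q where q: "q \<in> ?Q" "x = poly q (mvar N)" by blast
    have "coeff q i \<in> mpolys {..<Suc N}" for i
      using coeff_in_base[OF q(1), of i] mpolys_mono[of "{..<N}" "{..<Suc N}"] by auto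
    then show "x \<in> mpolys {..<Suc N}" unfolding q(2) poly_altdef
      by (intro is_subring_sum[OF R'] is_subring_mult[OF R'] is_subring_power[OF R'] mvar_in_mpolys) auto
  qed
  show "mpolys {..<Suc N} \<subseteq> ?h ` ?Q"
  proof
    fix p :: "(nat, 'k) mpoly" assume "p \<in> mpolys {..<Suc N}"
    then show "p \<in> ?h ` ?Q"
    proof (induction p rule: mpolys_induct)
      case (const c)
      show ?case by (rule image_eqI[of _ _ "[:mconst c:]"]) (simp_all add: R mconst_in_mpolys)
    next
      case (var x)
      show ?case
      proof (cases "x = N")
        case True
        have "[:0, 1:] \<in> ?Q"
          using R is_subring_zero[OF R] is_subring_one[OF R]
          by (auto simp: polys_over_def coeff_pCons split: nat.split)
        then show ?thesis using True by (intro image_eqI[of _ _ "[:0, 1:]"]) auto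
      next
        case False
        then have "[:mvar x:] \<in> ?Q" using R var by (simp add: mvar_in_mpolys)
        then show ?thesis by (intro image_eqI[of _ _ "[:mvar x:]"]) auto
      qed
    next
      case (add p q)
      then obtain p' q' where "p' \<in> ?Q" "q' \<in> ?Q" "p = ?h p'" "q = ?h q'" by blast
      then show ?case using is_subring_add[OF Q] by (intro image_eqI[of _ _ "p' + q'"]) auto
    next
      case (mult p q)
      then obtain p' q' where "p' \<in> ?Q" "q' \<in> ?Q" "p = ?h p'" "q = ?h q'" by blast
      then show ?case using is_subring_mult[OF Q] by (intro image_eqI[of _ _ "p' * q'"]) auto
    qed
  qed
qed

text \<open>The inverse map is the homomorphism that sends the new variable to \<open>X\<close> and fixes the others.\<close>

lemma poly_mvar_inj:
  "inj_on (\<lambda>q. poly q (mvar N)) (polys_over (mpolys {..<N} :: (nat, 'k::field) mpoly set))"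
proof -
  have kap: "comm_ring_hom (\<lambda>c :: 'k. [:mconst c :: (nat, 'k) mpoly:])"
    by unfold_locales (auto simp: mconst_def single_add mult_single one_pCons mult.commute)
  define \<theta> where "\<theta> = meval (\<lambda>c :: 'k. [:mconst c :: (nat, 'k) mpoly:])
      (\<lambda>i. if i = N then [:0, 1:] else [:mvar i:])"
  interpret \<theta>: comm_ring_hom \<theta> unfolding \<theta>_def by (rule comm_ring_hom_meval[OF kap])
  have const: "\<theta> p = [:p:]" if "p \<in> mpolys {..<N}" for p
    using that
  proof (induction p rule: mpolys_induct)
    case (const c) then show ?case by (simp add: \<theta>_def meval_mconst[OF kap])
  next
    case (var x) then show ?case by (simp add: \<theta>_def meval_mvar[OF kap])
  qed (simp_all add: \<theta>.hom_add \<theta>.hom_mult)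
  have X: "\<theta> (mvar N) = [:0, 1:]" by (simp add: \<theta>_def meval_mvar[OF kap])
  have "\<theta> (poly q (mvar N)) = q" if q: "q \<in> polys_over (mpolys {..<N})" for q
  proof -
    have "\<theta> (poly q (mvar N)) = (\<Sum>i\<le>degree q. \<theta> (coeff q i) * \<theta> (mvar N) ^ i)"
      by (simp add: poly_altdef \<theta>.hom_sum \<theta>.hom_mult \<theta>.hom_power)
    also have "\<dots> = (\<Sum>i\<le>degree q. Polynomial.monom (coeff q i) i)"
      using coeff_in_base[OF q] by (intro sum.cong refl) (simp add: const X monom_altdef)
    also have "\<dots> = q" by (rule poly_as_sum_of_monoms)
    finally show ?thesis .
  qed
  then show ?thesis by (rule inj_on_inverseI)
qed

lemma ufd_on_mpolys:
  "ufd_on (mpolys {..<N} :: (nat, 'k::field) mpoly set)"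
proof (induction N)
  case 0
  have "prime_factored (mpolys {..<0}) a" if a: "a \<in> mpolys {..<0}" "a \<noteq> 0" for a :: "(nat, 'k) mpoly"
  proof -
    have "\<exists>c. a = mconst c" using a(1)
    proof (induction a rule: mpolys_induct)
      case (add p q)
      then show ?case using comm_ring_hom_mconst by (metis mconst_def single_add)
    next
      case (mult p q)
      then show ?case by (auto simp: mconst_def mult_single)
    qed auto
    then obtain c where c: "a = mconst c" by blast
    then have "c \<noteq> 0" using a(2) by (auto simp: mconst_def)
    then have "a * mconst (inverse c) = 1" unfolding c by (simp add: mconst_def mult_single)
    then have "unit_on (mpolys {..<0}) a" using a mconst_in_mpolys unfolding unit_on_def by blast
    then show ?thesis by (rule prime_factored_unit)
  qed
  then show ?case using is_subring_mpolys by (auto simp: ufd_on_def)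
next
  case (Suc N)
  interpret factorial_subring "mpolys {..<N} :: (nat, 'k) mpoly set" by unfold_locales (rule Suc)
  show ?case unfolding mpolys_Suc
    by (rule ufd_on_image(1)[OF gauss_ufd poly_mvar_inj]) auto
qed

lemma prime_on_mpolys_Suc:
  fixes p :: "(nat, 'k::field) mpoly"
  assumes "prime_on (mpolys {..<N}) p" shows "prime_on (mpolys {..<Suc N}) p"
proof -
  interpret factorial_subring "mpolys {..<N} :: (nat, 'k) mpoly set" by unfold_locales (rule ufd_on_mpolys)
  have "prime_on ((\<lambda>q. poly q (mvar N)) ` DX) (poly [:p:] (mvar N))"
    by (rule ufd_on_image(2)[OF gauss_ufd poly_mvar_inj]) (use prime_on_const[OF subring_D assms] in auto)
  then show ?thesis by (simp add: mpolys_Suc)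
qed

lemma mpolys_exhaust: "\<exists>N. p \<in> mpolys {..<N}" for p :: "(nat, 'k::field) mpoly"
proof -
  have "finite (\<Union>m\<in>Poly_Mapping.keys p. Poly_Mapping.keys m)" by simp
  then obtain N where "(\<Union>m\<in>Poly_Mapping.keys p. Poly_Mapping.keys m) \<subseteq> {..<N}"
    using finite_nat_iff_bounded by blast
  then show ?thesis unfolding mpolys_def by blast
qed

text \<open>All variables at once: a polynomial lies in some step of the tower, and its prime factors there
stay prime in all later steps.\<close>

theorem ufd_on_UNIV_mpoly: "ufd_on (UNIV :: (nat, 'k::field) mpoly set)"
proof -
  have prime: "prime_on UNIV p" if p: "prime_on (mpolys {..<N}) p" for N and p :: "(nat, 'k) mpoly"
  proof -
    have pN: "prime_on (mpolys {..<N + i}) p" for i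
      by (induction i) (auto intro: p prime_on_mpolys_Suc)
    have ex: "\<exists>i. q \<in> mpolys {..<N + i} \<and> r \<in> mpolys {..<N + i} \<and> s \<in> mpolys {..<N + i}"
      for q r s :: "(nat, 'k) mpoly"
    proof -
      obtain a b c where "q \<in> mpolys {..<a}" "r \<in> mpolys {..<b}" "s \<in> mpolys {..<c}"
        using mpolys_exhaust by metis
      moreover have "mpolys {..<m} \<subseteq> mpolys {..<N + (a + b + c)}" if "m \<in> {a, b, c}" for m
        using that by (intro mpolys_mono) auto
      ultimately show ?thesis by blast
    qed
    show ?thesis unfolding prime_on_def
    proof (intro conjI ballI impI)
      show "p \<noteq> 0" using p by (simp add: prime_on_def)
      show "\<not> unit_on UNIV p"
      proof
        assume "unit_on UNIV p"
        then obtain q where q: "p * q = 1" by (auto simp: unit_on_def)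
        obtain i where i: "p \<in> mpolys {..<N + i}" "q \<in> mpolys {..<N + i}" using ex by metis
        then show False using pN[of i] q by (auto simp: prime_on_def unit_on_def)
      qed
      fix a b assume "dvd_on UNIV p (a * b)"
      then obtain c where c: "a * b = p * c" by (auto simp: dvd_on_def)
      obtain i where "a \<in> mpolys {..<N + i}" "b \<in> mpolys {..<N + i}" "c \<in> mpolys {..<N + i}"
        using ex by metis
      then show "dvd_on UNIV p a \<or> dvd_on UNIV p b"
        using pN[of i] c unfolding prime_on_def dvd_on_def by blast
    qed simp
  qed
  have "prime_factored UNIV a" if "a \<noteq> 0" for a :: "(nat, 'k) mpoly"
  proof -
    obtain N where "a \<in> mpolys {..<N}" using mpolys_exhaust by blast
    then have "prime_factored (mpolys {..<N}) a"
      using ufd_on_mpolys[where ?'k='k, of N] that unfolding ufd_on_def by blast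
    then obtain u ps where *: "unit_on (mpolys {..<N}) u" "\<forall>p\<in>set ps. prime_on (mpolys {..<N}) p"
      "a = u * prod_list ps"
      unfolding prime_factored_def by blast
    then have "unit_on UNIV u" unfolding unit_on_def by blast
    moreover have "\<forall>p\<in>set ps. prime_on UNIV p" using * prime by blast
    ultimately show ?thesis using *(3) unfolding prime_factored_def by blast
  qed
  then show ?thesis by (auto simp: ufd_on_def is_subring_def)
qed

section \<open>Localizations realized in a field\<close>

text \<open>If \<open>\<psi>\<close> maps \<open>Q\<close> to a field, is nonzero on \<open>S\<close>, and kills only \<open>S\<close>-torsion, then the class of the
fraction \<open>x / s\<close> is the fibre of \<open>(x, s) \<mapsto> \<psi> x / \<psi> s\<close>. So the localization is the ring of
these quotients.\<close>

theorem factorial_domain_localization: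
  fixes Q (structure) and \<psi> :: "'a \<Rightarrow> 'f::field"
  assumes Q: "cring Q" and SQ: "S \<subseteq> carrier Q" and S1: "\<one> \<in> S"
    and SS: "\<And>s t. s \<in> S \<Longrightarrow> t \<in> S \<Longrightarrow> s \<otimes> t \<in> S"
    and one: "\<psi> \<one> = 1"
    and add: "\<And>x y. x \<in> carrier Q \<Longrightarrow> y \<in> carrier Q \<Longrightarrow> \<psi> (x \<oplus> y) = \<psi> x + \<psi> y"
    and mult: "\<And>x y. x \<in> carrier Q \<Longrightarrow> y \<in> carrier Q \<Longrightarrow> \<psi> (x \<otimes> y) = \<psi> x * \<psi> y"
    and inv: "\<And>s. s \<in> S \<Longrightarrow> \<psi> s \<noteq> 0"
    and ker: "\<And>x. x \<in> carrier Q \<Longrightarrow> \<psi> x = 0 \<Longrightarrow> \<exists>t\<in>S. t \<otimes> x = \<zero>"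
    and T: "ufd_on {\<psi> x / \<psi> s |x s. x \<in> carrier Q \<and> s \<in> S}"
  shows "factorial_domain (localization Q S)"
proof -
  interpret Q: cring Q by fact
  let ?T = "{\<psi> x / \<psi> s |x s. x \<in> carrier Q \<and> s \<in> S}"
  define h where "h y = {(x, s). x \<in> carrier Q \<and> s \<in> S \<and> \<psi> x / \<psi> s = y}" for y
  have zero: "\<psi> \<zero> = 0" using add[OF Q.zero_closed Q.zero_closed] by (metis Q.l_zero Q.zero_closed add_cancel_right_left)
  have minus: "\<psi> (x \<ominus> y) = \<psi> x - \<psi> y" if "x \<in> carrier Q" "y \<in> carrier Q" for x y
  proof -
    have "x = (x \<ominus> y) \<oplus> y" using that by algebra
    then have "\<psi> x = \<psi> (x \<ominus> y) + \<psi> y" using add[of "x \<ominus> y" y] that by simp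
    then show ?thesis by simp
  qed
  have frac: "loc_frac Q S x s = h (\<psi> x / \<psi> s)" if xs: "x \<in> carrier Q" "s \<in> S" for x s
  proof -
    have "(\<exists>t\<in>S. t \<otimes> (x \<otimes> s') = t \<otimes> (x' \<otimes> s)) \<longleftrightarrow> \<psi> x' / \<psi> s' = \<psi> x / \<psi> s"
      if xs': "x' \<in> carrier Q" "s' \<in> S" for x' s'
    proof
      have sc: "s \<in> carrier Q" "s' \<in> carrier Q" using xs xs' SQ by auto
      assume "\<exists>t\<in>S. t \<otimes> (x \<otimes> s') = t \<otimes> (x' \<otimes> s)"
      then obtain t where t: "t \<in> S" "t \<otimes> (x \<otimes> s') = t \<otimes> (x' \<otimes> s)" by blast
      have tc: "t \<in> carrier Q" using t SQ by auto
      have "\<psi> t * (\<psi> x * \<psi> s') = \<psi> t * (\<psi> x' * \<psi> s)"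
        using arg_cong[OF t(2), of \<psi>] tc sc xs xs' by (simp add: mult)
      then have "\<psi> x * \<psi> s' = \<psi> x' * \<psi> s" using inv[OF t(1)] by simp
      then show "\<psi> x' / \<psi> s' = \<psi> x / \<psi> s"
        using inv[OF xs(2)] inv[OF xs'(2)] by (simp add: frac_eq_eq)
    next
      have sc: "s \<in> carrier Q" "s' \<in> carrier Q" using xs xs' SQ by auto
      assume "\<psi> x' / \<psi> s' = \<psi> x / \<psi> s"
      then have "\<psi> x * \<psi> s' = \<psi> x' * \<psi> s"
        using inv[OF xs(2)] inv[OF xs'(2)] by (simp add: frac_eq_eq)
      then have "\<psi> (x \<otimes> s' \<ominus> x' \<otimes> s) = 0" using xs xs' sc by (simp add: minus mult)
      then obtain t where t: "t \<in> S" "t \<otimes> (x \<otimes> s' \<ominus> x' \<otimes> s) = \<zero>"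
        using ker[of "x \<otimes> s' \<ominus> x' \<otimes> s"] xs xs' sc by auto
      have tc: "t \<in> carrier Q" using t SQ by auto
      have "t \<otimes> (x \<otimes> s') = t \<otimes> (x \<otimes> s' \<ominus> x' \<otimes> s) \<oplus> t \<otimes> (x' \<otimes> s)"
        using tc sc xs xs' by algebra
      also have "\<dots> = t \<otimes> (x' \<otimes> s)" using t(2) tc sc xs xs' by simp
      finally show "\<exists>t\<in>S. t \<otimes> (x \<otimes> s') = t \<otimes> (x' \<otimes> s)" using t(1) by blast
    qed
    then show ?thesis unfolding loc_frac_def h_def by auto
  qed
  have ex: "\<exists>x s. x \<in> carrier Q \<and> s \<in> S \<and> y = \<psi> x / \<psi> s \<and> (x, s) \<in> h y" if "y \<in> ?T" for y
    using that unfolding h_def by auto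
  have hD: "x \<in> carrier Q \<and> s \<in> S \<and> s \<in> carrier Q \<and> y = \<psi> x / \<psi> s" if "(x, s) \<in> h y" for x s y
    using that SQ unfolding h_def by auto
  let ?L = "localization Q S"
  show ?thesis
  proof (rule factorial_domain_of_ufd_on[OF T])
    show "bij_betw h ?T (carrier ?L)" unfolding bij_betw_def
    proof
      show "inj_on h ?T"
      proof (rule inj_onI)
        fix y z assume "y \<in> ?T" "h y = h z"
        then show "y = z" using ex[of y] hD by metis
      qed
      have "carrier ?L = {h (\<psi> x / \<psi> s) |x s. x \<in> carrier Q \<and> s \<in> S}"
        unfolding localization_def using frac by auto metis+
      then show "h ` ?T = carrier ?L" by auto
    qed
    show "h 1 = \<one>\<^bsub>?L\<^esub>"
      using frac[OF Q.one_closed S1] by (simp add: localization_def one)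
    show "h 0 = \<zero>\<^bsub>?L\<^esub>"
      using frac[OF Q.zero_closed S1] by (simp add: localization_def zero)
    fix y z assume y: "y \<in> ?T" and z: "z \<in> ?T"
    have cl: "s \<otimes> t \<in> S" if "s \<in> S" "t \<in> S" for s t using SS that .
    have "y * z = \<psi> (x \<otimes> x') / \<psi> (s \<otimes> s')" "x \<otimes> x' \<in> carrier Q"
      "y + z = \<psi> (x \<otimes> s' \<oplus> x' \<otimes> s) / \<psi> (s \<otimes> s')" "x \<otimes> s' \<oplus> x' \<otimes> s \<in> carrier Q" "s \<otimes> s' \<in> S"
      if "(x, s) \<in> h y" "(x', s') \<in> h z" for x s x' s'
    proof -
      note * = hD[OF that(1)] hD[OF that(2)]
      show "y * z = \<psi> (x \<otimes> x') / \<psi> (s \<otimes> s')" using * by (simp add: mult)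
      show "y + z = \<psi> (x \<otimes> s' \<oplus> x' \<otimes> s) / \<psi> (s \<otimes> s')"
        using * inv by (simp add: mult add add_frac_eq)
    qed (use hD[OF that(1)] hD[OF that(2)] SS in auto)
    note * = this
    obtain p where p: "p \<in> h y" using ex[OF y] by blast
    obtain p' where p': "p' \<in> h z" using ex[OF z] by blast
    have "(\<Union>(x, s)\<in>h y. \<Union>(x', s')\<in>h z. loc_frac Q S (x \<otimes> x') (s \<otimes> s')) = (\<Union>_\<in>h y. \<Union>_\<in>h z. h (y * z))"
      using *(1,2,5) frac by (intro SUP_cong refl) (auto split: prod.splits, metis+)
    also have "\<dots> = h (y * z)" using p p' by auto
    finally show "h (y * z) = h y \<otimes>\<^bsub>?L\<^esub> h z" by (simp add: localization_def)
    have "(\<Union>(x, s)\<in>h y. \<Union>(x', s')\<in>h z. loc_frac Q S (x \<otimes> s' \<oplus> x' \<otimes> s) (s \<otimes> s'))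
      = (\<Union>_\<in>h y. \<Union>_\<in>h z. h (y + z))"
      using *(3-5) frac by (intro SUP_cong refl) (auto split: prod.splits, metis+)
    also have "\<dots> = h (y + z)" using p p' by auto
    finally show "h (y + z) = h y \<oplus>\<^bsub>?L\<^esub> h z" by (simp add: localization_def)
  qed
qed

section \<open>The coordinate ring of an open Richardson variety\<close>

lemma cring_mpoly_ring: "cring (mpoly_ring V)"
proof -
  note R = is_subring_mpolys[of V]
  have eqs: "mult (mpoly_ring V) = (*)" "add (mpoly_ring V) = (+)" "one (mpoly_ring V) = 1" "zero (mpoly_ring V) = 0"
    by (simp_all add: mpoly_ring_def)
  show ?thesis
  proof (rule cringI)
    show "abelian_group (mpoly_ring V)"
    proof (rule abelian_groupI)
      fix x assume "x \<in> mpolys V"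
      then show "\<exists>y\<in>mpolys V. y \<oplus>\<^bsub>mpoly_ring V\<^esub> x = \<zero>\<^bsub>mpoly_ring V\<^esub>"
        using is_subring_uminus[OF R] by (intro bexI[of _ "- x"]) (simp_all add: eqs)
    qed (auto simp: eqs intro: is_subring_add[OF R] is_subring_zero[OF R])
    show "comm_monoid (mpoly_ring V)"
      by (rule comm_monoidI) (auto simp: eqs mult_ac intro: is_subring_mult[OF R] is_subring_one[OF R])
  qed (auto simp: eqs algebra_simps)
qed

lemma mpoly_ring_simps:
  "mult (mpoly_ring V) = (*)" "add (mpoly_ring V) = (+)" "one (mpoly_ring V) = 1" "zero (mpoly_ring V) = 0"
  by (simp_all add: mpoly_ring_def)

lemma finite_k_subset: "\<alpha> \<in> k_subsets k n \<Longrightarrow> finite \<alpha>"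
  unfolding k_subsets_def using finite_subset by blast

lemma elt_Suc_mem:
  assumes "\<alpha> \<in> k_subsets k n" "j < k"
  shows "elt \<alpha> (j + 1) \<in> \<alpha>" "elt \<alpha> (j + 1) \<in> {1..n}"
proof -
  have "length (sorted_list_of_set \<alpha>) = k" using assms by (simp add: k_subsets_def)
  then have "elt \<alpha> (j + 1) \<in> set (sorted_list_of_set \<alpha>)" using assms(2) by (simp add: elt_def)
  then show "elt \<alpha> (j + 1) \<in> \<alpha>" using finite_k_subset[OF assms(1)] by simp
  then show "elt \<alpha> (j + 1) \<in> {1..n}" using assms(1) unfolding k_subsets_def by blast
qed

lemma is_subring_det:
  assumes S: "is_subring S" and A: "\<And>i j. i < k \<Longrightarrow> j < k \<Longrightarrow> f (i, j) \<in> S"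
  shows "det (mat k k f) \<in> S"
proof -
  have sg: "signof p \<in> S" for p :: "nat \<Rightarrow> nat"
    using is_subring_one[OF S] is_subring_uminus[OF S] by (auto simp: sign_def)
  have "signof p * (\<Prod>i = 0..<k. mat k k f $$ (i, p i)) \<in> S" if "p permutes {0..<k}" for p
  proof -
    have "mat k k f $$ (i, p i) \<in> S" if "i \<in> {0..<k}" for i
      using A[of i "p i"] that permutes_in_image[OF \<open>p permutes {0..<k}\<close>, of i] by auto
    then show ?thesis by (intro is_subring_mult[OF S] sg is_subring_prod[OF S])
  qed
  then show ?thesis by (subst det_def'[of _ k]) (auto intro!: is_subring_sum[OF S])
qed

lemma generic_minor_in_mpolys:
  assumes "\<alpha> \<in> k_subsets k n" shows "generic_minor k \<alpha> \<in> mpolys ({1..k} \<times> {1..n})"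
  unfolding generic_minor_def
  by (rule is_subring_det[OF is_subring_mpolys]) (use elt_Suc_mem[OF assms] in \<open>auto intro!: mvar_in_mpolys\<close>)

lemma pluecker_hom:
  "ring_hom_ring (coord_ring k n) (mpoly_ring ({1..k} \<times> {1..n}) :: (nat \<times> nat, 'k::field) mpoly ring)
     (mpoly_subst (generic_minor k))"
proof -
  interpret C: cring "coord_ring k n :: (nat set, 'k) mpoly ring"
    unfolding coord_ring_def by (rule cring_mpoly_ring)
  interpret M: cring "mpoly_ring ({1..k} \<times> {1..n}) :: (nat \<times> nat, 'k) mpoly ring"
    by (rule cring_mpoly_ring)
  interpret h: comm_ring_hom "mpoly_subst (generic_minor k) :: _ \<Rightarrow> (nat \<times> nat, 'k) mpoly"
    unfolding mpoly_subst_eq_meval by (rule comm_ring_hom_meval[OF comm_ring_hom_mconst])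
  have cl: "mpoly_subst (generic_minor k) p \<in> (mpolys ({1..k} \<times> {1..n}) :: (nat \<times> nat, 'k) mpoly set)"
    if "p \<in> mpolys (k_subsets k n)" for p
    using that
  proof (induction p rule: mpolys_induct)
    case (const c)
    then show ?case by (simp add: mpoly_subst_eq_meval meval_mconst comm_ring_hom_mconst mconst_in_mpolys)
  next
    case (var x)
    then show ?case
      using generic_minor_in_mpolys[of x k n]
      by (simp add: mpoly_subst_eq_meval meval_mvar comm_ring_hom_mconst)
  next
    case (add p q)
    then show ?case by (simp add: h.hom_add is_subring_add[OF is_subring_mpolys])
  next
    case (mult p q)
    then show ?case by (simp add: h.hom_mult is_subring_mult[OF is_subring_mpolys])
  qed
  have "mpoly_subst (generic_minor k) \<in> Ring.ring_hom (coord_ring k n)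
      (mpoly_ring ({1..k} \<times> {1..n}) :: (nat \<times> nat, 'k) mpoly ring)"
    unfolding Ring.ring_hom_def coord_ring_def
    using cl by (auto simp: mpoly_ring_simps h.hom_add h.hom_mult)
  then show ?thesis
    by (intro ring_hom_ringI2) unfold_locales
qed

text \<open>The ideals of the ring of Pluecker coordinates that contain the Pluecker ideal and the coordinates
outside the interval from \<open>\<beta>\<close> to \<open>\<gamma>\<close>. The smallest one defines the Richardson variety; the kernel
of any map that factors through the coordinate ring is another one.\<close>

definition pluecker_closed ::
    "nat \<Rightarrow> nat \<Rightarrow> nat set \<Rightarrow> nat set \<Rightarrow> (nat set, 'k::field) mpoly set \<Rightarrow> bool" where
  "pluecker_closed k n \<beta> \<gamma> J \<longleftrightarrow>
     J \<subseteq> mpolys (k_subsets k n) \<and> 0 \<in> J \<and> (\<forall>a\<in>J. \<forall>b\<in>J. a + b \<in> J) \<and>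
     (\<forall>a\<in>J. \<forall>r\<in>mpolys (k_subsets k n). r * a \<in> J) \<and>
     (\<forall>p\<in>mpolys (k_subsets k n). mpoly_subst (generic_minor k) p = 0 \<longrightarrow> p \<in> J) \<and>
     (\<forall>\<alpha>\<in>k_subsets k n - subset_interval k n \<beta> \<gamma>. mvar \<alpha> \<in> J)"

text \<open>A criterion: it suffices to realize the coordinate ring in a field by a homomorphism \<open>\<psi>\<close> whose
kernel is torsion for \<open>\<Delta>\<^sub>\<beta>\<close> and \<open>\<Delta>\<^sub>\<gamma>\<close> modulo every closed ideal, and whose image, with \<open>\<Delta>\<^sub>\<beta>\<close> and
\<open>\<Delta>\<^sub>\<gamma>\<close> inverted, is factorial. In the proof, \<open>q\<close> is the map onto the Richardson coordinate ring and
\<open>\<phi>\<close> is the map induced by \<open>\<psi>\<close> on it.\<close>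

theorem factorial_open_richardson_ring:
  fixes \<psi> :: "(nat set, 'k::field) mpoly \<Rightarrow> 'f::field" and k n :: nat
  defines "V \<equiv> k_subsets k n"
  assumes hom: "comm_ring_hom \<psi>" and \<beta>: "\<beta> \<in> V" and \<gamma>: "\<gamma> \<in> V"
    and pl: "\<And>p. p \<in> mpolys V \<Longrightarrow> mpoly_subst (generic_minor k) p = 0 \<Longrightarrow> \<psi> p = 0"
    and out: "\<And>\<alpha>. \<alpha> \<in> V - subset_interval k n \<beta> \<gamma> \<Longrightarrow> \<psi> (mvar \<alpha>) = 0"
    and \<psi>\<beta>: "\<psi> (mvar \<beta>) \<noteq> 0" and \<psi>\<gamma>: "\<psi> (mvar \<gamma>) \<noteq> 0"
    and ker: "\<And>p J. pluecker_closed k n \<beta> \<gamma> J \<Longrightarrow> p \<in> mpolys V \<Longrightarrow> \<psi> p = 0 \<Longrightarrow>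
        \<exists>i j. mvar \<beta> ^ i * mvar \<gamma> ^ j * p \<in> J"
    and T: "ufd_on {\<psi> p / (\<psi> (mvar \<beta>) ^ i * \<psi> (mvar \<gamma>) ^ j) |p i j. p \<in> mpolys V}"
  shows "factorial_domain (open_richardson_ring TYPE('k) k n \<beta> \<gamma>)"
proof -
  interpret \<psi>: comm_ring_hom \<psi> by fact
  define C where "C = (coord_ring k n :: (nat set, 'k) mpoly ring)"
  define I where "I = (pluecker_ideal k n :: (nat set, 'k) mpoly set)"
  define A where "A = (pluecker_ring k n :: (nat set, 'k) mpoly set ring)"
  define R where "R = (richardson_ideal k n \<beta> \<gamma> :: (nat set, 'k) mpoly set set)"
  define Q where "Q = (richardson_ring k n \<beta> \<gamma> :: (nat set, 'k) mpoly set set ring)"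
  have Cs: "carrier C = mpolys V" "mult C = (*)" "add C = (+)" "one C = 1" "zero C = 0"
    by (simp_all add: C_def coord_ring_def mpoly_ring_simps V_def)
  interpret C: cring C unfolding C_def coord_ring_def by (rule cring_mpoly_ring)
  have Iid: "ideal I C" unfolding I_def C_def pluecker_ideal_def
    by (rule ring_hom_ring.kernel_is_ideal[OF pluecker_hom])
  have I: "p \<in> I \<longleftrightarrow> p \<in> mpolys V \<and> mpoly_subst (generic_minor k) p = 0" for p
    unfolding I_def pluecker_ideal_def a_kernel_def' by (simp add: C_def[symmetric] Cs mpoly_ring_simps)
  interpret I: ideal I C by (rule Iid)
  have A: "A = C Quot I" by (simp add: A_def pluecker_ring_def C_def I_def)
  interpret A: cring A unfolding A by (rule I.quotient_is_cring) unfold_locales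
  define K where "K = {p \<in> mpolys V. \<psi> p = 0}"
  have Kid: "ideal K C"
  proof (rule idealI)
    show "ring C" by unfold_locales
    show "subgroup K (add_monoid C)"
    proof (rule C.add.subgroupI)
      show "K \<subseteq> carrier C" by (auto simp: K_def Cs)
      show "K \<noteq> {}" using is_subring_zero[OF is_subring_mpolys, of V] by (auto simp: K_def)
      fix a assume a: "a \<in> K"
      have "\<ominus>\<^bsub>C\<^esub> a = - a"
        using a is_subring_uminus[OF is_subring_mpolys] by (intro C.minus_equality) (auto simp: K_def Cs)
      then show "\<ominus>\<^bsub>C\<^esub> a \<in> K" using a is_subring_uminus[OF is_subring_mpolys, of a V]
        by (auto simp: K_def \<psi>.hom_uminus)
    next
      fix a b assume "a \<in> K" "b \<in> K"
      then show "a \<oplus>\<^bsub>C\<^esub> b \<in> K"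
        using is_subring_add[OF is_subring_mpolys, of a V b] by (auto simp: K_def Cs \<psi>.hom_add)
    qed
    fix a x assume "a \<in> K" "x \<in> carrier C"
    then show "x \<otimes>\<^bsub>C\<^esub> a \<in> K" "a \<otimes>\<^bsub>C\<^esub> x \<in> K"
      using is_subring_mult[OF is_subring_mpolys, of a V x] by (auto simp: K_def Cs \<psi>.hom_mult mult.commute)
  qed
  have gens: "pluecker_coord k n ` (k_subsets k n - subset_interval k n \<beta> \<gamma>) \<subseteq> carrier A"
    unfolding A by (auto simp: pluecker_coord_def I_def[symmetric] C_def[symmetric] FactRing_def A_RCOSETS_def'
          Cs V_def intro!: mvar_in_mpolys)
  have Rid: "ideal R A" unfolding R_def richardson_ideal_def A_def[symmetric]
    by (rule A.genideal_ideal[OF gens])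
  interpret R: ideal R A by (rule Rid)
  have Q: "Q = A Quot R" by (simp add: Q_def richardson_ring_def A_def R_def)
  interpret Q: cring Q unfolding Q by (rule R.quotient_is_cring) unfold_locales
  define q where "q p = R +>\<^bsub>A\<^esub> (I +>\<^bsub>C\<^esub> p)" for p
  have qh: "q \<in> Ring.ring_hom C Q"
    using ring_hom_trans[OF I.rcos_ring_hom, of "(+>\<^bsub>A\<^esub>) R" Q] R.rcos_ring_hom
    unfolding A[symmetric] Q[symmetric] by (simp add: comp_def q_def[abs_def])
  interpret q: ring_hom_ring C Q q by (rule ring_hom_ringI2[OF _ _ qh]) unfold_locales
  have surj: "\<exists>p\<in>mpolys V. x = q p" if "x \<in> carrier Q" for x
    using that unfolding Q q_def FactRing_def A_RCOSETS_def' by (auto simp: A FactRing_def A_RCOSETS_def' Cs)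
  have RK: "R \<subseteq> (\<lambda>p. I +>\<^bsub>C\<^esub> p) ` K"
    unfolding R_def richardson_ideal_def A_def[symmetric]
  proof (rule A.genideal_minimal)
    show "ideal ((\<lambda>p. I +>\<^bsub>C\<^esub> p) ` K) A" unfolding A by (rule C.ring_ideal_imp_quot_ideal[OF Iid Kid])
    show "pluecker_coord k n ` (k_subsets k n - subset_interval k n \<beta> \<gamma>) \<subseteq> (\<lambda>p. I +>\<^bsub>C\<^esub> p) ` K"
      using out by (auto simp: pluecker_coord_def I_def[symmetric] C_def[symmetric] K_def V_def
          intro!: imageI mvar_in_mpolys)
  qed
  have IA: "I +>\<^bsub>C\<^esub> p \<in> carrier A" if "p \<in> mpolys V" for p
    using that by (auto simp: A FactRing_def A_RCOSETS_def' Cs)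
  have Q0: "\<zero>\<^bsub>Q\<^esub> = R" by (simp add: Q FactRing_def)
  have q0: "q p = \<zero>\<^bsub>Q\<^esub> \<longleftrightarrow> I +>\<^bsub>C\<^esub> p \<in> R" if "p \<in> mpolys V" for p
    unfolding Q0 q_def
    using A.a_rcos_zero[OF Rid] R.a_rcos_self[OF IA[OF that]] by blast
  have kerq: "\<psi> p = 0" if p: "p \<in> mpolys V" "q p = \<zero>\<^bsub>Q\<^esub>" for p
  proof -
    have "I +>\<^bsub>C\<^esub> p \<in> R" using q0 p by blast
    then obtain p' where p': "p' \<in> K" "I +>\<^bsub>C\<^esub> p = I +>\<^bsub>C\<^esub> p'" using RK by blast
    have "p \<in> I +>\<^bsub>C\<^esub> p'" using I.a_rcos_self[of p] p p' by (simp add: Cs)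
    then obtain i where i: "i \<in> I" "p = i + p'" unfolding a_r_coset_def' by (auto simp: Cs)
    then show ?thesis using p' pl I by (auto simp: K_def \<psi>.hom_add)
  qed
  define \<phi> where "\<phi> x = \<psi> (SOME p. p \<in> mpolys V \<and> q p = x)" for x
  have \<phi>q: "\<phi> (q p) = \<psi> p" if p: "p \<in> mpolys V" for p
  proof -
    define p' where "p' = (SOME p'. p' \<in> mpolys V \<and> q p' = q p)"
    have p': "p' \<in> mpolys V \<and> q p' = q p" unfolding p'_def by (rule someI[of _ p]) (use p in simp)
    have d: "p - p' \<in> mpolys V" using is_subring_diff[OF is_subring_mpolys] p p' by blast
    have "q p = q ((p - p') + p')" by simp
    also have "\<dots> = q (p - p') \<oplus>\<^bsub>Q\<^esub> q p'" using q.hom_add[of "p - p'" p'] d p' by (simp add: Cs)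
    finally have "q p' = q (p - p') \<oplus>\<^bsub>Q\<^esub> q p'" using p' by simp
    then have "q (p - p') = \<zero>\<^bsub>Q\<^esub>"
      using d p' q.hom_closed[of p'] q.hom_closed[of "p - p'"] by (simp add: Cs Q.add.r_cancel_one')
    then have "\<psi> (p - p') = 0" using kerq d by blast
    then show ?thesis unfolding \<phi>_def p'_def[symmetric] by (simp add: \<psi>.hom_minus)
  qed
  define S where "S = {(q (mvar \<beta>) [^]\<^bsub>Q\<^esub> i) \<otimes>\<^bsub>Q\<^esub> (q (mvar \<gamma>) [^]\<^bsub>Q\<^esub> j) | (i::nat) (j::nat). True}"
  have R_mp: "is_subring (mpolys V :: (nat set, 'k) mpoly set)" by (rule is_subring_mpolys)
  have \<beta>\<gamma>: "mvar \<beta> \<in> (mpolys V :: (nat set, 'k) mpoly set)"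
    "mvar \<gamma> \<in> (mpolys V :: (nat set, 'k) mpoly set)" using \<beta> \<gamma> by (auto intro: mvar_in_mpolys)
  have mon: "mvar \<beta> ^ i * mvar \<gamma> ^ j \<in> (mpolys V :: (nat set, 'k) mpoly set)" for i j
    by (intro is_subring_mult[OF R_mp] is_subring_power[OF R_mp] \<beta>\<gamma>)
  have qpow: "q (p ^ i) = q p [^]\<^bsub>Q\<^esub> i" if "p \<in> mpolys V" for p and i :: nat
  proof (induction i)
    case 0 then show ?case using q.hom_one by (simp add: Cs)
  next
    case (Suc i)
    then show ?case using q.hom_mult[of "p ^ i" p] that is_subring_power[OF R_mp that, of i]
      by (simp add: Cs mult.commute)
  qed
  have qmult: "q (a * b) = q a \<otimes>\<^bsub>Q\<^esub> q b" if "a \<in> mpolys V" "b \<in> mpolys V" for a b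
    using q.hom_mult[of a b] that by (simp add: Cs)
  have qadd: "q (a + b) = q a \<oplus>\<^bsub>Q\<^esub> q b" if "a \<in> mpolys V" "b \<in> mpolys V" for a b
    using q.hom_add[of a b] that by (simp add: Cs)
  have q1: "q 1 = \<one>\<^bsub>Q\<^esub>" using q.hom_one by (simp add: Cs)
  have S: "s \<in> S \<longleftrightarrow> (\<exists>i j. s = q (mvar \<beta> ^ i * mvar \<gamma> ^ j))" for s
  proof -
    have "q (mvar \<beta> ^ i * mvar \<gamma> ^ j) = (q (mvar \<beta>) [^]\<^bsub>Q\<^esub> i) \<otimes>\<^bsub>Q\<^esub> (q (mvar \<gamma>) [^]\<^bsub>Q\<^esub> j)" for i j
      using \<beta>\<gamma> by (simp add: qmult qpow is_subring_power[OF R_mp])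
    then show ?thesis unfolding S_def by simp
  qed
  have qc: "q p \<in> carrier Q" if "p \<in> mpolys V" for p using q.hom_closed[of p] that by (simp add: Cs)
  have "open_richardson_ring TYPE('k) k n \<beta> \<gamma> = localization Q S"
    unfolding open_richardson_ring_def invert2_def richardson_coord_def pluecker_coord_def S_def q_def
      Q_def R_def A_def I_def C_def ..
  moreover have "factorial_domain (localization Q S)"
  proof (rule factorial_domain_localization[of _ _ \<phi>])
    show "cring Q" by unfold_locales
    show "S \<subseteq> carrier Q" using S qc mon by auto
    show "\<one>\<^bsub>Q\<^esub> \<in> S" unfolding S by (intro exI[of _ 0]) (simp add: q1)
    show "s \<otimes>\<^bsub>Q\<^esub> t \<in> S" if "s \<in> S" "t \<in> S" for s t
    proof -
      obtain i j i' j' where *: "s = q (mvar \<beta> ^ i * mvar \<gamma> ^ j)" "t = q (mvar \<beta> ^ i' * mvar \<gamma> ^ j')"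
        using \<open>s \<in> S\<close> \<open>t \<in> S\<close> unfolding S by blast
      have "s \<otimes>\<^bsub>Q\<^esub> t = q ((mvar \<beta> ^ i * mvar \<gamma> ^ j) * (mvar \<beta> ^ i' * mvar \<gamma> ^ j'))"
        unfolding * by (rule qmult[symmetric, OF mon mon])
      also have "\<dots> = q (mvar \<beta> ^ (i + i') * mvar \<gamma> ^ (j + j'))" by (simp add: power_add mult_ac)
      finally show ?thesis unfolding S by blast
    qed
    show "\<phi> \<one>\<^bsub>Q\<^esub> = 1" using \<phi>q[OF is_subring_one[OF R_mp]] by (simp add: q1)
    show "\<phi> (x \<oplus>\<^bsub>Q\<^esub> y) = \<phi> x + \<phi> y" "\<phi> (x \<otimes>\<^bsub>Q\<^esub> y) = \<phi> x * \<phi> y"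
      if xy: "x \<in> carrier Q" "y \<in> carrier Q" for x y
    proof -
      obtain a b where ab: "a \<in> mpolys V" "b \<in> mpolys V" "x = q a" "y = q b" using surj xy by blast
      show "\<phi> (x \<oplus>\<^bsub>Q\<^esub> y) = \<phi> x + \<phi> y"
        using ab \<phi>q is_subring_add[OF R_mp ab(1,2)] by (simp add: \<psi>.hom_add flip: qadd)
      show "\<phi> (x \<otimes>\<^bsub>Q\<^esub> y) = \<phi> x * \<phi> y"
        using ab \<phi>q is_subring_mult[OF R_mp ab(1,2)] by (simp add: \<psi>.hom_mult flip: qmult)
    qed
    show "\<phi> s \<noteq> 0" if "s \<in> S" for s
      using that \<psi>\<beta> \<psi>\<gamma> \<phi>q[OF mon] unfolding S by (auto simp: \<psi>.hom_mult \<psi>.hom_power)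
    show "\<exists>t\<in>S. t \<otimes>\<^bsub>Q\<^esub> x = \<zero>\<^bsub>Q\<^esub>" if x: "x \<in> carrier Q" "\<phi> x = 0" for x
    proof -
      obtain p where p: "p \<in> mpolys V" "x = q p" using surj x by blast
      have "pluecker_closed k n \<beta> \<gamma> {p \<in> mpolys V. q p = \<zero>\<^bsub>Q\<^esub>}"
        unfolding pluecker_closed_def V_def[symmetric]
      proof (intro conjI ballI impI)
        show "0 \<in> {p \<in> mpolys V. q p = \<zero>\<^bsub>Q\<^esub>}" using q.hom_zero is_subring_zero[OF R_mp] by (simp add: Cs)
        show "a + b \<in> {p \<in> mpolys V. q p = \<zero>\<^bsub>Q\<^esub>}"
          if "a \<in> {p \<in> mpolys V. q p = \<zero>\<^bsub>Q\<^esub>}" "b \<in> {p \<in> mpolys V. q p = \<zero>\<^bsub>Q\<^esub>}" for a b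
          using that is_subring_add[OF R_mp] by (simp add: qadd)
        show "r * a \<in> {p \<in> mpolys V. q p = \<zero>\<^bsub>Q\<^esub>}"
          if "a \<in> {p \<in> mpolys V. q p = \<zero>\<^bsub>Q\<^esub>}" "r \<in> mpolys V" for a r
          using that is_subring_mult[OF R_mp] by (simp add: qmult qc)
        show "p \<in> {p \<in> mpolys V. q p = \<zero>\<^bsub>Q\<^esub>}"
          if pp: "p \<in> mpolys V" "mpoly_subst (generic_minor k) p = 0" for p
        proof -
          have "p \<in> I" using I pp by blast
          then have "I +>\<^bsub>C\<^esub> p = \<zero>\<^bsub>A\<^esub>" using I.a_rcos_const by (simp add: A FactRing_def)
          then show ?thesis using pp q0 R.zero_closed by simp
        qed
        show "mvar \<alpha> \<in> {p \<in> mpolys V. q p = \<zero>\<^bsub>Q\<^esub>}" if "\<alpha> \<in> V - subset_interval k n \<beta> \<gamma>" for \<alpha>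
        proof -
          have "I +>\<^bsub>C\<^esub> mvar \<alpha> \<in> R" unfolding R_def richardson_ideal_def A_def[symmetric]
          proof (rule subsetD[OF A.genideal_self])
            show "pluecker_coord k n ` (k_subsets k n - subset_interval k n \<beta> \<gamma>) \<subseteq> carrier A"
              by (rule gens)
            show "I +>\<^bsub>C\<^esub> mvar \<alpha> \<in> pluecker_coord k n ` (k_subsets k n - subset_interval k n \<beta> \<gamma>)"
              using that by (auto simp: pluecker_coord_def I_def C_def V_def)
          qed
          then show ?thesis using q0 that by (simp add: mvar_in_mpolys)
        qed
      qed auto
      moreover have "\<psi> p = 0" using x(2) p(2) \<phi>q[OF p(1)] by simp
      ultimately obtain i j where "mvar \<beta> ^ i * mvar \<gamma> ^ j * p \<in> {p \<in> mpolys V. q p = \<zero>\<^bsub>Q\<^esub>}"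
        using ker[OF _ p(1)] by blast
      then have "q (mvar \<beta> ^ i * mvar \<gamma> ^ j) \<otimes>\<^bsub>Q\<^esub> x = \<zero>\<^bsub>Q\<^esub>"
        using qmult[OF mon p(1)] p(2) by simp
      then show ?thesis using S by blast
    qed
    have "{\<phi> x / \<phi> s |x s. x \<in> carrier Q \<and> s \<in> S}
        = {\<psi> p / (\<psi> (mvar \<beta>) ^ i * \<psi> (mvar \<gamma>) ^ j) |p i j. p \<in> mpolys V}"
    proof -
      have "\<phi> (q p) / \<phi> (q (mvar \<beta> ^ i * mvar \<gamma> ^ j)) = \<psi> p / (\<psi> (mvar \<beta>) ^ i * \<psi> (mvar \<gamma>) ^ j)"
        if "p \<in> mpolys V" for p i j
        using \<phi>q[OF mon] \<phi>q[OF that] by (simp add: \<psi>.hom_mult \<psi>.hom_power)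
      note eq = this
      show ?thesis
      proof (intro equalityI subsetI)
        fix y assume "y \<in> {\<phi> x / \<phi> s |x s. x \<in> carrier Q \<and> s \<in> S}"
        then obtain x s where xs: "x \<in> carrier Q" "s \<in> S" "y = \<phi> x / \<phi> s" by blast
        obtain p where p: "p \<in> mpolys V" "x = q p" using surj xs(1) by blast
        obtain i j where "s = q (mvar \<beta> ^ i * mvar \<gamma> ^ j)" using xs(2) unfolding S by blast
        then have "y = \<psi> p / (\<psi> (mvar \<beta>) ^ i * \<psi> (mvar \<gamma>) ^ j)" using eq[OF p(1)] xs(3) p(2) by simp
        then show "y \<in> {\<psi> p / (\<psi> (mvar \<beta>) ^ i * \<psi> (mvar \<gamma>) ^ j) |p i j. p \<in> mpolys V}"
          using p(1) by blast
      next
        fix y assume "y \<in> {\<psi> p / (\<psi> (mvar \<beta>) ^ i * \<psi> (mvar \<gamma>) ^ j) |p i j. p \<in> mpolys V}"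
        then obtain p i j where p: "p \<in> mpolys V"
          "y = \<psi> p / (\<psi> (mvar \<beta>) ^ i * \<psi> (mvar \<gamma>) ^ j)" by blast
        have "y = \<phi> (q p) / \<phi> (q (mvar \<beta> ^ i * mvar \<gamma> ^ j))" using eq[OF p(1)] p(2) by simp
        moreover have "q (mvar \<beta> ^ i * mvar \<gamma> ^ j) \<in> S" unfolding S by blast
        ultimately show "y \<in> {\<phi> x / \<phi> s |x s. x \<in> carrier Q \<and> s \<in> S}" using qc[OF p(1)] by blast
      qed
    qed
    then show "ufd_on {\<phi> x / \<phi> s |x s. x \<in> carrier Q \<and> s \<in> S}" using T by simp
  qed
  ultimately show ?thesis by simp
qed

section \<open>Minors\<close>

text \<open>The determinant formed by the first \<open>k\<close> rows of \<open>X\<close> and the columns \<open>c 0, \<dots>, c (k - 1)\<close>, in this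
order and possibly with repetitions. Rows are numbered from \<open>0\<close>.\<close>

definition minor :: "nat \<Rightarrow> (nat \<Rightarrow> nat \<Rightarrow> 'a::comm_ring_1) \<Rightarrow> (nat \<Rightarrow> nat) \<Rightarrow> 'a" where
  "minor k X c = det (mat k k (\<lambda>(i, j). X i (c j)))"

lemma minor_cong:
  assumes "\<And>i j. i < k \<Longrightarrow> j < k \<Longrightarrow> X i (c j) = Y i (d j)"
  shows "minor k X c = minor k Y d"
  unfolding minor_def by (rule arg_cong[of _ _ det], rule eq_matI) (use assms in auto)

lemma hom_minor:
  assumes "comm_ring_hom h" shows "h (minor k X c) = minor k (\<lambda>i j. h (X i j)) c"
proof -
  interpret h: comm_ring_hom h by fact
  have "map_mat h (mat k k (\<lambda>(i, j). X i (c j))) = mat k k (\<lambda>(i, j). h (X i (c j)))"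
    by (rule eq_matI) auto
  then show ?thesis unfolding minor_def using h.hom_det by metis
qed

lemma minor_leibniz:
  "minor k X c = (\<Sum>p | p permutes {0..<k}. signof p * (\<Prod>i=0..<k. X i (c (p i))))"
proof -
  have "(\<Prod>i=0..<k. mat k k (\<lambda>(i, j). X i (c j)) $$ (i, p i)) = (\<Prod>i=0..<k. X i (c (p i)))"
    if "p permutes {0..<k}" for p
    using permutes_in_image[OF that] by (intro prod.cong refl) auto
  then show ?thesis unfolding minor_def by (subst det_def'[of _ k]) (auto intro!: sum.cong)
qed

lemma minor_scale_rows:
  "minor k (\<lambda>i j. s i * X i j) c = (\<Prod>i=0..<k. s i) * minor k X c"
  by (simp add: minor_leibniz prod.distrib sum_distrib_left mult_ac)

lemma minor_repeat:
  assumes "i < k" "j < k" "i \<noteq> j" "c i = c j" shows "minor k X c = 0"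
  unfolding minor_def
  by (rule det_identical_columns[of _ k i j]) (use assms in \<open>auto intro!: eq_vecI\<close>)

lemma minor_permute:
  assumes p: "p permutes {0..<k}"
  shows "minor k X (\<lambda>j. c (p j)) = signof p * minor k X c"
proof -
  let ?A = "transpose_mat (mat k k (\<lambda>(i, j). X i (c j)))"
  have "minor k X (\<lambda>j. c (p j)) = det (transpose_mat (mat k k (\<lambda>(i, j). X i (c (p j)))))"
    unfolding minor_def by (rule det_transpose[symmetric, of _ k]) auto
  also have "transpose_mat (mat k k (\<lambda>(i, j). X i (c (p j)))) = mat k k (\<lambda>(i, j). ?A $$ (p i, j))"
    by (rule eq_matI) (use permutes_in_image[OF p] in auto)
  also have "det \<dots> = signof p * det ?A" by (rule det_permute_rows[OF _ p]) auto
  also have "det ?A = minor k X c" unfolding minor_def by (rule det_transpose[of _ k]) auto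
  finally show ?thesis .
qed

lemma minor_mult:
  "minor k (\<lambda>i j. \<Sum>l=0..<k. M i (c l) * W l j) d = minor k M c * minor k W d"
proof -
  have "mat k k (\<lambda>(i, j). \<Sum>l=0..<k. M i (c l) * W l (d j))
      = mat k k (\<lambda>(i, j). M i (c j)) * mat k k (\<lambda>(i, j). W i (d j))"
    by (rule eq_matI) (auto simp: scalar_prod_def)
  then show ?thesis unfolding minor_def by (simp add: det_mult[of _ k])
qed

lemma minor_zero_block:
  assumes R: "R \<subseteq> {0..<k}" and C: "C \<subseteq> {0..<k}" and card: "k < card R + card C"
    and zero: "\<And>i j. i \<in> R \<Longrightarrow> j \<in> C \<Longrightarrow> X i (c j) = 0"
  shows "minor k X c = 0"
  unfolding minor_leibniz
proof (rule sum.neutral, rule ballI)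
  fix p assume "p \<in> {p. p permutes {0..<k}}"
  then have p: "p permutes {0..<k}" by simp
  have fin: "finite R" "finite C" using R C finite_subset by auto
  have "p ` R \<inter> C \<noteq> {}"
  proof
    assume "p ` R \<inter> C = {}"
    then have "card (p ` R \<union> C) = card (p ` R) + card C" using fin by (intro card_Un_disjoint) auto
    also have "card (p ` R) = card R" by (rule card_image) (rule inj_on_subset[OF permutes_inj[OF p]], simp)
    finally have "card R + card C = card (p ` R \<union> C)" ..
    also have "\<dots> \<le> card {0..<k}"
      using R C permutes_image[OF p] by (intro card_mono) auto
    finally show False using card by simp
  qed
  then obtain i where i: "i \<in> R" "p i \<in> C" by blast
  then have "(\<Prod>i=0..<k. X i (c (p i))) = 0" using zero R by (intro prod_zero) auto
  then show "signof p * (\<Prod>i=0..<k. X i (c (p i))) = 0" by simp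
qed

text \<open>Cramer's rule for the column \<open>j\<close> of \<open>X\<close>.\<close>

lemma minor_cramer:
  assumes i: "i < k"
  shows "(\<Sum>l=0..<k. X i (c l) * minor k X (c(l := j))) = minor k X c * X i j"
proof -
  define A where "A = mat k k (\<lambda>(i, j). X i (c j))"
  have A: "A \<in> carrier_mat k k" by (simp add: A_def)
  have expand: "minor k X (c(l := j)) = (\<Sum>r=0..<k. X r j * cofactor A r l)" if l: "l < k" for l
  proof -
    let ?B = "mat k k (\<lambda>(i, j'). X i ((c(l := j)) j'))"
    have "minor k X (c(l := j)) = (\<Sum>r<k. ?B $$ (r, l) * cofactor ?B r l)"
      unfolding minor_def by (rule laplace_expansion_column) (use l in auto)
    also have "\<dots> = (\<Sum>r<k. X r j * cofactor A r l)"
    proof (rule sum.cong[OF refl])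
      fix r assume r: "r \<in> {..<k}"
      have "mat_delete ?B r l = mat_delete A r l"
        unfolding mat_delete_def A_def by (rule eq_matI) (use r l in auto)
      then show "?B $$ (r, l) * cofactor ?B r l = X r j * cofactor A r l"
        using r l by (simp add: cofactor_def)
    qed
    finally show ?thesis by (simp add: atLeast0LessThan)
  qed
  have adj: "(\<Sum>l=0..<k. X i (c l) * cofactor A r l) = (if i = r then det A else 0)" if r: "r < k" for r
  proof -
    have "(A * adj_mat A) $$ (i, r) = (\<Sum>l=0..<k. X i (c l) * cofactor A r l)"
      using i r by (auto simp: A_def adj_mat_def scalar_prod_def intro!: sum.cong)
    then show ?thesis using adj_mat(2)[OF A] i r by auto
  qed
  have "(\<Sum>l=0..<k. X i (c l) * minor k X (c(l := j)))
      = (\<Sum>l=0..<k. \<Sum>r=0..<k. X r j * (X i (c l) * cofactor A r l))"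
    by (rule sum.cong[OF refl]) (simp add: expand sum_distrib_left mult_ac)
  also have "\<dots> = (\<Sum>r=0..<k. X r j * (\<Sum>l=0..<k. X i (c l) * cofactor A r l))"
    by (subst sum.swap) (simp add: sum_distrib_left)
  also have "\<dots> = (\<Sum>r=0..<k. X r j * (if i = r then det A else 0))"
    by (intro sum.cong refl) (simp add: adj)
  also have "\<dots> = det A * X i j" using i by (simp add: if_distrib mult.commute cong: if_cong)
  finally show ?thesis by (simp add: minor_def A_def)
qed

text \<open>The matrix of numerators in Cramer's rule is the adjugate of the block with columns \<open>b\<close>, times \<open>X\<close>.
Its minors are therefore those of \<open>X\<close>, up to a power of the minor \<open>b\<close>.\<close>

lemma minor_of_cramer:
  fixes X :: "nat \<Rightarrow> nat \<Rightarrow> 'a::idom"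
  assumes k: "1 \<le> k" and b: "minor k X b \<noteq> 0"
  shows "minor k (\<lambda>l j. minor k X (b(l := j))) c = minor k X b ^ (k - 1) * minor k X c"
proof -
  have "minor k X b * minor k (\<lambda>l j. minor k X (b(l := j))) c
      = minor k (\<lambda>i j. \<Sum>l=0..<k. X i (b l) * minor k X (b(l := j))) c"
    by (rule minor_mult[symmetric])
  also have "\<dots> = minor k (\<lambda>i j. minor k X b * X i j) c"
    by (rule minor_cong) (simp add: minor_cramer)
  also have "\<dots> = minor k X b * (minor k X b ^ (k - 1) * minor k X c)"
    using k by (simp add: minor_scale_rows flip: power_Suc mult.assoc)
  finally show ?thesis using b by simp
qed

section \<open>Pluecker coordinates of column sequences\<close>

text \<open>The elements of \<open>\<alpha>\<close> in increasing order, numbered from \<open>0\<close>.\<close>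

definition enum :: "nat set \<Rightarrow> nat \<Rightarrow> nat" where
  "enum \<alpha> j = elt \<alpha> (j + 1)"

lemma enum_mem:
  assumes "\<alpha> \<in> k_subsets k n" "j < k" shows "enum \<alpha> j \<in> {1..n}"
  using elt_Suc_mem(2)[OF assms] by (simp add: enum_def)

text \<open>The generic matrix; its rows are numbered from \<open>0\<close>, the row indices of its variables from \<open>1\<close>.\<close>

definition generic_entry :: "nat \<Rightarrow> nat \<Rightarrow> (nat \<times> nat, 'k::field) mpoly" where
  "generic_entry i j = mvar (i + 1, j)"

lemma generic_minor_eq: "generic_minor k \<alpha> = minor k generic_entry (enum \<alpha>)"
  by (simp add: generic_minor_def minor_def generic_entry_def enum_def)

lemma generic_minor_nonzero:
  assumes c: "inj_on c {0..<k}"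
  shows "minor k (generic_entry :: _ \<Rightarrow> _ \<Rightarrow> (nat \<times> nat, 'k::field) mpoly) c \<noteq> 0"
proof
  assume 0: "minor k (generic_entry :: _ \<Rightarrow> _ \<Rightarrow> (nat \<times> nat, 'k) mpoly) c = 0"
  have id: "comm_ring_hom (\<lambda>x :: 'k. x)" by unfold_locales auto
  define h :: "(nat \<times> nat, 'k) mpoly \<Rightarrow> 'k" where
    "h = meval (\<lambda>x. x) (\<lambda>(i, j). if j = c (i - 1) then 1 else 0)"
  have h: "comm_ring_hom h" unfolding h_def by (rule comm_ring_hom_meval[OF id])
  interpret h: comm_ring_hom h by fact
  have "0 = minor k (\<lambda>i j. h (generic_entry i j)) c" using hom_minor[OF h] 0 h.hom_zero by metis
  also have "\<dots> = det (1\<^sub>m k)" unfolding minor_def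
    by (rule arg_cong[of _ _ det], rule eq_matI)
       (use c in \<open>auto simp: generic_entry_def h_def meval_mvar[OF id] inj_on_def\<close>)
  finally show False by simp
qed

lemma bij_betw_enum:
  assumes "\<alpha> \<in> k_subsets k n" shows "bij_betw (enum \<alpha>) {0..<k} \<alpha>"
proof -
  have fin: "finite \<alpha>" and card: "card \<alpha> = k"
    using finite_k_subset[OF assms] assms by (auto simp: k_subsets_def)
  have "bij_betw (\<lambda>j. sorted_list_of_set \<alpha> ! j) {..<k} \<alpha>"
    by (rule bij_betw_nth) (use fin card in auto)
  then show ?thesis by (simp add: enum_def[abs_def] elt_def atLeast0LessThan)
qed

lemma enum_strict_mono:
  assumes "\<alpha> \<in> k_subsets k n" "i < j" "j < k" shows "enum \<alpha> i < enum \<alpha> j"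
proof -
  have "length (sorted_list_of_set \<alpha>) = k" using assms by (simp add: k_subsets_def)
  then show ?thesis
    using sorted_wrt_nth_less[OF strict_sorted_list_of_set, of i j \<alpha>] assms by (simp add: enum_def elt_def)
qed

text \<open>The Pluecker coordinate of a sequence of columns: zero for repeated columns, otherwise the
coordinate of the set of columns with the sign of the sorting permutation. The sign is not computed;
it is chosen such that the generic minor is the image of the coordinate.\<close>

definition pluecker_sequence :: "nat \<Rightarrow> (nat \<Rightarrow> nat) \<Rightarrow> (nat set, 'k::field) mpoly" where
  "pluecker_sequence k c =
     (if \<not> inj_on c {0..<k} then 0
      else if minor k generic_entry c = (generic_minor k (c ` {0..<k}) :: (nat \<times> nat, 'k) mpoly)
        then mvar (c ` {0..<k})
      else - mvar (c ` {0..<k}))"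

lemma minor_generic_sequence:
  assumes c: "inj_on c {0..<k}" "c ` {0..<k} \<subseteq> {1..n}"
  shows "minor k generic_entry c = (generic_minor k (c ` {0..<k}) :: (nat \<times> nat, 'k::field) mpoly) \<or>
         minor k generic_entry c = (- generic_minor k (c ` {0..<k}) :: (nat \<times> nat, 'k) mpoly)"
proof -
  let ?\<alpha> = "c ` {0..<k}"
  have \<alpha>: "?\<alpha> \<in> k_subsets k n" using c by (simp add: k_subsets_def card_image)
  note e = bij_betw_enum[OF \<alpha>]
  define p where "p j = (if j < k then inv_into {0..<k} (enum ?\<alpha>) (c j) else j)" for j
  have ep: "enum ?\<alpha> (p j) = c j" if "j < k" for j
    using that bij_betw_inv_into_right[OF e, of "c j"] by (simp add: p_def)
  have "bij_betw (\<lambda>j. inv_into {0..<k} (enum ?\<alpha>) (c j)) {0..<k} {0..<k}"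
    using bij_betw_trans[OF _ bij_betw_inv_into[OF e], of c "{0..<k}"] c
    by (simp add: bij_betw_def comp_def)
  then have "bij_betw p {0..<k} {0..<k}" by (subst bij_betw_cong[of _ p]) (auto simp: p_def)
  then have p: "p permutes {0..<k}" by (rule bij_imp_permutes) (simp add: p_def)
  have "minor k generic_entry c = (minor k generic_entry (\<lambda>j. enum ?\<alpha> (p j)) :: (nat \<times> nat, 'k) mpoly)"
    by (rule minor_cong) (simp only: ep)
  also have "\<dots> = signof p * generic_minor k ?\<alpha>" unfolding generic_minor_eq by (rule minor_permute[OF p])
  finally show ?thesis by (cases "evenperm p") (simp_all add: sign_def)
qed

lemma subst_pluecker_sequence:
  assumes c: "c ` {0..<k} \<subseteq> {1..n}"
  shows "mpoly_subst (generic_minor k) (pluecker_sequence k c) =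
    (minor k generic_entry c :: (nat \<times> nat, 'k::field) mpoly)"
proof -
  interpret h: comm_ring_hom "mpoly_subst (generic_minor k) :: _ \<Rightarrow> (nat \<times> nat, 'k) mpoly"
    unfolding mpoly_subst_eq_meval by (rule comm_ring_hom_meval[OF comm_ring_hom_mconst])
  have v: "mpoly_subst (generic_minor k) (mvar \<alpha>) = (generic_minor k \<alpha> :: (nat \<times> nat, 'k) mpoly)" for \<alpha>
    by (simp add: mpoly_subst_eq_meval meval_mvar comm_ring_hom_mconst)
  show ?thesis
  proof (cases "inj_on c {0..<k}")
    case True
    then show ?thesis using minor_generic_sequence[OF True c, where ?'k='k]
      by (auto simp: pluecker_sequence_def v h.hom_uminus True)
  next
    case False
    then obtain i j where "i < k" "j < k" "i \<noteq> j" "c i = c j" by (auto simp: inj_on_def)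
    then show ?thesis using False minor_repeat[of i k j c] by (simp add: pluecker_sequence_def)
  qed
qed

lemma pluecker_sequence_enum:
  assumes "\<alpha> \<in> k_subsets k n" shows "pluecker_sequence k (enum \<alpha>) = mvar \<alpha>"
  using bij_betw_enum[OF assms] by (simp add: pluecker_sequence_def bij_betw_def generic_minor_eq)

lemma pluecker_sequence_in_mpolys:
  assumes "c ` {0..<k} \<subseteq> {1..n}" shows "pluecker_sequence k c \<in> mpolys (k_subsets k n)"
proof -
  have "mvar (c ` {0..<k}) \<in> mpolys (k_subsets k n)" if "inj_on c {0..<k}"
    using that assms by (intro mvar_in_mpolys) (simp add: k_subsets_def card_image)
  then show ?thesis
    using is_subring_uminus[OF is_subring_mpolys] is_subring_zero[OF is_subring_mpolys]
    unfolding pluecker_sequence_def by auto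
qed

section \<open>Normalizing the generic echelon matrix\<close>

lemma sum_enum:
  assumes "\<alpha> \<in> k_subsets k n" shows "(\<Sum>i=0..<k. enum \<alpha> i) = \<Sum>\<alpha>"
  using sum.reindex_bij_betw[OF bij_betw_enum[OF assms], of "\<lambda>x. x"] by simp

lemma subset_le_enum: "subset_le k \<alpha> \<alpha>' \<longleftrightarrow> (\<forall>i<k. enum \<alpha> i \<le> enum \<alpha>' i)"
proof
  assume "subset_le k \<alpha> \<alpha>'" then show "\<forall>i<k. enum \<alpha> i \<le> enum \<alpha>' i"
    by (auto simp: subset_le_def enum_def)
next
  assume *: "\<forall>i<k. enum \<alpha> i \<le> enum \<alpha>' i"
  show "subset_le k \<alpha> \<alpha>'" unfolding subset_le_def
  proof
    fix i assume "i \<in> {1..k}"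
    then have "i - 1 < k" "i - 1 + 1 = i" by auto
    then show "elt \<alpha> i \<le> elt \<alpha>' i" using * unfolding enum_def by metis
  qed
qed

text \<open>The data of an open Richardson variety. The argument \<open>K\<close> only names the ground field.\<close>

locale richardson =
  fixes k n :: nat and \<beta> \<gamma> :: "nat set" and K :: "'k::field itself"
  assumes k1: "1 \<le> k" and \<beta>: "\<beta> \<in> k_subsets k n" and \<gamma>: "\<gamma> \<in> k_subsets k n"
    and le: "subset_le k \<beta> \<gamma>"
begin

abbreviation "V \<equiv> k_subsets k n"
abbreviation "b \<equiv> enum \<beta>"
abbreviation "c \<equiv> enum \<gamma>"

lemma b_le_c: "i < k \<Longrightarrow> b i \<le> c i" using le by (simp only: subset_le_enum)
lemma b_less: "i < j \<Longrightarrow> j < k \<Longrightarrow> b i < b j" by (rule enum_strict_mono[OF \<beta>])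
lemma c_less: "i < j \<Longrightarrow> j < k \<Longrightarrow> c i < c j" by (rule enum_strict_mono[OF \<gamma>])
lemma b_range: "i < k \<Longrightarrow> b i \<in> {1..n}" by (rule enum_mem[OF \<beta>])
lemma c_range: "i < k \<Longrightarrow> c i \<in> {1..n}" by (rule enum_mem[OF \<gamma>])

definition x0 :: "(nat, 'k) mpoly" where "x0 = mvar 0"

text \<open>The generic matrix in echelon form with pivot columns \<open>\<beta>\<close>, all pivots being equal to the variable
\<open>x0\<close>. Variables are indexed by natural numbers, which are linearly ordered; this makes the polynomials an
instance of integral domains. The variable \<open>x0\<close> has index \<open>0\<close>, which no pair \<open>(i + 1, j)\<close> encodes.\<close>

definition M :: "nat \<Rightarrow> nat \<Rightarrow> (nat, 'k) mpoly" where
  "M i j = (if j < b i then 0 else if j = b i then x0 else mvar (prod_encode (i + 1, j)))"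

text \<open>The minor of \<open>M\<close> at \<open>\<gamma>\<close>.\<close>

definition D :: "(nat, 'k) mpoly" where "D = minor k M c"

text \<open>Let \<open>M\<^sub>\<gamma>\<close> be the block of columns \<open>\<gamma>\<close>. The entry \<open>(l, j)\<close> of \<open>D M\<^sub>\<gamma>\<^sup>-\<^sup>1 M\<close> is a minor by Cramer's rule.
Replacing it by zero for \<open>j > c l\<close> and multiplying by \<open>M\<^sub>\<gamma>\<close> again gives \<open>H\<close>. Up to the factor \<open>D\<close>, it
arises from \<open>M\<close> by subtracting multiples of the columns in \<open>\<gamma>\<close> from columns further to the right. This
keeps the echelon form and the pivots, and the columns in \<open>\<gamma>\<close>, but it kills the minors not below \<open>\<gamma>\<close>.\<close>

definition H :: "nat \<Rightarrow> nat \<Rightarrow> (nat, 'k) mpoly" where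
  "H i j = (\<Sum>l=0..<k. M i (c l) * (if c l < j then 0 else minor k M (c(l := j))))"

lemma prod_encode_Suc_nonzero: "prod_encode (i + 1, j) \<noteq> 0"
proof
  assume "prod_encode (i + 1, j) = 0"
  then have "prod_encode (i + 1, j) = prod_encode (0, 0)" by (simp add: prod_encode_def)
  then show False by (simp only: prod_encode_eq) simp
qed

lemma x0_nonzero: "x0 \<noteq> 0"
  unfolding x0_def mvar_def by (metis lookup_single_eq lookup_zero zero_neq_one)

text \<open>Specialize \<open>x0\<close> and the variables in row \<open>i\<close> and column \<open>c i\<close> to one and all other variables to zero.
As \<open>\<beta> \<le> \<gamma>\<close>, the block of columns \<open>\<gamma>\<close> becomes lower triangular with ones on the diagonal.\<close>

lemma D_nonzero: "D \<noteq> 0"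
proof
  assume 0: "D = 0"
  have id: "comm_ring_hom (\<lambda>x :: 'k. x)" by unfold_locales auto
  define h :: "(nat, 'k) mpoly \<Rightarrow> 'k" where
    "h = meval (\<lambda>x. x) (\<lambda>x. if x = 0 then 1 else case prod_decode x of (i, j) \<Rightarrow> if j = c (i - 1) then 1 else 0)"
  have h: "comm_ring_hom h" unfolding h_def by (rule comm_ring_hom_meval[OF id])
  interpret h: comm_ring_hom h by fact
  have hM: "h (M i j) = (if j < b i then 0 else if j = b i then 1 else if j = c i then 1 else 0)" for i j
    using prod_encode_Suc_nonzero[of i j] by (auto simp: M_def x0_def h_def meval_mvar[OF id] h.hom_zero[unfolded h_def])
  define A where "A = mat k k (\<lambda>(i, j). h (M i (c j)))"
  have A: "A \<in> carrier_mat k k" by (simp add: A_def)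
  have "det A = prod_list (diag_mat A)"
  proof (rule det_lower_triangular[OF _ A])
    fix i j assume ij: "i < j" "j < k"
    then have "c i < c j" "b i \<le> c i" using c_less[of i j] b_le_c[of i] by auto
    then show "A $$ (i, j) = 0" using ij by (simp add: A_def hM)
  qed
  also have "diag_mat A = map (\<lambda>i. 1) [0..<k]" unfolding diag_mat_def
  proof (rule map_cong)
    show "[0..<dim_row A] = [0..<k]" by (simp add: A_def)
    fix i assume "i \<in> set [0..<k]"
    then show "A $$ (i, i) = 1" using b_le_c[of i] by (auto simp: A_def hM)
  qed
  also have "prod_list \<dots> = 1" by (simp add: map_replicate_const)
  finally have "h D = 1" unfolding D_def hom_minor[OF h] by (simp add: minor_def A_def)
  then show False using 0 h.hom_zero by simp
qed

lemma H_eq: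
  assumes i: "i < k"
  shows "H i j = D * M i j - (\<Sum>l=0..<k. if c l < j then M i (c l) * minor k M (c(l := j)) else 0)"
proof -
  have "H i j + (\<Sum>l=0..<k. if c l < j then M i (c l) * minor k M (c(l := j)) else 0)
     = (\<Sum>l=0..<k. M i (c l) * minor k M (c(l := j)))"
    unfolding H_def sum.distrib[symmetric] by (rule sum.cong) auto
  also have "\<dots> = D * M i j" unfolding D_def by (rule minor_cramer[OF i])
  finally show ?thesis by (simp add: algebra_simps)
qed

lemma M_below: "j < b i \<Longrightarrow> M i j = 0" by (simp add: M_def)

lemma H_at_most_pivot:
  assumes i: "i < k" and j: "j \<le> b i" shows "H i j = D * M i j"
proof -
  have "(\<Sum>l=0..<k. if c l < j then M i (c l) * minor k M (c(l := j)) else 0) = 0"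
    using j by (intro sum.neutral) (auto simp: M_below)
  then show ?thesis by (simp add: H_eq[OF i])
qed

lemma H_below: "i < k \<Longrightarrow> j < b i \<Longrightarrow> H i j = 0"
  by (simp add: H_at_most_pivot M_below)

lemma H_gamma:
  assumes i: "i < k" and j: "j < k" shows "H i (c j) = D * M i (c j)"
proof -
  have "(\<Sum>l=0..<k. if c l < c j then M i (c l) * minor k M (c(l := c j)) else 0) = 0"
  proof (rule sum.neutral, rule ballI)
    fix l assume l: "l \<in> {0..<k}"
    show "(if c l < c j then M i (c l) * minor k M (c(l := c j)) else 0) = 0"
      using minor_repeat[of l k j "c(l := c j)" M] l j by auto
  qed
  then show ?thesis by (simp add: H_eq[OF i])
qed

lemma minor_H_beta: "minor k H b = (D * x0) ^ k"
proof -
  define A where "A = mat k k (\<lambda>(i, j). H i (b j))"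
  have A: "A \<in> carrier_mat k k" by (simp add: A_def)
  have "det A = prod_list (diag_mat A)"
    by (rule det_upper_triangular[OF _ A]) (use H_below b_less in \<open>auto simp: A_def upper_triangular_def\<close>)
  also have "diag_mat A = map (\<lambda>i. D * x0) [0..<k]"
    unfolding diag_mat_def by (rule map_cong) (auto simp: A_def H_at_most_pivot M_def)
  also have "prod_list \<dots> = (D * x0) ^ k" by (simp add: map_replicate_const)
  finally show ?thesis by (simp add: minor_def A_def)
qed

lemma minor_H_gamma: "minor k H c = D ^ k * D"
proof -
  have "minor k H c = minor k (\<lambda>i j. D * M i j) c" by (rule minor_cong) (simp only: H_gamma)
  then show ?thesis by (simp add: minor_scale_rows D_def)
qed

text \<open>Both order relations force a block of zeros that is too large for a nonzero determinant.\<close>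

lemma minor_H_outside:
  assumes "\<alpha> \<in> V - subset_interval k n \<beta> \<gamma>" shows "minor k H (enum \<alpha>) = 0"
proof -
  have \<alpha>: "\<alpha> \<in> V" using assms by simp
  note mono = enum_strict_mono[OF \<alpha>]
  have mono_le: "enum \<alpha> i \<le> enum \<alpha> j" if "i \<le> j" "j < k" for i j
    using mono[of i j] that by (cases "i = j") auto
  have "\<not> subset_le k \<beta> \<alpha> \<or> \<not> subset_le k \<alpha> \<gamma>" using assms by (auto simp: subset_interval_def)
  then show ?thesis
  proof
    assume "\<not> subset_le k \<beta> \<alpha>"
    then obtain i where i: "i < k" "enum \<alpha> i < b i" by (auto simp: subset_le_enum not_le)
    show ?thesis
    proof (rule minor_zero_block[of "{i..<k}" k "{0..<Suc i}"])
      fix r j assume "r \<in> {i..<k}" "j \<in> {0..<Suc i}"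
      then have rj: "i \<le> r" "r < k" "j \<le> i" by auto
      have "enum \<alpha> j \<le> enum \<alpha> i" using mono_le rj i by blast
      moreover have "b i \<le> b r" using b_less[of i r] rj by (cases "i = r") auto
      ultimately have "enum \<alpha> j < b r" using i by linarith
      then show "H r (enum \<alpha> j) = 0" using H_below rj by blast
    qed (use i in auto)
  next
    assume "\<not> subset_le k \<alpha> \<gamma>"
    then obtain i where i: "i < k" "c i < enum \<alpha> i" by (auto simp: subset_le_enum not_le)
    define W where "W l j = (if c l < j then 0 else minor k M (c(l := j)))" for l j
    have "minor k H (enum \<alpha>) = minor k (\<lambda>i j. \<Sum>l=0..<k. M i (c l) * W l j) (enum \<alpha>)"
      by (rule minor_cong) (simp add: H_def W_def)
    also have "\<dots> = minor k M c * minor k W (enum \<alpha>)" by (rule minor_mult)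
    also have "minor k W (enum \<alpha>) = 0"
    proof (rule minor_zero_block[of "{0..<Suc i}" k "{i..<k}"])
      fix r j assume "r \<in> {0..<Suc i}" "j \<in> {i..<k}"
      then have rj: "r \<le> i" "i \<le> j" "j < k" by auto
      have "enum \<alpha> i \<le> enum \<alpha> j" using mono_le rj by blast
      moreover have "c r \<le> c i" using c_less[of r i] rj i by (cases "r = i") auto
      ultimately have "c r < enum \<alpha> j" using i by linarith
      then show "W r (enum \<alpha> j) = 0" by (simp only: W_def if_True)
    qed (use i in auto)
    finally show ?thesis by simp
  qed
qed

section \<open>The Richardson coordinate ring inside a field\<close>

text \<open>The embedding of the ground field.\<close>

definition \<kappa> :: "'k \<Rightarrow> (nat, 'k) mpoly fract" where "\<kappa> a = to_fract (mconst a)"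

lemma comm_ring_hom_to_fract: "comm_ring_hom (to_fract :: 'a::idom \<Rightarrow> 'a fract)"
  by unfold_locales auto

lemma hom_\<kappa>: "comm_ring_hom \<kappa>"
  unfolding \<kappa>_def[abs_def] by (rule comm_ring_hom_compose[OF comm_ring_hom_to_fract comm_ring_hom_mconst])

text \<open>The denominator by which the minors of \<open>H\<close> are divided. The factor \<open>D ^ k\<close> undoes the scaling of \<open>H\<close>
by \<open>D\<close>; the power of \<open>x0\<close> makes \<open>\<Delta>\<^sub>\<beta>\<close> go to \<open>x0\<close>.\<close>

definition E :: "(nat, 'k) mpoly" where "E = D ^ k * x0 ^ (k - 1)"

lemma E_nonzero: "E \<noteq> 0" using D_nonzero x0_nonzero by (simp add: E_def)

text \<open>Pluecker coordinates of the normalized matrix.\<close>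

definition \<psi> :: "(nat set, 'k) mpoly \<Rightarrow> (nat, 'k) mpoly fract" where
  "\<psi> = meval \<kappa> (\<lambda>\<alpha>. to_fract (minor k H (enum \<alpha>)) / to_fract E)"

lemma hom_\<psi>: "comm_ring_hom \<psi>" unfolding \<psi>_def by (rule comm_ring_hom_meval[OF hom_\<kappa>])

sublocale \<psi>: comm_ring_hom \<psi> by (rule hom_\<psi>)

lemma \<psi>_mvar: "\<psi> (mvar \<alpha>) = to_fract (minor k H (enum \<alpha>)) / to_fract E"
  by (simp add: \<psi>_def meval_mvar[OF hom_\<kappa>])

lemma to_fract_power: "to_fract (x ^ m) = to_fract (x :: 'a::idom) ^ m"
  by (induction m) auto

lemma \<psi>_beta: "\<psi> (mvar \<beta>) = to_fract x0"
proof -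
  have "(D * x0) ^ k = x0 * E"
    using k1 by (simp add: E_def power_mult_distrib mult_ac power_eq_if[of x0 k])
  then show ?thesis using E_nonzero by (simp add: \<psi>_mvar minor_H_beta)
qed

lemma \<psi>_gamma: "\<psi> (mvar \<gamma>) * to_fract x0 ^ (k - 1) = to_fract D"
proof -
  have "\<psi> (mvar \<gamma>) * to_fract x0 ^ (k - 1) = to_fract (D ^ k * D * x0 ^ (k - 1)) / to_fract E"
    by (simp add: \<psi>_mvar minor_H_gamma to_fract_power)
  also have "D ^ k * D * x0 ^ (k - 1) = D * E" by (simp add: E_def mult_ac)
  finally show ?thesis using E_nonzero by simp
qed

lemma \<psi>_outside: "\<alpha> \<in> V - subset_interval k n \<beta> \<gamma> \<Longrightarrow> \<psi> (mvar \<alpha>) = 0"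
  by (simp only: \<psi>_mvar minor_H_outside) simp

text \<open>The values of \<open>\<psi>\<close> on the coordinates are the maximal minors of a matrix over the field: \<open>H\<close> with row \<open>i\<close>
divided by \<open>s i\<close>. Hence \<open>\<psi>\<close> factors through the map to the generic minors.\<close>

lemma \<psi>_kernel:
  assumes p: "p \<in> mpolys V" and 0: "mpoly_subst (generic_minor k) p = 0"
  shows "\<psi> p = 0"
proof -
  define s where "s i = (if i = 0 then D * x0 ^ (k - 1) else D)" for i :: nat
  define Y where "Y i j = inverse (to_fract (s i)) * to_fract (H i j)" for i j
  have ps: "(\<Prod>i=0..<k. s i) = E"
  proof -
    have "(\<Prod>i=0..<k. s i) = s 0 * (\<Prod>i\<in>{0..<k}-{0}. s i)" using k1 by (intro prod.remove) auto
    also have "(\<Prod>i\<in>{0..<k}-{0}. s i) = (\<Prod>i\<in>{0..<k}-{0}. D)" by (rule prod.cong) (auto simp: s_def)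
    also have "\<dots> = D ^ (k - 1)" using k1 by simp
    also have "s 0 * D ^ (k - 1) = E" using k1 by (simp add: s_def E_def mult_ac power_eq_if[of D k])
    finally show ?thesis .
  qed
  have inv: "(\<Prod>i\<in>A. inverse (to_fract (s i))) = inverse (to_fract (\<Prod>i\<in>A. s i))" for A
    by (induction A rule: infinite_finite_induct) auto
  have Y: "minor k Y e = to_fract (minor k H e) / to_fract E" for e
    unfolding Y_def[abs_def] minor_scale_rows inv ps
    by (simp add: hom_minor[OF comm_ring_hom_to_fract] divide_inverse mult.commute)
  define ev where "ev = meval \<kappa> (\<lambda>(i, j). Y (i - 1) j)"
  have ev: "comm_ring_hom ev" unfolding ev_def by (rule comm_ring_hom_meval[OF hom_\<kappa>])
  interpret ev: comm_ring_hom ev by fact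
  have sub: "comm_ring_hom (mpoly_subst (generic_minor k) :: _ \<Rightarrow> (nat \<times> nat, 'k) mpoly)"
    unfolding mpoly_subst_eq_meval by (rule comm_ring_hom_meval[OF comm_ring_hom_mconst])
  have "\<psi> p = ev (mpoly_subst (generic_minor k) p)"
  proof (rule hom_eq_on_mpolys[OF hom_\<psi> comm_ring_hom_compose[OF ev sub] _ _ p])
    show "\<psi> (mconst a) = ev (mpoly_subst (generic_minor k) (mconst a))" for a
      by (simp add: \<psi>_def ev_def mpoly_subst_eq_meval meval_mconst hom_\<kappa> comm_ring_hom_mconst)
    fix \<alpha>
    have "ev (mpoly_subst (generic_minor k) (mvar \<alpha>)) = minor k (\<lambda>i j. ev (generic_entry i j)) (enum \<alpha>)"
      by (simp add: mpoly_subst_eq_meval meval_mvar comm_ring_hom_mconst generic_minor_eq hom_minor[OF ev])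
    also have "\<dots> = minor k Y (enum \<alpha>)"
      by (rule minor_cong) (simp add: ev_def generic_entry_def meval_mvar[OF hom_\<kappa>])
    finally show "\<psi> (mvar \<alpha>) = ev (mpoly_subst (generic_minor k) (mvar \<alpha>))" by (simp only: \<psi>_mvar Y)
  qed
  then show ?thesis using 0 ev.hom_zero by simp
qed

section \<open>Recovering the matrix from its Pluecker coordinates\<close>

text \<open>The matrix with entry \<open>(i, j)\<close> equal to the Pluecker coordinate of \<open>\<beta>\<close> with its \<open>i\<close>-th element replaced by
\<open>j\<close>. By Cramer's rule it represents the same subspace as the generic matrix.\<close>

abbreviation N :: "nat \<Rightarrow> nat \<Rightarrow> (nat set, 'k) mpoly" where
  "N i j \<equiv> pluecker_sequence k (b(i := j))"

text \<open>The homomorphism with \<open>\<pi> (M i j) = N i j\<close> modulo the coordinates outside the interval. Variables whose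
index does not encode a position in a \<open>k \<times> n\<close> matrix go to zero, apart from \<open>x0\<close>.\<close>

definition \<pi> :: "(nat, 'k) mpoly \<Rightarrow> (nat set, 'k) mpoly" where
  "\<pi> = meval mconst (\<lambda>x. if x = 0 then mvar \<beta> else
     case prod_decode x of (i, j) \<Rightarrow> if i \<in> {1..k} \<and> j \<in> {1..n} then N (i - 1) j else 0)"

lemma hom_\<pi>: "comm_ring_hom \<pi>" unfolding \<pi>_def by (rule comm_ring_hom_meval[OF comm_ring_hom_mconst])

sublocale \<pi>: comm_ring_hom \<pi> by (rule hom_\<pi>)

lemma VR: "is_subring (mpolys V :: (nat set, 'k) mpoly set)" by (rule is_subring_mpolys)

lemma b_upd_range: "j \<in> {1..n} \<Longrightarrow> (b(i := j)) ` {0..<k} \<subseteq> {1..n}"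
  using b_range by (auto simp: image_subset_iff)

lemma N_in: "i < k \<Longrightarrow> j \<in> {1..n} \<Longrightarrow> N i j \<in> mpolys V"
  using b_range by (intro pluecker_sequence_in_mpolys) (auto simp: image_subset_iff)

lemma mvar_beta_gamma: "mvar \<beta> \<in> (mpolys V :: (nat set, 'k) mpoly set)"
  "mvar \<gamma> \<in> (mpolys V :: (nat set, 'k) mpoly set)"
  using \<beta> \<gamma> by (auto intro: mvar_in_mpolys)

lemma \<pi>_in: "\<pi> f \<in> mpolys V"
proof -
  have "f \<in> mpolys UNIV" by (simp add: mpolys_def)
  then show ?thesis
  proof (induction f rule: mpolys_induct)
    case (const a)
    then show ?case by (simp add: \<pi>_def meval_mconst comm_ring_hom_mconst mconst_in_mpolys)
  next
    case (var x)
    then show ?case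
      using mvar_beta_gamma(1) is_subring_zero[OF VR] N_in
      by (auto simp: \<pi>_def meval_mvar comm_ring_hom_mconst split: prod.split)
  qed (auto simp: \<pi>.hom_add \<pi>.hom_mult is_subring_add[OF VR] is_subring_mult[OF VR])
qed

lemma \<pi>_x0: "\<pi> x0 = mvar \<beta>"
  by (simp add: \<pi>_def x0_def meval_mvar comm_ring_hom_mconst)

context
  fixes J :: "(nat set, 'k) mpoly set"
  assumes J: "pluecker_closed k n \<beta> \<gamma> J"
begin

lemma
  shows J_zero: "0 \<in> J" and J_add: "x \<in> J \<Longrightarrow> y \<in> J \<Longrightarrow> x + y \<in> J"
    and J_mult: "x \<in> J \<Longrightarrow> r \<in> mpolys V \<Longrightarrow> r * x \<in> J"
    and J_kernel: "p \<in> mpolys V \<Longrightarrow> mpoly_subst (generic_minor k) p = 0 \<Longrightarrow> p \<in> J"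
    and J_outside: "\<alpha> \<in> V - subset_interval k n \<beta> \<gamma> \<Longrightarrow> mvar \<alpha> \<in> J"
    and J_sub: "J \<subseteq> mpolys V"
  using J unfolding pluecker_closed_def by blast+

lemma J_uminus: "x \<in> J \<Longrightarrow> - x \<in> J"
  using J_mult[of x "- 1"] is_subring_uminus[OF VR is_subring_one[OF VR]] by simp

text \<open>Congruence modulo \<open>J\<close>.\<close>

definition eqv :: "(nat set, 'k) mpoly \<Rightarrow> (nat set, 'k) mpoly \<Rightarrow> bool" where
  "eqv x y \<longleftrightarrow> x \<in> mpolys V \<and> y \<in> mpolys V \<and> x - y \<in> J"

lemma eqv_refl: "x \<in> mpolys V \<Longrightarrow> eqv x x" by (simp add: eqv_def J_zero)

lemma eqv_trans: "eqv x y \<Longrightarrow> eqv y z \<Longrightarrow> eqv x z"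
  using J_add[of "x - y" "y - z"] by (simp add: eqv_def)

lemma eqv_add: "eqv x y \<Longrightarrow> eqv x' y' \<Longrightarrow> eqv (x + x') (y + y')"
  using J_add[of "x - y" "x' - y'"] by (simp add: eqv_def is_subring_add[OF VR] add_diff_add)

lemma eqv_mult:
  assumes "eqv x y" "eqv x' y'" shows "eqv (x * x') (y * y')"
proof -
  have "x * x' - y * y' = x' * (x - y) + y * (x' - y')" by (simp add: algebra_simps)
  moreover have "x' * (x - y) + y * (x' - y') \<in> J"
    by (intro J_add J_mult) (use assms in \<open>auto simp: eqv_def\<close>)
  ultimately show ?thesis using assms by (simp add: eqv_def is_subring_mult[OF VR])
qed

lemma eqv_diff: "eqv x y \<Longrightarrow> eqv x' y' \<Longrightarrow> eqv (x - x') (y - y')"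
proof -
  assume *: "eqv x y" "eqv x' y'"
  have "x - x' - (y - y') = (x - y) + - (x' - y')" by simp
  moreover have "(x - y) + - (x' - y') \<in> J"
    by (intro J_add J_uminus) (use * in \<open>auto simp: eqv_def\<close>)
  ultimately have "x - x' - (y - y') \<in> J" by (simp only:)
  then show ?thesis using * by (simp add: eqv_def is_subring_diff[OF VR])
qed

lemma eqv_sum: "(\<And>i. i \<in> I \<Longrightarrow> eqv (f i) (g i)) \<Longrightarrow> eqv (sum f I) (sum g I)"
  by (induction I rule: infinite_finite_induct) (auto intro: eqv_add eqv_refl is_subring_zero[OF VR])

lemma eqv_prod: "(\<And>i. i \<in> I \<Longrightarrow> eqv (f i) (g i)) \<Longrightarrow> eqv (prod f I) (prod g I)"
  by (induction I rule: infinite_finite_induct) (auto intro: eqv_mult eqv_refl is_subring_one[OF VR])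

lemma eqv_power: "eqv x y \<Longrightarrow> eqv (x ^ m) (y ^ m)"
  by (induction m) (auto intro: eqv_mult eqv_refl is_subring_one[OF VR])

lemma eqv_minor:
  assumes "\<And>i j. i < k \<Longrightarrow> j < k \<Longrightarrow> eqv (X i (e j)) (Y i (e j))"
  shows "eqv (minor k X e) (minor k Y e)"
  unfolding minor_leibniz
proof (intro eqv_sum eqv_mult eqv_prod)
  fix p assume "p \<in> {p. p permutes {0..<k}}"
  then have p: "p permutes {0..<k}" by simp
  show "eqv (signof p) (signof p)"
    using is_subring_one[OF VR] is_subring_uminus[OF VR] by (intro eqv_refl) (auto simp: sign_def)
  fix i assume "i \<in> {0..<k}"
  then show "eqv (X i (e (p i))) (Y i (e (p i)))" using permutes_in_image[OF p, of i] assms by auto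
qed

text \<open>The sums of the elements serve as a simple obstruction: a set in the interval has a sum between those
of \<open>\<beta>\<close> and \<open>\<gamma>\<close>.\<close>

lemma sequence_outside:
  assumes e: "e ` {0..<k} \<subseteq> {1..n}"
    and sum: "(\<Sum>i=0..<k. e i) < \<Sum>\<beta> \<or> \<Sum>\<gamma> < (\<Sum>i=0..<k. e i)"
  shows "pluecker_sequence k e \<in> J"
proof -
  have "mvar (e ` {0..<k}) \<in> J" if inj: "inj_on e {0..<k}"
  proof (rule J_outside)
    let ?\<alpha> = "e ` {0..<k}"
    have \<alpha>: "?\<alpha> \<in> V" using e inj by (simp add: k_subsets_def card_image)
    have "\<Sum>?\<alpha> = (\<Sum>i=0..<k. e i)" using inj by (simp add: sum.reindex)
    then have s: "(\<Sum>i=0..<k. enum ?\<alpha> i) = (\<Sum>i=0..<k. e i)" using sum_enum[OF \<alpha>] by simp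
    have "\<not> (subset_le k \<beta> ?\<alpha> \<and> subset_le k ?\<alpha> \<gamma>)"
    proof
      assume "subset_le k \<beta> ?\<alpha> \<and> subset_le k ?\<alpha> \<gamma>"
      then have "(\<Sum>i=0..<k. b i) \<le> (\<Sum>i=0..<k. enum ?\<alpha> i)" "(\<Sum>i=0..<k. enum ?\<alpha> i) \<le> (\<Sum>i=0..<k. c i)"
        unfolding subset_le_enum by (auto intro!: sum_mono)
      then show False using sum s sum_enum[OF \<beta>] sum_enum[OF \<gamma>] by simp
    qed
    then show "?\<alpha> \<in> V - subset_interval k n \<beta> \<gamma>" using \<alpha> by (simp add: subset_interval_def)
  qed
  then show ?thesis using J_zero J_uminus by (auto simp: pluecker_sequence_def)
qed

lemma sum_fun_upd:
  fixes e :: "nat \<Rightarrow> nat"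
  assumes l: "l < k" shows "(\<Sum>i=0..<k. (e(l := j)) i) + e l = (\<Sum>i=0..<k. e i) + j"
proof -
  have "(\<Sum>i=0..<k. (e(l := j)) i) = j + (\<Sum>i\<in>{0..<k}-{l}. (e(l := j)) i)"
    using l by (subst sum.remove[of _ l]) auto
  also have "(\<Sum>i\<in>{0..<k}-{l}. (e(l := j)) i) = (\<Sum>i\<in>{0..<k}-{l}. e i)" by (rule sum.cong) auto
  finally show ?thesis using l sum.remove[of "{0..<k}" l e] by simp
qed

lemma \<pi>_M:
  assumes i: "i < k" and j: "j \<in> {1..n}" shows "eqv (\<pi> (M i j)) (N i j)"
proof -
  consider "j < b i" | "j = b i" | "b i < j" by linarith
  then show ?thesis
  proof cases
    case 1
    have "(\<Sum>l=0..<k. (b(i := j)) l) < \<Sum>\<beta>" using sum_fun_upd[OF i, of b j] sum_enum[OF \<beta>] 1 by linarith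
    then have "N i j \<in> J" using b_range j by (intro sequence_outside) auto
    then show ?thesis using 1 N_in[OF i j] J_uminus is_subring_zero[OF VR] by (simp add: M_def eqv_def \<pi>.hom_zero)
  next
    case 2
    have "N i j = mvar \<beta>" using pluecker_sequence_enum[OF \<beta>] 2 by simp
    then show ?thesis using 2 mvar_beta_gamma by (simp add: M_def \<pi>_x0 eqv_refl)
  next
    case 3
    then have "M i j = mvar (prod_encode (i + 1, j))" by (simp add: M_def)
    then have "\<pi> (M i j) = N i j"
      using i j prod_encode_Suc_nonzero[of i j] by (simp add: \<pi>_def meval_mvar comm_ring_hom_mconst)
    then show ?thesis using N_in[OF i j] by (simp add: eqv_refl)
  qed
qed

lemma minor_N:
  assumes e: "\<And>j. j < k \<Longrightarrow> e j \<in> {1..n}"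
  shows "eqv (minor k N e) (mvar \<beta> ^ (k - 1) * pluecker_sequence k e)"
proof -
  let ?sub = "mpoly_subst (generic_minor k) :: _ \<Rightarrow> (nat \<times> nat, 'k) mpoly"
  have hs: "comm_ring_hom ?sub"
    unfolding mpoly_subst_eq_meval by (rule comm_ring_hom_meval[OF comm_ring_hom_mconst])
  interpret sub: comm_ring_hom ?sub by fact
  have eI: "e ` {0..<k} \<subseteq> {1..n}" using e by auto
  have in1: "minor k N e \<in> mpolys V"
    unfolding minor_def by (rule is_subring_det[OF VR]) (use N_in e in auto)
  have in2: "mvar \<beta> ^ (k - 1) * pluecker_sequence k e \<in> (mpolys V :: (nat set, 'k) mpoly set)"
    using pluecker_sequence_in_mpolys[OF eI] mvar_beta_gamma
    by (intro is_subring_mult[OF VR] is_subring_power[OF VR])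
  have nz: "minor k (generic_entry :: _ \<Rightarrow> _ \<Rightarrow> (nat \<times> nat, 'k) mpoly) b \<noteq> 0"
    by (rule generic_minor_nonzero) (use bij_betw_enum[OF \<beta>] in \<open>simp add: bij_betw_def\<close>)
  have "?sub (minor k N e) = minor k (\<lambda>i j. ?sub (N i j)) e" by (rule hom_minor[OF hs])
  also have "\<dots> = minor k (\<lambda>i j. minor k generic_entry (b(i := j))) e"
    by (rule minor_cong, rule subst_pluecker_sequence, rule b_upd_range, rule e)
  also have "\<dots> = minor k generic_entry b ^ (k - 1) * minor k generic_entry e"
    by (rule minor_of_cramer[OF k1 nz])
  also have "\<dots> = ?sub (mvar \<beta> ^ (k - 1) * pluecker_sequence k e)"
    by (simp add: sub.hom_mult sub.hom_power subst_pluecker_sequence[OF eI])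
       (simp add: mpoly_subst_eq_meval meval_mvar comm_ring_hom_mconst generic_minor_eq)
  finally have "?sub (minor k N e - mvar \<beta> ^ (k - 1) * pluecker_sequence k e) = 0"
    by (simp add: sub.hom_minus)
  then have "minor k N e - mvar \<beta> ^ (k - 1) * pluecker_sequence k e \<in> J"
    by (intro J_kernel is_subring_diff[OF VR] in1 in2)
  then show ?thesis using in1 in2 by (simp add: eqv_def)
qed

lemma \<pi>_minor_M:
  assumes e: "\<And>j. j < k \<Longrightarrow> e j \<in> {1..n}"
  shows "eqv (\<pi> (minor k M e)) (mvar \<beta> ^ (k - 1) * pluecker_sequence k e)"
  unfolding hom_minor[OF hom_\<pi>]
  by (rule eqv_trans[OF eqv_minor minor_N]) (use \<pi>_M e in auto)

lemma \<pi>_D: "eqv (\<pi> D) (mvar \<beta> ^ (k - 1) * mvar \<gamma>)"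
  using \<pi>_minor_M[of c] c_range unfolding D_def pluecker_sequence_enum[OF \<gamma>] by blast

lemma \<pi>_cramer:
  assumes l: "l < k" and j: "j \<in> {1..n}" "c l < j"
  shows "eqv (\<pi> (minor k M (c(l := j)))) 0"
proof -
  have e: "(c(l := j)) i \<in> {1..n}" if "i < k" for i using c_range[OF that] j by auto
  have "\<Sum>\<gamma> < (\<Sum>i=0..<k. (c(l := j)) i)" using sum_fun_upd[OF l, of c j] sum_enum[OF \<gamma>] j by linarith
  moreover have "(c(l := j)) ` {0..<k} \<subseteq> {1..n}" using e by (auto simp del: fun_upd_apply)
  ultimately have "pluecker_sequence k (c(l := j)) \<in> J" by (intro sequence_outside) auto
  then have "mvar \<beta> ^ (k - 1) * pluecker_sequence k (c(l := j)) \<in> J"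
    by (intro J_mult is_subring_power[OF VR] mvar_beta_gamma)
  then have "eqv (mvar \<beta> ^ (k - 1) * pluecker_sequence k (c(l := j))) 0"
    using J_sub is_subring_zero[OF VR] by (auto simp: eqv_def)
  with \<pi>_minor_M[of "c(l := j)", OF e] show ?thesis by (rule eqv_trans)
qed

text \<open>Modulo \<open>J\<close> the matrix \<open>N\<close> is already normalized, as the Cramer minors that were dropped in \<open>H\<close> vanish.\<close>

lemma \<pi>_H:
  assumes i: "i < k" and j: "j \<in> {1..n}" shows "eqv (\<pi> (H i j)) (\<pi> D * N i j)"
proof -
  have "\<pi> (H i j) = \<pi> D * \<pi> (M i j) -
      (\<Sum>l=0..<k. if c l < j then \<pi> (M i (c l)) * \<pi> (minor k M (c(l := j))) else 0)"
    by (simp add: H_eq[OF i] \<pi>.hom_minus \<pi>.hom_mult \<pi>.hom_sum if_distrib[of \<pi>] \<pi>.hom_zero cong: if_cong)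
  moreover have "eqv (\<Sum>l=0..<k. if c l < j then \<pi> (M i (c l)) * \<pi> (minor k M (c(l := j))) else 0) (\<Sum>l=0..<k. 0)"
  proof (rule eqv_sum)
    fix l assume "l \<in> {0..<k}"
    then have l: "l < k" by simp
    show "eqv (if c l < j then \<pi> (M i (c l)) * \<pi> (minor k M (c(l := j))) else 0) 0"
    proof (cases "c l < j")
      case True
      have "eqv (\<pi> (M i (c l)) * \<pi> (minor k M (c(l := j)))) (\<pi> (M i (c l)) * 0)"
        by (intro eqv_mult eqv_refl \<pi>_in \<pi>_cramer l j True)
      then show ?thesis using True by (simp only: if_True mult_zero_right)
    next
      case False
      then show ?thesis using eqv_refl[OF is_subring_zero[OF VR]] by (simp only: if_False)
    qed
  qed
  moreover have "eqv (\<pi> D * \<pi> (M i j)) (\<pi> D * N i j)"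
    by (intro eqv_mult eqv_refl \<pi>_in \<pi>_M i j)
  ultimately show ?thesis using eqv_diff by fastforce
qed

lemma \<pi>_minor_H:
  assumes e: "\<And>j. j < k \<Longrightarrow> e j \<in> {1..n}"
  shows "eqv (\<pi> (minor k H e)) (mvar \<beta> ^ (k - 1) * \<pi> D ^ k * pluecker_sequence k e)"
proof -
  have "eqv (\<pi> (minor k H e)) (minor k (\<lambda>i j. \<pi> D * N i j) e)"
    unfolding hom_minor[OF hom_\<pi>] by (rule eqv_minor) (use \<pi>_H e in auto)
  moreover have "minor k (\<lambda>i j. \<pi> D * N i j) e = \<pi> D ^ k * minor k N e"
    by (simp add: minor_scale_rows)
  moreover have "eqv (\<pi> D ^ k * minor k N e) (\<pi> D ^ k * (mvar \<beta> ^ (k - 1) * pluecker_sequence k e))"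
    by (intro eqv_mult eqv_refl is_subring_power[OF VR] \<pi>_in minor_N e)
  ultimately show ?thesis using eqv_trans by (simp add: mult_ac)
qed

text \<open>Write \<open>\<psi> p\<close> as a fraction. Its numerator \<open>f\<close> and denominator, pulled back by \<open>\<pi>\<close>, represent \<open>p\<close> again,
modulo \<open>J\<close>. This is the identity \<open>\<pi> \<psi> = id\<close>, freed of denominators. It holds for the
coordinates and is inherited by sums and products.\<close>

lemma numerator:
  assumes "p \<in> mpolys V"
  shows "\<exists>f a e. \<psi> p * to_fract (x0 ^ a * D ^ e) = to_fract f \<and> eqv (\<pi> f) (mvar \<beta> ^ a * \<pi> D ^ e * p)"
  using assms
proof (induction p rule: mpolys_induct)
  case (const a)
  have "\<psi> (mconst a) = to_fract (mconst a)" by (simp add: \<psi>_def meval_mconst[OF hom_\<kappa>] \<kappa>_def)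
  moreover have "\<pi> (mconst a) = mconst a" by (simp add: \<pi>_def meval_mconst comm_ring_hom_mconst)
  ultimately show ?case
    by (intro exI[of _ "mconst a"] exI[of _ 0]) (simp add: eqv_refl mconst_in_mpolys)
next
  case (var \<alpha>)
  have "\<psi> (mvar \<alpha>) * to_fract (x0 ^ (k - 1) * D ^ k) = to_fract (minor k H (enum \<alpha>))"
    using E_nonzero by (simp add: \<psi>_mvar E_def mult.commute)
  moreover have "eqv (\<pi> (minor k H (enum \<alpha>))) (mvar \<beta> ^ (k - 1) * \<pi> D ^ k * mvar \<alpha>)"
    using \<pi>_minor_H[of "enum \<alpha>", OF enum_mem[OF var]] unfolding pluecker_sequence_enum[OF var] .
  ultimately show ?case by blast
next
  case (add p q)
  then obtain f a e f' a' e' where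
    f: "\<psi> p * to_fract (x0 ^ a * D ^ e) = to_fract f" "eqv (\<pi> f) (mvar \<beta> ^ a * \<pi> D ^ e * p)" and
    f': "\<psi> q * to_fract (x0 ^ a' * D ^ e') = to_fract f'" "eqv (\<pi> f') (mvar \<beta> ^ a' * \<pi> D ^ e' * q)"
    by blast
  let ?g = "f * (x0 ^ a' * D ^ e') + f' * (x0 ^ a * D ^ e)"
  have "\<psi> (p + q) * to_fract (x0 ^ (a + a') * D ^ (e + e')) =
      (\<psi> p * to_fract (x0 ^ a * D ^ e)) * to_fract (x0 ^ a' * D ^ e') +
      (\<psi> q * to_fract (x0 ^ a' * D ^ e')) * to_fract (x0 ^ a * D ^ e)"
    by (simp add: \<psi>.hom_add power_add algebra_simps)
  also have "\<dots> = to_fract ?g" unfolding f(1) f'(1) by simp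
  finally have 1: "\<psi> (p + q) * to_fract (x0 ^ (a + a') * D ^ (e + e')) = to_fract ?g" .
  have mon: "mvar \<beta> ^ a * \<pi> D ^ e \<in> mpolys V" for a e
    by (intro is_subring_mult[OF VR] is_subring_power[OF VR] mvar_beta_gamma \<pi>_in)
  have "\<pi> ?g = \<pi> f * (mvar \<beta> ^ a' * \<pi> D ^ e') + \<pi> f' * (mvar \<beta> ^ a * \<pi> D ^ e)"
    by (simp add: \<pi>.hom_add \<pi>.hom_mult \<pi>.hom_power \<pi>_x0)
  moreover have "eqv (\<pi> f * (mvar \<beta> ^ a' * \<pi> D ^ e') + \<pi> f' * (mvar \<beta> ^ a * \<pi> D ^ e))
      ((mvar \<beta> ^ a * \<pi> D ^ e * p) * (mvar \<beta> ^ a' * \<pi> D ^ e') + (mvar \<beta> ^ a' * \<pi> D ^ e' * q) * (mvar \<beta> ^ a * \<pi> D ^ e))"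
    by (intro eqv_add eqv_mult f(2) f'(2) eqv_refl mon)
  moreover have "(mvar \<beta> ^ a * \<pi> D ^ e * p) * (mvar \<beta> ^ a' * \<pi> D ^ e') + (mvar \<beta> ^ a' * \<pi> D ^ e' * q) * (mvar \<beta> ^ a * \<pi> D ^ e)
     = mvar \<beta> ^ (a + a') * \<pi> D ^ (e + e') * (p + q)" by (simp add: power_add algebra_simps)
  ultimately have "eqv (\<pi> ?g) (mvar \<beta> ^ (a + a') * \<pi> D ^ (e + e') * (p + q))" by simp
  then show ?case using 1 by blast
next
  case (mult p q)
  then obtain f a e f' a' e' where
    f: "\<psi> p * to_fract (x0 ^ a * D ^ e) = to_fract f" "eqv (\<pi> f) (mvar \<beta> ^ a * \<pi> D ^ e * p)" and
    f': "\<psi> q * to_fract (x0 ^ a' * D ^ e') = to_fract f'" "eqv (\<pi> f') (mvar \<beta> ^ a' * \<pi> D ^ e' * q)"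
    by blast
  have "\<psi> (p * q) * to_fract (x0 ^ (a + a') * D ^ (e + e')) =
      (\<psi> p * to_fract (x0 ^ a * D ^ e)) * (\<psi> q * to_fract (x0 ^ a' * D ^ e'))"
    by (simp add: \<psi>.hom_mult power_add mult_ac)
  also have "\<dots> = to_fract (f * f')" unfolding f(1) f'(1) by simp
  finally have 1: "\<psi> (p * q) * to_fract (x0 ^ (a + a') * D ^ (e + e')) = to_fract (f * f')" .
  have "eqv (\<pi> f * \<pi> f') ((mvar \<beta> ^ a * \<pi> D ^ e * p) * (mvar \<beta> ^ a' * \<pi> D ^ e' * q))"
    by (intro eqv_mult f f')
  moreover have "(mvar \<beta> ^ a * \<pi> D ^ e * p) * (mvar \<beta> ^ a' * \<pi> D ^ e' * q)
     = mvar \<beta> ^ (a + a') * \<pi> D ^ (e + e') * (p * q)" by (simp add: power_add mult_ac)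
  ultimately have "eqv (\<pi> (f * f')) (mvar \<beta> ^ (a + a') * \<pi> D ^ (e + e') * (p * q))"
    by (simp add: \<pi>.hom_mult)
  then show ?case using 1 by blast
qed

lemma kernel_torsion:
  assumes p: "p \<in> mpolys V" and 0: "\<psi> p = 0"
  shows "\<exists>i j. mvar \<beta> ^ i * mvar \<gamma> ^ j * p \<in> J"
proof -
  obtain f a e where f: "\<psi> p * to_fract (x0 ^ a * D ^ e) = to_fract f"
    "eqv (\<pi> f) (mvar \<beta> ^ a * \<pi> D ^ e * p)" using numerator[OF p] by blast
  have "f = 0" using f(1) 0 by simp
  then have *: "mvar \<beta> ^ a * \<pi> D ^ e * p \<in> J"
    using f(2) J_uminus[of "- (mvar \<beta> ^ a * \<pi> D ^ e * p)"] by (simp add: eqv_def \<pi>.hom_zero)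
  have "eqv (mvar \<beta> ^ a * \<pi> D ^ e * p) (mvar \<beta> ^ a * (mvar \<beta> ^ (k - 1) * mvar \<gamma>) ^ e * p)"
    by (intro eqv_mult eqv_power \<pi>_D eqv_refl p is_subring_power[OF VR] mvar_beta_gamma)
  then have "(mvar \<beta> ^ a * \<pi> D ^ e * p) + - (mvar \<beta> ^ a * \<pi> D ^ e * p -
      mvar \<beta> ^ a * (mvar \<beta> ^ (k - 1) * mvar \<gamma>) ^ e * p) \<in> J"
    using * unfolding eqv_def by (intro J_add J_uminus) auto
  also have "(mvar \<beta> ^ a * \<pi> D ^ e * p) + - (mvar \<beta> ^ a * \<pi> D ^ e * p -
      mvar \<beta> ^ a * (mvar \<beta> ^ (k - 1) * mvar \<gamma>) ^ e * p) =
      mvar \<beta> ^ (a + (k - 1) * e) * mvar \<gamma> ^ e * p"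
    by (simp add: power_add power_mult_distrib mult_ac flip: power_mult)
  finally show ?thesis by blast
qed

end

section \<open>The retraction\<close>

text \<open>With the kernel of \<open>\<psi>\<close> in the role of \<open>J\<close>, the preceding results say that \<open>\<psi> \<circ> \<pi>\<close> fixes \<open>x0\<close>, \<open>D\<close> and
the numerators of all values of \<open>\<psi>\<close>.\<close>

lemma pluecker_closed_kernel: "pluecker_closed k n \<beta> \<gamma> {p \<in> mpolys V. \<psi> p = 0}"
  unfolding pluecker_closed_def
proof (intro conjI ballI impI)
  show "p \<in> {p \<in> mpolys V. \<psi> p = 0}" if "p \<in> mpolys V" "mpoly_subst (generic_minor k) p = 0" for p
    using that \<psi>_kernel by simp
  show "mvar \<alpha> \<in> {p \<in> mpolys V. \<psi> p = 0}" if "\<alpha> \<in> V - subset_interval k n \<beta> \<gamma>" for \<alpha>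
    using that \<psi>_outside[OF that] by (simp add: mvar_in_mpolys)
qed (auto simp: \<psi>.hom_add \<psi>.hom_mult \<psi>.hom_zero is_subring_add[OF VR] is_subring_mult[OF VR] is_subring_zero[OF VR])

lemma \<psi>_eqv:
  assumes "eqv {p \<in> mpolys V. \<psi> p = 0} x y" shows "\<psi> x = \<psi> y"
  using assms unfolding eqv_def[OF pluecker_closed_kernel] by (simp add: \<psi>.hom_minus)

lemma \<psi>_\<pi>_D: "\<psi> (\<pi> D) = to_fract D"
  using \<psi>_eqv[OF \<pi>_D[OF pluecker_closed_kernel]] \<psi>_beta \<psi>_gamma
  by (simp add: \<psi>.hom_mult \<psi>.hom_power mult.commute)

lemma \<psi>_numerator:
  assumes p: "p \<in> mpolys V"
  shows "\<exists>f a e. \<psi> p = to_fract f / to_fract (x0 ^ a * D ^ e) \<and> \<psi> (\<pi> f) = to_fract f"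
proof -
  obtain f a e where f: "\<psi> p * to_fract (x0 ^ a * D ^ e) = to_fract f"
    "eqv {p \<in> mpolys V. \<psi> p = 0} (\<pi> f) (mvar \<beta> ^ a * \<pi> D ^ e * p)"
    using numerator[OF pluecker_closed_kernel p] by blast
  have "\<psi> (\<pi> f) = to_fract (x0 ^ a * D ^ e) * \<psi> p"
    using \<psi>_eqv[OF f(2)] by (simp add: \<psi>.hom_mult \<psi>.hom_power \<psi>_beta \<psi>_\<pi>_D to_fract_power)
  moreover have "to_fract (x0 ^ a * D ^ e) \<noteq> 0" using x0_nonzero D_nonzero by simp
  then have "\<psi> p = to_fract f / to_fract (x0 ^ a * D ^ e)" using f(1) by (metis nonzero_mult_div_cancel_right)
  ultimately show ?thesis using f(1) by (metis mult.commute)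
qed

text \<open>\<open>S\<close> is the polynomial ring with \<open>x0\<close> and \<open>D\<close> inverted, and \<open>r\<close> is the extension of \<open>\<psi> \<circ> \<pi>\<close> to \<open>S\<close>. The
image of the coordinate ring consists of the fractions with a numerator fixed by \<open>\<psi> \<circ> \<pi>\<close>, and \<open>r\<close>
retracts \<open>S\<close> onto it.\<close>

lemma ufd_image:
  "ufd_on {\<psi> p / (\<psi> (mvar \<beta>) ^ i * \<psi> (mvar \<gamma>) ^ j) |p i j. p \<in> mpolys V}" (is "ufd_on ?T")
proof -
  define d where "d = to_fract x0 * to_fract D"
  define S where "S = {f / d ^ m |f m. f \<in> range (to_fract :: (nat, 'k) mpoly \<Rightarrow> _)}"
  have d0: "d \<noteq> 0" using x0_nonzero D_nonzero by (simp add: d_def)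
  have x0': "to_fract x0 \<noteq> 0" and D': "to_fract D \<noteq> 0" using x0_nonzero D_nonzero by auto
  have "ufd_on (range (to_fract :: (nat, 'k) mpoly \<Rightarrow> _))"
    by (rule ufd_on_image(1)[OF ufd_on_UNIV_mpoly]) (auto intro: injI)
  then have S: "ufd_on S" unfolding S_def
    by (rule ufd_on_localization) (use d0 in \<open>auto simp: d_def simp flip: to_fract_mult\<close>)
  have rd: "\<psi> (\<pi> (x0 * D)) = d" by (simp add: \<pi>.hom_mult \<psi>.hom_mult \<pi>_x0 \<psi>_beta \<psi>_\<pi>_D d_def)
  have dd: "to_fract (x0 * D) = d" by (simp add: d_def)
  define r where "r y = (SOME z. \<exists>f m. y = to_fract f / d ^ m \<and> z = \<psi> (\<pi> f) / d ^ m)" for y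
  have r: "r (to_fract f / d ^ m) = \<psi> (\<pi> f) / d ^ m" for f m
    unfolding r_def
  proof (rule some_equality)
    fix z assume "\<exists>f' m'. to_fract f / d ^ m = to_fract f' / d ^ m' \<and> z = \<psi> (\<pi> f') / d ^ m'"
    then obtain f' m' where z: "to_fract f / d ^ m = to_fract f' / d ^ m'" "z = \<psi> (\<pi> f') / d ^ m'" by blast
    have "to_fract f * d ^ m' = to_fract f' * d ^ m" using z(1) d0 by (simp add: frac_eq_eq)
    then have "to_fract (f * (x0 * D) ^ m') = to_fract (f' * (x0 * D) ^ m)"
      unfolding dd[symmetric] by (simp add: to_fract_power)
    then have "\<psi> (\<pi> (f * (x0 * D) ^ m')) = \<psi> (\<pi> (f' * (x0 * D) ^ m))" by (simp only: to_fract_eq_iff)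
    then have "\<psi> (\<pi> f) * d ^ m' = \<psi> (\<pi> f') * d ^ m"
      unfolding \<pi>.hom_mult \<psi>.hom_mult \<pi>.hom_power \<psi>.hom_power
      unfolding \<pi>.hom_mult[symmetric] \<psi>.hom_mult[symmetric] rd .
    then show "z = \<psi> (\<pi> f) / d ^ m" unfolding z(2) using d0 by (simp add: frac_eq_eq)
  qed blast
  have d: "d = \<psi> (mvar \<beta>) ^ k * \<psi> (mvar \<gamma>)"
    using k1 by (simp add: d_def \<psi>_beta power_eq_if[of _ k] mult_ac flip: \<psi>_gamma)
  have T: "y \<in> ?T \<longleftrightarrow> (\<exists>f m. y = to_fract f / d ^ m \<and> \<psi> (\<pi> f) = to_fract f)" for y
  proof
    assume "y \<in> ?T"
    then obtain p i j where p: "p \<in> mpolys V" "y = \<psi> p / (\<psi> (mvar \<beta>) ^ i * \<psi> (mvar \<gamma>) ^ j)" by blast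
    obtain f a e where f: "\<psi> p = to_fract f / to_fract (x0 ^ a * D ^ e)" "\<psi> (\<pi> f) = to_fract f"
      using \<psi>_numerator[OF p(1)] by blast
    have g: "\<psi> (mvar \<gamma>) = to_fract D / to_fract x0 ^ (k - 1)" using \<psi>_gamma x0' by (simp add: field_simps)
    let ?g = "f * (x0 ^ ((k - 1) * j + e + j) * D ^ (a + i))"
    have "y = to_fract f / (to_fract x0 ^ a * to_fract D ^ e * (to_fract x0 ^ i * (to_fract D / to_fract x0 ^ (k - 1)) ^ j))"
      unfolding p(2) f(1) \<psi>_beta g by (simp add: to_fract_power)
    also have "\<dots> = to_fract ?g / d ^ (a + e + i + j)"
      unfolding d_def using x0' D'
      by (simp add: to_fract_power power_divide power_add power_mult_distrib field_simps flip: power_mult)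
    finally have "y = to_fract ?g / d ^ (a + e + i + j)" .
    moreover have "\<psi> (\<pi> ?g) = to_fract ?g"
      by (simp add: \<pi>.hom_mult \<psi>.hom_mult \<pi>.hom_power \<psi>.hom_power \<pi>_x0 \<psi>_beta \<psi>_\<pi>_D f(2) to_fract_power)
    ultimately show "\<exists>f m. y = to_fract f / d ^ m \<and> \<psi> (\<pi> f) = to_fract f" by blast
  next
    assume "\<exists>f m. y = to_fract f / d ^ m \<and> \<psi> (\<pi> f) = to_fract f"
    then obtain f m where f: "y = to_fract f / d ^ m" "\<psi> (\<pi> f) = to_fract f" by blast
    have "y = \<psi> (\<pi> f) / (\<psi> (mvar \<beta>) ^ (k * m) * \<psi> (mvar \<gamma>) ^ m)"
      unfolding f by (simp add: d power_mult_distrib power_mult)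
    then show "y \<in> ?T" using \<pi>_in by blast
  qed
  have rT: "\<psi> (\<pi> f) / d ^ m \<in> ?T" for f m
  proof -
    have "\<psi> (\<pi> f) / d ^ m = \<psi> (\<pi> f) / (\<psi> (mvar \<beta>) ^ (k * m) * \<psi> (mvar \<gamma>) ^ m)"
      by (simp add: d power_mult_distrib power_mult)
    then show ?thesis using \<pi>_in by blast
  qed
  show ?thesis
  proof (rule ufd_on_retract[OF S, of _ r])
    show "?T \<subseteq> S" unfolding S_def using T by blast
    show "is_subring ?T"
    proof (rule is_subringI)
      show "1 \<in> ?T" unfolding T by (intro exI[of _ 1] exI[of _ 0]) (simp add: \<pi>.hom_one \<psi>.hom_one)
      fix y z assume "y \<in> ?T" "z \<in> ?T"
      then obtain f m g l where *: "y = to_fract f / d ^ m" "\<psi> (\<pi> f) = to_fract f"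
        "z = to_fract g / d ^ l" "\<psi> (\<pi> g) = to_fract g" unfolding T by blast
      have "y - z = to_fract (f * (x0 * D) ^ l - g * (x0 * D) ^ m) / d ^ (m + l)"
        unfolding *(1,3) power_add to_fract_diff to_fract_mult to_fract_power
        unfolding to_fract_mult[symmetric] dd by (rule diff_frac_eq) (use d0 in auto)
      moreover have "\<psi> (\<pi> (f * (x0 * D) ^ l - g * (x0 * D) ^ m)) = to_fract (f * (x0 * D) ^ l - g * (x0 * D) ^ m)"
        by (simp add: \<pi>.hom_mult \<psi>.hom_mult \<pi>.hom_minus \<psi>.hom_minus \<pi>.hom_power \<psi>.hom_power \<pi>_x0 \<psi>_beta \<psi>_\<pi>_D * to_fract_power)
      ultimately show "y - z \<in> ?T" unfolding T by blast
      have "y * z = to_fract (f * g) / d ^ (m + l)" unfolding * by (simp add: power_add)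
      moreover have "\<psi> (\<pi> (f * g)) = to_fract (f * g)" by (simp add: \<pi>.hom_mult \<psi>.hom_mult *)
      ultimately show "y * z \<in> ?T" unfolding T by blast
    qed
    show "r y \<in> ?T" if "y \<in> S" for y
      using that r rT unfolding S_def by force
    show "r (y * z) = r y * r z" if yz: "y \<in> S" "z \<in> S" for y z
    proof -
      obtain f m g l where *: "y = to_fract f / d ^ m" "z = to_fract g / d ^ l"
        using yz unfolding S_def by blast
      have "y * z = to_fract (f * g) / d ^ (m + l)" unfolding * by (simp add: power_add)
      then have "r (y * z) = \<psi> (\<pi> (f * g)) / d ^ (m + l)" by (simp only: r)
      also have "\<dots> = r y * r z" unfolding * r by (simp add: \<pi>.hom_mult \<psi>.hom_mult power_add)
      finally show ?thesis .
    qed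
    show "r y = y" if "y \<in> ?T" for y
    proof -
      obtain f m where "y = to_fract f / d ^ m" "\<psi> (\<pi> f) = to_fract f" using \<open>y \<in> ?T\<close> unfolding T by blast
      then show ?thesis by (simp only: r)
    qed
  qed
qed

theorem open_richardson_ring_factorial: "factorial_domain (open_richardson_ring TYPE('k) k n \<beta> \<gamma>)"
proof (rule factorial_open_richardson_ring[OF hom_\<psi> \<beta> \<gamma>])
  show "\<psi> (mvar \<beta>) \<noteq> 0" using x0_nonzero by (simp add: \<psi>_beta)
  show "\<psi> (mvar \<gamma>) \<noteq> 0" using \<psi>_gamma D_nonzero by auto
qed (use \<psi>_kernel \<psi>_outside kernel_torsion ufd_image in auto)

end

theorem proposition2:
  fixes k n :: nat and \<beta> \<gamma> :: "nat set"
  assumes "1 \<le> k" and "k \<le> n"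
    and "\<beta> \<in> k_subsets k n" and "\<gamma> \<in> k_subsets k n"
    and "subset_le k \<beta> \<gamma>"
  shows "factorial_domain (open_richardson_ring TYPE('k::field) k n \<beta> \<gamma>)"
proof -
  interpret richardson k n \<beta> \<gamma> "TYPE('k)" by unfold_locales (use assms in auto)
  show ?thesis by (rule open_richardson_ring_factorial)
qed

end
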